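(* Let $\mathcal{X}=[0,1]$, $H\ge1$, and place on $f$ the local extrema spline prior described in the context (fixed order $j$, fixed $M\in\{-1,1\}$), and independently on $\sigma$ a prior assigning positive probability to every $\epsilon$-neighborhood of $\sigma_0$. Suppose $y_i\sim N\{f_0(x_i),\sigma_0^2\}$ independently, where either the design points $x_i$ are i.i.d. from a probability distribution $Q$ on $\mathcal{X}$ (random design), or they are fixed with $\max_{i<n}|x_i-x_{i+1}|<(K_1n)^{-1}$ for some $0<K_1<1$ (fixed design). Let $P_{f_0,\sigma_0}$ be the joint distribution of $\{y_i\}_{i\ge1}$ given $\{x_i\}_{i\ge1}$ and $\Pi_n$ the posterior given $y_1,\dots,y_n$. For $\epsilon>0$ let $Z_n=W_{\epsilon,n}$ in the fixed design case and $Z_n=U_\epsilon$ in the random design case. If $f_0\in\mathcal{F}^{H-1}$, then for every $\epsilon>0$, $\Pi_n\{(f,\sigma)\in Z_n^C\mid y_1,\dots,y_n\}\to0$ almost surely $[P_{f_0,\sigma_0}]$. Further, the same conclusion holds for $f_0\in\mathcal{F}^{H+}$ when $H$ is odd and $M<0$ or when $H$ is even and $M>0$, and for $f_0\in\mathcal{F}^{H-}$ when $H$ is odd and $M>0$ or when $H$ is even and $M<0$.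
   Context: $W_{\epsilon,n}=\{(f,\sigma):\int|f(x)-f_0(x)|\,dQ_n(x)<\epsilon,\ |\sigma/\sigma_0-1|<\epsilon\}$, where $Q_n$ is the empirical distribution of the design points $x_1,\dots,x_n$; $U_\epsilon=\{(f,\sigma):d_Q(f,f_0)<\epsilon,\ |\sigma/\sigma_0-1|<\epsilon\}$ with $d_Q(f_1,f_2)=\inf\{\epsilon>0:Q(\{x:|f_1(x)-f_2(x)|>\epsilon\})<\epsilon\}$. $\mathcal{F}^{G}$ is the set of continuously differentiable functions on $\mathcal{X}$ with $G$ or fewer local extrema interior to $\mathcal{X}$. $\mathcal{F}^{H+}$: continuously differentiable functions with at most $H$ interior local extrema such that those with exactly $H$ extrema have first extremum from the left a maximum, and those with fewer lie in $\mathcal{F}^{H-1}$; $\mathcal{F}^{H-}$: same with "minimum". Prior on $f$: knots from a branching process on the complete binary tree whose depth-$N$ nodes are labeled $\{a/2^{N+1}: a \text{ odd}, 1\le a\le 2^{N+1}-1\}$, node $a/2^{N+1}$ having children $(2a\pm1)/2^{N+2}$; starting from root $1/2$, each existing depth-$N$ node generates each child independently with probability $0.5^{N+1}$; generated labels plus end knots $0,1$ form the knot set with $K$ knots. Then $f(x)=\sum_{k=0}^{K+j-1}\beta_kB^{\ast}_{(j,k)}(x)$, $B^{\ast}_{(j,0)}=1$, $B^{\ast}_{(j,k)}(x)=M\int_{-\infty}^x\{\prod_{h=1}^H(\xi-\alpha_h)\}B_{(j,k)}(\xi)d\xi$ ($B_{(j,k)}$ order-$j$ B-splines on the knot set); $\beta_0\sim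 N(0,c)$; for $k\ge1$ independently $\beta_k=0$ with probability $\pi$, else $\beta_k\sim\mathrm{Exp}(\lambda)$; $\pi\sim\mathrm{Beta}(\nu,\omega)$; $\lambda\sim\mathrm{Gamma}(\delta,\kappa)$ truncated to $\lambda>\epsilon_0$ for fixed small $\epsilon_0>0$; $\alpha_h$ i.i.d. $N((b-a)/2,1)$ truncated to $[a,b]\supset\mathcal{X}$. *)

theory Defs
  imports "HOL-Probability.Probability"
begin

definition normal_measure :: "real \<Rightarrow> real \<Rightarrow> real measure" where
  "normal_measure mu sd = density lborel (\<lambda>x. ennreal (normal_density mu sd x))"

definition exp_measure :: "real \<Rightarrow> real measure" where
  "exp_measure l = density lborel (\<lambda>x. ennreal (exponential_density l x))"

definition gamma_dens :: "real \<Rightarrow> real \<Rightarrow> real \<Rightarrow> real" where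
  "gamma_dens d k x = (if x > 0 then k powr d * x powr (d - 1) * exp (- k * x) / Gamma d else 0)"

definition beta_dens :: "real \<Rightarrow> real \<Rightarrow> real \<Rightarrow> real" where
  "beta_dens v w x = (if 0 < x \<and> x < 1 then x powr (v - 1) * (1 - x) powr (w - 1) / Beta v w else 0)"

definition gamma_measure :: "real \<Rightarrow> real \<Rightarrow> real measure" where
  "gamma_measure d k = density lborel (\<lambda>x. ennreal (gamma_dens d k x))"

definition beta_measure :: "real \<Rightarrow> real \<Rightarrow> real measure" where
  "beta_measure v w = density lborel (\<lambda>x. ennreal (beta_dens v w x))"

definition truncate_to :: "'a measure \<Rightarrow> 'a set \<Rightarrow> 'a measure" where
  "truncate_to N A = density N (\<lambda>x. indicator A x / emeasure N A)"

definition spike_slab :: "real \<Rightarrow> real \<Rightarrow> real measure" where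
  "spike_slab p l = measure_pmf (bernoulli_pmf p) \<bind>
      (\<lambda>z. if z then return borel 0 else exp_measure l)"

text \<open>A node of depth N is labelled (N, a) meaning a / 2^(N+1), a odd.
  The coin c (N+1) a' decides whether the (unique) parent of the depth-(N+1)
  node a' generates it; it is Bernoulli(0.5^(N+1)).\<close>
fun node_exists :: "(nat \<times> nat \<Rightarrow> bool) \<Rightarrow> nat \<Rightarrow> nat \<Rightarrow> bool" where
  "node_exists c 0 a = (a = 1)"
| "node_exists c (Suc N) a' =
     (odd a' \<and> c (Suc N, a') \<and>
      (\<exists>a. odd a \<and> (a' + 1 = 2 * a \<or> a' = 2 * a + 1) \<and> node_exists c N a))"

definition knot_set :: "(nat \<times> nat \<Rightarrow> bool) \<Rightarrow> real set" where
  "knot_set c = {real a / 2 ^ (N + 1) | N a. node_exists c N a} \<union> {0, 1}"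

definition coin_prior :: "(nat \<times> nat \<Rightarrow> bool) measure" where
  "coin_prior = PiM UNIV (\<lambda>(m, a). measure_pmf (bernoulli_pmf ((1/2) ^ m)))"

text \<open>Order-p B-spline i on knot sequence t (Cox--de Boor; 0/0 = 0).\<close>
fun bspl :: "real list \<Rightarrow> nat \<Rightarrow> nat \<Rightarrow> real \<Rightarrow> real" where
  "bspl t i 0 x = 0"
| "bspl t i (Suc 0) x = (if t ! i \<le> x \<and> x < t ! Suc i then 1 else 0)"
| "bspl t i (Suc (Suc r)) x =
     (x - t ! i) / (t ! (i + r + 1) - t ! i) * bspl t i (Suc r) x
   + (t ! (i + r + 2) - x) / (t ! (i + r + 2) - t ! Suc i) * bspl t (Suc i) (Suc r) x"

text \<open>Extended knot sequence for order j: boundary knots repeated j times.\<close>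
definition ext_knots :: "nat \<Rightarrow> real set \<Rightarrow> real list" where
  "ext_knots j S = replicate (j - 1) 0 @ sorted_list_of_set S @ replicate (j - 1) 1"

definition num_bsplines :: "nat \<Rightarrow> real set \<Rightarrow> nat" where
  "num_bsplines j S = length (ext_knots j S) - j"

text \<open>B*_(j,k), k \<ge> 1 (uses the k-th B-spline, 0-based index k-1).\<close>
definition bstar :: "nat \<Rightarrow> nat \<Rightarrow> real \<Rightarrow> (nat \<Rightarrow> real) \<Rightarrow> real set \<Rightarrow> nat \<Rightarrow> real \<Rightarrow> real" where
  "bstar j H M alpha S k x =
     M * (LBINT xi:{..x}. (\<Prod>h<H. xi - alpha h) * bspl (ext_knots j S) (k - 1) j xi)"

definition spline_fun ::
  "nat \<Rightarrow> nat \<Rightarrow> real \<Rightarrow> (nat \<times> nat \<Rightarrow> bool) \<Rightarrow> (nat \<Rightarrow> real) \<Rightarrow> (nat \<Rightarrow> real) \<Rightarrow> real \<Rightarrow> real" where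
  "spline_fun j H M c beta alpha x =
     (let S = knot_set c in
      if finite S then beta 0 + (\<Sum>k=1..num_bsplines j S. beta k * bstar j H M alpha S k x)
      else 0)"

definition beta_coef_prior :: "real \<Rightarrow> real \<Rightarrow> real \<Rightarrow> real \<Rightarrow> real \<Rightarrow> real \<Rightarrow> (nat \<Rightarrow> real) measure" where
  "beta_coef_prior c v w d k eps0 =
     (beta_measure v w \<Otimes>\<^sub>M truncate_to (gamma_measure d k) {eps0<..}) \<bind>
       (\<lambda>(p, l). PiM UNIV (\<lambda>i. if i = 0 then normal_measure 0 (sqrt c) else spike_slab p l))"

definition alpha_prior :: "real \<Rightarrow> real \<Rightarrow> (nat \<Rightarrow> real) measure" where
  "alpha_prior a b = PiM UNIV (\<lambda>_. truncate_to (normal_measure ((b - a) / 2) 1) {a..b})"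

type_synonym param = "(nat \<times> nat \<Rightarrow> bool) \<times> (nat \<Rightarrow> real) \<times> (nat \<Rightarrow> real) \<times> real"

definition full_prior ::
  "real \<Rightarrow> real \<Rightarrow> real \<Rightarrow> real \<Rightarrow> real \<Rightarrow> real \<Rightarrow> real \<Rightarrow> real \<Rightarrow> real measure \<Rightarrow> param measure" where
  "full_prior c v w d k eps0 a b rho =
     coin_prior \<Otimes>\<^sub>M (beta_coef_prior c v w d k eps0 \<Otimes>\<^sub>M (alpha_prior a b \<Otimes>\<^sub>M rho))"

definition f_of :: "nat \<Rightarrow> nat \<Rightarrow> real \<Rightarrow> param \<Rightarrow> real \<Rightarrow> real" where
  "f_of j H M th = (case th of (cc, beta, alpha, s) \<Rightarrow> spline_fun j H M cc beta alpha)"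

definition sigma_of :: "param \<Rightarrow> real" where
  "sigma_of th = snd (snd (snd th))"

definition likelihood :: "(real \<Rightarrow> real) \<Rightarrow> real \<Rightarrow> nat \<Rightarrow> (nat \<Rightarrow> real) \<Rightarrow> (nat \<Rightarrow> real) \<Rightarrow> ennreal" where
  "likelihood f s n x y = (\<Prod>i<n. ennreal (normal_density (f (x i)) s (y i)))"

definition posterior ::
  "param measure \<Rightarrow> (param \<Rightarrow> real \<Rightarrow> real) \<Rightarrow> nat \<Rightarrow> (nat \<Rightarrow> real) \<Rightarrow> (nat \<Rightarrow> real)
   \<Rightarrow> ((real \<Rightarrow> real) \<Rightarrow> real \<Rightarrow> bool) \<Rightarrow> ennreal" where
  "posterior Pr F n x y P =
     (\<integral>\<^sup>+ th. indicator {th. P (F th) (sigma_of th)} th * likelihood (F th) (sigma_of th) n x y \<partial>Pr)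
     / (\<integral>\<^sup>+ th. likelihood (F th) (sigma_of th) n x y \<partial>Pr)"

definition data_dist :: "(real \<Rightarrow> real) \<Rightarrow> real \<Rightarrow> (nat \<Rightarrow> real) \<Rightarrow> (nat \<Rightarrow> real) measure" where
  "data_dist f0 s0 x = PiM UNIV (\<lambda>i. normal_measure (f0 (x i)) s0)"

definition W_nbhd :: "real \<Rightarrow> (nat \<Rightarrow> real) \<Rightarrow> nat \<Rightarrow> (real \<Rightarrow> real) \<Rightarrow> real \<Rightarrow> (real \<Rightarrow> real) \<Rightarrow> real \<Rightarrow> bool" where
  "W_nbhd e x n f0 s0 f s \<longleftrightarrow>
     (\<Sum>i<n. \<bar>f (x i) - f0 (x i)\<bar>) / real n < e \<and> \<bar>s / s0 - 1\<bar> < e"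

definition d_Q :: "real measure \<Rightarrow> (real \<Rightarrow> real) \<Rightarrow> (real \<Rightarrow> real) \<Rightarrow> real" where
  "d_Q Q f1 f2 = Inf {e. e > 0 \<and> measure Q {x. \<bar>f1 x - f2 x\<bar> > e} < e}"

definition U_nbhd :: "real \<Rightarrow> real measure \<Rightarrow> (real \<Rightarrow> real) \<Rightarrow> real \<Rightarrow> (real \<Rightarrow> real) \<Rightarrow> real \<Rightarrow> bool" where
  "U_nbhd e Q f0 s0 f s \<longleftrightarrow> d_Q Q f f0 < e \<and> \<bar>s / s0 - 1\<bar> < e"

definition C1_on01 :: "(real \<Rightarrow> real) \<Rightarrow> bool" where
  "C1_on01 f \<longleftrightarrow> (\<exists>f'. continuous_on {0..1} f' \<and>
      (\<forall>x\<in>{0..1}. (f has_real_derivative f' x) (at x within {0..1})))"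

definition is_loc_max :: "(real \<Rightarrow> real) \<Rightarrow> real \<Rightarrow> bool" where
  "is_loc_max f x \<longleftrightarrow> (\<exists>d>0. \<forall>y. \<bar>y - x\<bar> < d \<longrightarrow> f y \<le> f x)"

definition is_loc_min :: "(real \<Rightarrow> real) \<Rightarrow> real \<Rightarrow> bool" where
  "is_loc_min f x \<longleftrightarrow> (\<exists>d>0. \<forall>y. \<bar>y - x\<bar> < d \<longrightarrow> f x \<le> f y)"

definition interior_extrema :: "(real \<Rightarrow> real) \<Rightarrow> real set" where
  "interior_extrema f = {x \<in> {0<..<1}. is_loc_max f x \<or> is_loc_min f x}"

definition F_G :: "nat \<Rightarrow> (real \<Rightarrow> real) set" where
  "F_G G = {f. C1_on01 f \<and> finite (interior_extrema f) \<and> card (interior_extrema f) \<le> G}"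

definition F_plus :: "nat \<Rightarrow> (real \<Rightarrow> real) set" where
  "F_plus H = {f. f \<in> F_G (H - 1) \<or>
      (C1_on01 f \<and> finite (interior_extrema f) \<and> card (interior_extrema f) = H
        \<and> is_loc_max f (Min (interior_extrema f)))}"

definition F_minus :: "nat \<Rightarrow> (real \<Rightarrow> real) set" where
  "F_minus H = {f. f \<in> F_G (H - 1) \<or>
      (C1_on01 f \<and> finite (interior_extrema f) \<and> card (interior_extrema f) = H
        \<and> is_loc_min f (Min (interior_extrema f)))}"

definition fixed_design :: "real \<Rightarrow> (nat \<Rightarrow> real) \<Rightarrow> bool" where
  "fixed_design K1 x \<longleftrightarrow> (\<forall>i. x i \<in> {0..1}) \<and>
     (\<forall>n i k. i < n \<and> k < n \<and> x i < x k \<and> \<not> (\<exists>m<n. x i < x m \<and> x m < x k)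
        \<longrightarrow> x k - x i < 1 / (K1 * real n))"

end

theory Submission
  imports Defs
begin

text \<open>
  Almost every draw of the prior is piecewise monotone with at most \<open>H\<close> breakpoints, and this class is
  so small that no sieve or tests are needed: noise sums over intervals are uniformly \<open>o(n)\<close> (an
  exponential bound for each of the at most \<open>n\<^sup>2 + 1\<close> traces of intervals on the design points),
  and the layer-cake formula extends this to all piecewise monotone functions, even unbounded ones, after
  truncation. Hence the likelihood ratio against the truth is at most \<open>exp (- \<delta> n)\<close> simultaneously for
  all parameters with \<open>(1/n) \<Sum>(f - f0)\<^sup>2\<close> or \<open>\<bar>\<sigma>/\<sigma>0 - 1\<bar>\<close> bounded below, which covers the
  complement of the neighbourhood. In the random design this uses that an interval of fixed \<open>Q\<close>-mass
  receives a positive fraction of the design points.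

  The normalising constant is at least \<open>\<kappa> exp (- \<delta> n / 2)\<close> because every sup-norm neighbourhood of
  \<open>f0\<close> has positive prior mass: put the \<open>\<alpha>\<close>'s at sign changes of \<open>f0'\<close> (surplus ones
  at 0 or 1), take all dyadic knots up to a large depth, and in each cell of a fixed partition realise the
  increment of \<open>f0\<close> by a single B-spline supported where the polynomial has the right sign.
\<close>

section \<open>Noise sums over piecewise monotone functions\<close>

text \<open>The draws have no common bound, so the correlation of the noise with f cannot be o(n)
  uniformly. What does hold is an error of size \<eta> (n + G), with G the sum of (f - f0)^2 over
  the design: the part of f below a height T is treated by level sets, and above it |f| is at most
  f^2 / T. The log likelihood contains G itself with a fixed coefficient, and this absorbs \<eta> G;
  the unknown scale is then a matter of one scalar inequality. The difference f - f0 may oscillate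
  even when both are piecewise monotone, so f and f0 are paired with the noise separately. For the
  noise, probability enters through \<open>regular_noise\<close> alone, a property of one noise
  sequence. On such a sequence each bound holds for all admissible functions and scales at once, and
  the posterior becomes a quotient of two integrals, one bounded above and one below. Positivity of
  the lower bound comes from a prior event that constrains only finitely many coins, coefficients
  and roots.\<close>

definition piecewise_mono :: "nat \<Rightarrow> (real \<Rightarrow> real) \<Rightarrow> bool" where
  "piecewise_mono m f \<longleftrightarrow> (\<exists>A. finite A \<and> card A \<le> m \<and>
     (\<forall>C. is_interval C \<and> C \<inter> A = {} \<longrightarrow> mono_on C f \<or> antimono_on C f))"

lemma is_interval_cuts:
  fixes C :: "real set"
  assumes "is_interval C"
  shows "is_interval (C \<inter> {..<a})" "is_interval (C \<inter> {a})" "is_interval (C \<inter> {a<..})"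
  using assms by (auto simp: is_interval_1)

text \<open>Cutting an interval at a point leaves at most three intervals, one of them a singleton,
  which explains the factor 3 per breakpoint. \<open>F\<close> is abstract because the bound serves
  both noise sums and, in the random design, probabilities of deviation sets.\<close>

lemma interval_cut_bound:
  fixes F :: "real set \<Rightarrow> real"
  assumes sub: "\<And>C a. is_interval C \<Longrightarrow> F C \<le> F (C \<inter> {..<a}) + F (C \<inter> {a}) + F (C \<inter> {a<..})"
    and single: "\<And>C a. C \<subseteq> {a} \<Longrightarrow> F C \<le> B" and "B \<ge> 0"
    and "finite A" "is_interval C"
    and "\<And>C'. is_interval C' \<Longrightarrow> C' \<subseteq> C \<Longrightarrow> C' \<inter> A = {} \<Longrightarrow> F C' \<le> B"
  shows "F C \<le> 3 ^ card A * B"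
  using assms(4-)
proof (induction A arbitrary: C rule: finite_induct)
  case empty
  then show ?case by auto
next
  case (insert a A)
  have 1: "F (C \<inter> {..<a}) \<le> 3 ^ card A * B"
    using insert.prems by (intro insert.IH is_interval_cuts) (auto intro!: insert.prems)
  have 2: "F (C \<inter> {a<..}) \<le> 3 ^ card A * B"
    using insert.prems by (intro insert.IH is_interval_cuts) (auto intro!: insert.prems)
  have "F (C \<inter> {a}) \<le> B" by (rule single) auto
  also have "\<dots> \<le> 3 ^ card A * B" using \<open>B \<ge> 0\<close> by (simp add: mult_le_cancel_right1)
  finally show ?case
    using 1 2 sub[OF insert.prems(1), of a] insert.hyps by (simp add: algebra_simps)
qed

text \<open>Layer-cake: a weighted sum is an average of sums over level sets.\<close>
lemma level_set_sum_bound: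
  fixes e v :: "nat \<Rightarrow> real"
  assumes "finite J" and v: "\<And>i. i \<in> J \<Longrightarrow> 0 \<le> v i \<and> v i \<le> R" and "R \<ge> 0"
    and D: "\<And>s. \<bar>\<Sum>i\<in>{i\<in>J. v i > s}. e i\<bar> \<le> D"
  shows "\<bar>\<Sum>i\<in>J. e i * v i\<bar> \<le> R * D"
proof -
  have vi: "(LINT s|lborel. indicator {0..<v i} s) = v i" "integrable lborel (indicator {0..<v i} :: real \<Rightarrow> real)"
    if "i \<in> J" for i using v[OF that] by auto
  have "(\<Sum>i\<in>J. e i * v i) = (\<Sum>i\<in>J. LINT s|lborel. e i * indicator {0..<v i} s)"
    using vi by (intro sum.cong) auto
  also have "\<dots> = (LINT s|lborel. (\<Sum>i\<in>J. e i * indicator {0..<v i} s))"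
    by (rule Bochner_Integration.integral_sum[symmetric]) (use vi in auto)
  finally have eq: "(\<Sum>i\<in>J. e i * v i) = (LINT s|lborel. (\<Sum>i\<in>J. e i * indicator {0..<v i} s))" .
  have bd: "\<bar>\<Sum>i\<in>J. e i * indicator {0..<v i} s\<bar> \<le> D * indicator {0..<R} s" for s
  proof (cases "s \<in> {0..<R}")
    case True
    have "(\<Sum>i\<in>J. e i * indicator {0..<v i} s) = (\<Sum>i\<in>{i\<in>J. v i > s}. e i)"
      unfolding sum.inter_filter[OF assms(1)] using True by (intro sum.cong) (auto simp: indicator_def)
    then show ?thesis using D[of s] True by simp
  next
    case False
    then have "\<And>i. i \<in> J \<Longrightarrow> indicator {0..<v i} s = (0::real)"
      using v by (fastforce simp: indicator_def)
    then show ?thesis using False by simp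
  qed
  have "\<bar>\<Sum>i\<in>J. e i * v i\<bar> \<le> (LINT s|lborel. \<bar>\<Sum>i\<in>J. e i * indicator {0..<v i} s\<bar>)"
    unfolding eq using integral_norm_bound[of lborel "\<lambda>s. \<Sum>i\<in>J. e i * indicator {0..<v i} s"] by simp
  also have "\<dots> \<le> (LINT s|lborel. D * indicator {0..<R} s)"
    by (intro integral_mono integrable_abs Bochner_Integration.integrable_sum bd integrable_mult_right vi)
       (use \<open>R \<ge> 0\<close> in auto)
  also have "\<dots> = R * D" using \<open>R \<ge> 0\<close> by simp
  finally show ?thesis .
qed

text \<open>A superlevel set of a function monotone on an interval is an interval, so
  \<open>D\<close> bounds every layer. Adding \<open>T\<close> puts the values into [0, 2 T]; the
  layers then cost \<open>2 * T * D\<close>, and removing the shift costs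
  \<open>T * D\<close>.\<close>

lemma monotone_piece_sum_bound:
  fixes e x :: "nat \<Rightarrow> real"
  assumes C: "is_interval C" "mono_on C h \<or> antimono_on C h"
    and T: "\<And>z. \<bar>h z\<bar> \<le> T" and "T \<ge> 0"
    and D: "\<And>I. is_interval I \<Longrightarrow> \<bar>\<Sum>i | i < n \<and> x i \<in> I. e i\<bar> \<le> D"
  shows "\<bar>\<Sum>i | i < n \<and> x i \<in> C. e i * h (x i)\<bar> \<le> 3 * T * D"
proof -
  let ?J = "{i. i < n \<and> x i \<in> C}"
  have lev: "\<bar>\<Sum>i\<in>{i\<in>?J. h (x i) + T > s}. e i\<bar> \<le> D" for s
  proof -
    have "is_interval {z\<in>C. h z + T > s}"
      using C(2)
    proof
      assume m: "mono_on C h"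
      show ?thesis unfolding is_interval_1
      proof safe
        fix a b z assume *: "a \<in> C" "b \<in> C" "s < h a + T" "s < h b + T" "a \<le> z" "z \<le> b"
        show zC: "z \<in> C" by (rule mem_is_interval_1_I[OF C(1) *(1,2,5,6)])
        have "h a \<le> h z" by (rule monotone_onD[OF m]) (use * zC in auto)
        then show "s < h z + T" using *(3,4) by linarith
      qed
    next
      assume m: "antimono_on C h"
      show ?thesis unfolding is_interval_1
      proof safe
        fix a b z assume *: "a \<in> C" "b \<in> C" "s < h a + T" "s < h b + T" "a \<le> z" "z \<le> b"
        show zC: "z \<in> C" by (rule mem_is_interval_1_I[OF C(1) *(1,2,5,6)])
        have "h b \<le> h z" using monotone_onD[OF m zC \<open>b \<in> C\<close> \<open>z \<le> b\<close>] by simp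
        then show "s < h z + T" using *(3,4) by linarith
      qed
    qed
    from D[OF this] show ?thesis by simp
  qed
  have "\<bar>\<Sum>i\<in>?J. e i * (h (x i) + T)\<bar> \<le> (2 * T) * D"
  proof (rule level_set_sum_bound[OF _ _ _ lev])
    show "0 \<le> h (x i) + T \<and> h (x i) + T \<le> 2 * T" for i
      using T[of "x i"] by linarith
  qed (use \<open>T \<ge> 0\<close> in auto)
  moreover have "\<bar>\<Sum>i\<in>?J. e i * T\<bar> \<le> T * D"
    using mult_right_mono[OF D[OF C(1)] \<open>T \<ge> 0\<close>] \<open>T \<ge> 0\<close>
    by (simp add: sum_distrib_right[symmetric] abs_mult mult.commute[of T])
  moreover have "(\<Sum>i\<in>?J. e i * h (x i)) = (\<Sum>i\<in>?J. e i * (h (x i) + T)) - (\<Sum>i\<in>?J. e i * T)"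
    unfolding sum_subtractf[symmetric] by (simp add: distrib_left)
  ultimately show ?thesis by linarith
qed

lemma piecewise_mono_sum_bound:
  fixes e x :: "nat \<Rightarrow> real"
  assumes pm: "piecewise_mono m h"
    and T: "\<And>z. \<bar>h z\<bar> \<le> T" and "T \<ge> 0"
    and D: "\<And>I. is_interval I \<Longrightarrow> \<bar>\<Sum>i | i < n \<and> x i \<in> I. e i\<bar> \<le> D"
  shows "\<bar>\<Sum>i<n. e i * h (x i)\<bar> \<le> 3 ^ m * (3 * T * D)"
proof -
  obtain A where A: "finite A" "card A \<le> m"
    and mono: "\<And>C. is_interval C \<Longrightarrow> C \<inter> A = {} \<Longrightarrow> mono_on C h \<or> antimono_on C h"
    using pm by (auto simp: piecewise_mono_def)
  define F where "F C = \<bar>\<Sum>i | i < n \<and> x i \<in> C. e i * h (x i)\<bar>" for C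
  have D0: "D \<ge> 0" using D[of "{}"] by simp
  have piece: "F C \<le> 3 * T * D" if "is_interval C" "mono_on C h \<or> antimono_on C h" for C
    unfolding F_def by (rule monotone_piece_sum_bound) (use that T \<open>T \<ge> 0\<close> D in auto)
  have "F UNIV \<le> 3 ^ card A * (3 * T * D)"
  proof (rule interval_cut_bound)
    fix C :: "real set" and a assume "is_interval C"
    have "{i. i < n \<and> x i \<in> C} = {i. i < n \<and> x i \<in> C \<inter> {..<a}} \<union> {i. i < n \<and> x i \<in> C \<inter> {a}} \<union> {i. i < n \<and> x i \<in> C \<inter> {a<..}}"
      by auto
    then have "(\<Sum>i | i < n \<and> x i \<in> C. e i * h (x i)) = (\<Sum>i | i < n \<and> x i \<in> C \<inter> {..<a}. e i * h (x i))
       + (\<Sum>i | i < n \<and> x i \<in> C \<inter> {a}. e i * h (x i)) + (\<Sum>i | i < n \<and> x i \<in> C \<inter> {a<..}. e i * h (x i))"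
      by (auto simp: sum.union_disjoint disjoint_iff)
    then show "F C \<le> F (C \<inter> {..<a}) + F (C \<inter> {a}) + F (C \<inter> {a<..})"
      unfolding F_def by linarith
  next
    fix C and a :: real assume "C \<subseteq> {a}"
    then show "F C \<le> 3 * T * D"
      by (intro piece) (auto simp: is_interval_1 monotone_on_def subset_singleton_iff)
  qed (use A D0 \<open>T \<ge> 0\<close> mono piece in auto)
  also have "\<dots> \<le> 3 ^ m * (3 * T * D)"
    using A D0 \<open>T \<ge> 0\<close> by (intro mult_right_mono power_increasing) auto
  finally show ?thesis by (simp add: F_def lessThan_def)
qed

lemma piecewise_mono_truncate:
  assumes "piecewise_mono m f"
  shows "piecewise_mono m (\<lambda>z. max (- T) (min T (f z)))"
proof -
  have "mono_on C (\<lambda>z. max (- T) (min T (f z)))" if "mono_on C f" for C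
    using that by (fastforce simp: monotone_on_def max_def min_def)
  moreover have "antimono_on C (\<lambda>z. max (- T) (min T (f z)))" if "antimono_on C f" for C
    using that by (fastforce simp: monotone_on_def max_def min_def)
  ultimately show ?thesis
    using assms unfolding piecewise_mono_def by blast
qed

text \<open>Truncation at height \<open>T\<close> makes the level-set bound applicable. The excess
  lives where |f| > T: there |f| <= f^2 / T settles the terms with |e| <= L, and Young's inequality
  with weight \<eta> trades the remaining ones for f^2 and the squared noise tail.\<close>

lemma noise_correlation_bound:
  fixes e x :: "nat \<Rightarrow> real"
  assumes pm: "piecewise_mono m f" and "T > 0" "L > 0" "\<eta> > 0"
    and D: "\<And>I. is_interval I \<Longrightarrow> \<bar>\<Sum>i | i < n \<and> x i \<in> I. e i\<bar> \<le> D"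
  shows "\<bar>\<Sum>i<n. e i * f (x i)\<bar> \<le> 3 ^ m * (3 * T * D) + (L / T + \<eta>) * (\<Sum>i<n. (f (x i))\<^sup>2)
           + (\<Sum>i<n. if \<bar>e i\<bar> > L then (e i)\<^sup>2 else 0) / (4 * \<eta>)"
proof -
  define h where "h z = max (- T) (min T (f z))" for z
  have h: "\<bar>h z\<bar> \<le> T" for z using \<open>T > 0\<close> by (auto simp: h_def)
  have 1: "\<bar>\<Sum>i<n. e i * h (x i)\<bar> \<le> 3 ^ m * (3 * T * D)"
    by (rule piecewise_mono_sum_bound) (use h \<open>T > 0\<close> D pm in \<open>auto simp: h_def[abs_def] intro!: piecewise_mono_truncate\<close>)
  have 2: "\<bar>e * (u - max (- T) (min T u))\<bar> \<le> (L / T + \<eta>) * u\<^sup>2 + (if \<bar>e\<bar> > L then e\<^sup>2 else 0) / (4 * \<eta>)" for e u :: real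
  proof (cases "\<bar>u\<bar> \<le> T")
    case True
    then have "u - max (- T) (min T u) = 0" by auto
    then show ?thesis using assms(2-4) by simp
  next
    case False
    have a: "\<bar>e * (u - max (- T) (min T u))\<bar> \<le> \<bar>e\<bar> * \<bar>u\<bar>"
      unfolding abs_mult using \<open>T > 0\<close> by (intro mult_left_mono) (auto simp: max_def min_def)
    show ?thesis
    proof (cases "\<bar>e\<bar> > L")
      case True
      \<comment> \<open>Young's inequality |e| |u| <= \<eta> u^2 + e^2 / (4 \<eta>), read off a
        completed square.\<close>
      have "0 \<le> (2 * \<eta> * \<bar>u\<bar> - \<bar>e\<bar>)\<^sup>2" by simp
      then have "4 * \<eta> * (\<bar>e\<bar> * \<bar>u\<bar>) \<le> 4 * \<eta>\<^sup>2 * u\<^sup>2 + e\<^sup>2"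
        by (simp add: power2_diff power_mult_distrib algebra_simps)
      then have "\<bar>e\<bar> * \<bar>u\<bar> \<le> \<eta> * u\<^sup>2 + e\<^sup>2 / (4 * \<eta>)"
        using \<open>\<eta> > 0\<close> by (simp add: field_simps power2_eq_square)
      moreover have "0 \<le> L / T * u\<^sup>2" using assms(2-4) by simp
      ultimately show ?thesis using a True by (simp add: distrib_right)
    next
      case F: False
      have "\<bar>e\<bar> * \<bar>u\<bar> \<le> L * \<bar>u\<bar>" using F by (intro mult_right_mono) auto
      also have "\<dots> \<le> L * (\<bar>u\<bar> * \<bar>u\<bar> / T)"
      proof -
        have "T * \<bar>u\<bar> \<le> \<bar>u\<bar> * \<bar>u\<bar>" using False by (intro mult_right_mono) auto
        then show ?thesis using assms(2-4) by (intro mult_left_mono) (auto simp: pos_le_divide_eq mult.commute)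
      qed
      also have "\<dots> = L / T * u\<^sup>2" by (simp add: power2_eq_square)
      finally have "\<bar>e\<bar> * \<bar>u\<bar> \<le> L / T * u\<^sup>2" .
      moreover have "0 \<le> \<eta> * u\<^sup>2" using \<open>\<eta> > 0\<close> by simp
      ultimately show ?thesis using a F by (simp add: distrib_right)
    qed
  qed
  have "\<bar>\<Sum>i<n. e i * f (x i)\<bar> = \<bar>(\<Sum>i<n. e i * h (x i)) + (\<Sum>i<n. e i * (f (x i) - h (x i)))\<bar>"
    unfolding sum.distrib[symmetric] by (simp add: right_diff_distrib)
  also have "\<dots> \<le> 3 ^ m * (3 * T * D) + (\<Sum>i<n. \<bar>e i * (f (x i) - h (x i))\<bar>)"
    using 1 sum_abs[of "\<lambda>i. e i * (f (x i) - h (x i))" "{..<n}"] by linarith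
  also have "(\<Sum>i<n. \<bar>e i * (f (x i) - h (x i))\<bar>) \<le>
      (\<Sum>i<n. (L / T + \<eta>) * (f (x i))\<^sup>2 + (if \<bar>e i\<bar> > L then (e i)\<^sup>2 else 0) / (4 * \<eta>))"
    unfolding h_def by (intro sum_mono 2)
  also have "\<dots> = (L / T + \<eta>) * (\<Sum>i<n. (f (x i))\<^sup>2) + (\<Sum>i<n. if \<bar>e i\<bar> > L then (e i)\<^sup>2 else 0) / (4 * \<eta>)"
    by (simp add: sum.distrib sum_distrib_left sum_divide_distrib)
  finally show ?thesis by simp
qed

section \<open>Likelihood ratios\<close>

text \<open>Everything the likelihood bounds ask of one noise sequence: uniform smallness over
  intervals, a tail condition on the squares, their law of large numbers, and the pairing with f0.
  The last clause is separate because f - f0 need not be piecewise monotone.\<close>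

definition regular_noise :: "(nat \<Rightarrow> real) \<Rightarrow> (nat \<Rightarrow> real) \<Rightarrow> (real \<Rightarrow> real) \<Rightarrow> real \<Rightarrow> bool" where
  "regular_noise e x f0 s0 \<longleftrightarrow>
     (\<forall>t>0. \<forall>\<^sub>F n in sequentially. \<forall>I. is_interval I \<longrightarrow> \<bar>\<Sum>i | i < n \<and> x i \<in> I. e i\<bar> \<le> t * real n) \<and>
     (\<forall>t>0. \<exists>L>0. \<forall>\<^sub>F n in sequentially. (\<Sum>i<n. if \<bar>e i\<bar> > L then (e i)\<^sup>2 else 0) \<le> t * real n) \<and>
     (\<forall>t>0. \<forall>\<^sub>F n in sequentially. \<bar>(\<Sum>i<n. (e i)\<^sup>2) - s0\<^sup>2 * real n\<bar> \<le> t * real n) \<and>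
     (\<forall>t>0. \<forall>\<^sub>F n in sequentially. \<bar>\<Sum>i<n. e i * f0 (x i)\<bar> \<le> t * real n)"

text \<open>The error is allowed to grow with the sum of squares, since f is unbounded and the log
  likelihood gives that sum back with a larger coefficient.\<close>

lemma uniform_noise_correlation:
  assumes reg: "regular_noise e x f0 s0" and F: "\<And>i. \<bar>f0 (x i)\<bar> \<le> F" and "\<eta> > 0"
  shows "\<forall>\<^sub>F n in sequentially. \<forall>f. piecewise_mono m f \<longrightarrow>
    \<bar>\<Sum>i<n. e i * (f (x i) - f0 (x i))\<bar> \<le> \<eta> * (real n + (\<Sum>i<n. (f (x i) - f0 (x i))\<^sup>2))"
proof -
  \<comment> \<open>Replacing f^2 by 2 (f - f0)^2 + 2 F^2 produces the coefficients 4 \<eta>1 and 4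
    \<eta>1 F^2; scaling by 1 + F^2 keeps both below \<eta> / 2.\<close>
  define \<eta>1 where "\<eta>1 = \<eta> / (8 * (1 + F\<^sup>2))"
  have F2: "1 + F\<^sup>2 > 0" by (intro add_nonneg_pos add_pos_nonneg) auto
  have \<eta>1: "\<eta>1 > 0" "4 * \<eta>1 * (1 + F\<^sup>2) = \<eta> / 2"
    using \<open>\<eta> > 0\<close> F2 by (simp_all add: \<eta>1_def field_simps)
  have "4 * \<eta>1 * F\<^sup>2 \<ge> 0" using \<eta>1(1) by simp
  then have \<eta>1': "4 * \<eta>1 \<le> \<eta> / 2" "4 * \<eta>1 * F\<^sup>2 \<le> \<eta> / 2" using \<eta>1 unfolding distrib_left by (linarith, linarith)
  obtain L where L: "L > 0" and evL: "\<forall>\<^sub>F n in sequentially. (\<Sum>i<n. if \<bar>e i\<bar> > L then (e i)\<^sup>2 else 0) \<le> (\<eta> * \<eta>1 / 2) * real n"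
    using reg \<open>\<eta> > 0\<close> \<eta>1(1) unfolding regular_noise_def by (meson divide_pos_pos mult_pos_pos zero_less_numeral)
  \<comment> \<open>The choices are nested: the tail condition yields \<open>L\<close> from
    \<open>\<eta>1\<close>, then \<open>T\<close> makes \<open>L / T\<close> equal to
    \<open>\<eta>1\<close>, and \<open>t\<close> offsets the factor \<open>3 ^ m * 3 * T\<close>.
    The interval sums, the tail and the f0 term each get \<eta> / 8 per observation.\<close>
  define T where "T = L / \<eta>1"
  have T: "T > 0" "L / T = \<eta>1" using L \<eta>1 by (auto simp: T_def)
  define t where "t = \<eta> / (8 * 3 ^ m * 3 * T)"
  have t: "t > 0" "3 ^ m * (3 * T * t) = \<eta> / 8" using \<open>\<eta> > 0\<close> T by (auto simp: t_def)
  have ev1: "\<forall>\<^sub>F n in sequentially. \<forall>I. is_interval I \<longrightarrow> \<bar>\<Sum>i | i < n \<and> x i \<in> I. e i\<bar> \<le> t * real n"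
    using reg t(1) by (auto simp: regular_noise_def)
  have ev2: "\<forall>\<^sub>F n in sequentially. \<bar>\<Sum>i<n. e i * f0 (x i)\<bar> \<le> \<eta> / 8 * real n"
    using reg \<open>\<eta> > 0\<close> unfolding regular_noise_def by (meson divide_pos_pos zero_less_numeral)
  show ?thesis
    using ev1 ev2 evL
  proof eventually_elim
    case (elim n)
    show ?case
    proof safe
      fix f assume pm: "piecewise_mono m f"
      define G where "G = (\<Sum>i<n. (f (x i) - f0 (x i))\<^sup>2)"
      have "G \<ge> 0" by (simp add: G_def sum_nonneg)
      have "(\<Sum>i<n. (f (x i))\<^sup>2) \<le> (\<Sum>i<n. 2 * (f (x i) - f0 (x i))\<^sup>2 + 2 * F\<^sup>2)"
      proof (rule sum_mono)
        fix i
        \<comment> \<open>This square is exactly 2 (f - f0)^2 + 2 f0^2 - f^2.\<close>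
        have "0 \<le> (f (x i) - 2 * f0 (x i))\<^sup>2" by simp
        then have "(f (x i))\<^sup>2 \<le> 2 * (f (x i) - f0 (x i))\<^sup>2 + 2 * (f0 (x i))\<^sup>2"
          by (simp add: power2_eq_square algebra_simps)
        moreover have "(f0 (x i))\<^sup>2 \<le> F\<^sup>2" using F[of i] by (intro sqrt_le_D) (simp add: power2_le_iff_abs_le abs_le_square_iff)
        ultimately show "(f (x i))\<^sup>2 \<le> 2 * (f (x i) - f0 (x i))\<^sup>2 + 2 * F\<^sup>2" by simp
      qed
      also have "\<dots> = 2 * G + 2 * F\<^sup>2 * real n" by (simp add: G_def sum.distrib sum_distrib_left)
      finally have f2: "(\<Sum>i<n. (f (x i))\<^sup>2) \<le> 2 * G + 2 * F\<^sup>2 * real n" .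
      have "\<bar>\<Sum>i<n. e i * f (x i)\<bar> \<le> 3 ^ m * (3 * T * (t * real n)) + (L / T + \<eta>1) * (\<Sum>i<n. (f (x i))\<^sup>2)
           + (\<Sum>i<n. if \<bar>e i\<bar> > L then (e i)\<^sup>2 else 0) / (4 * \<eta>1)"
        by (rule noise_correlation_bound) (use pm T L \<eta>1 elim in auto)
      also have "3 ^ m * (3 * T * (t * real n)) = \<eta> / 8 * real n"
        using t(2) by (metis mult.assoc)
      also have "(L / T + \<eta>1) * (\<Sum>i<n. (f (x i))\<^sup>2) \<le> (2 * \<eta>1) * (2 * G + 2 * F\<^sup>2 * real n)"
        using \<eta>1 f2 unfolding T(2) by (intro mult_mono) (auto simp: sum_nonneg)
      also have "\<dots> = (4 * \<eta>1) * G + (4 * \<eta>1 * F\<^sup>2) * real n" by (simp add: algebra_simps)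
      also have "\<dots> \<le> (\<eta> / 2) * G + (\<eta> / 2) * real n"
        using \<eta>1' \<open>G \<ge> 0\<close> by (intro add_mono mult_right_mono) auto
      also have "(\<Sum>i<n. if \<bar>e i\<bar> > L then (e i)\<^sup>2 else 0) / (4 * \<eta>1) \<le> (\<eta> * \<eta>1 / 2) * real n / (4 * \<eta>1)"
        using elim \<eta>1 by (intro divide_right_mono) auto
      also have "\<dots> = \<eta> / 8 * real n" using \<eta>1 by simp
      finally have "\<bar>\<Sum>i<n. e i * f (x i)\<bar> \<le> \<eta> / 8 * real n + (\<eta> / 2 * G + \<eta> / 2 * real n) + \<eta> / 8 * real n"
        by simp
      moreover have "(\<Sum>i<n. e i * (f (x i) - f0 (x i))) = (\<Sum>i<n. e i * f (x i)) - (\<Sum>i<n. e i * f0 (x i))"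
        by (simp add: right_diff_distrib sum_subtractf)
      moreover have "\<eta> * real n \<ge> 0" "\<eta> * G \<ge> 0" using \<open>\<eta> > 0\<close> \<open>G \<ge> 0\<close> by auto
      ultimately show "\<bar>\<Sum>i<n. e i * (f (x i) - f0 (x i))\<bar> \<le> \<eta> * (real n + (\<Sum>i<n. (f (x i) - f0 (x i))\<^sup>2))"
        using elim(2) unfolding G_def[symmetric] by (simp add: distrib_left)
    qed
  qed
qed

section \<open>Gaussian likelihood ratios, uniformly in the regression function and the
  scale\<close>

lemma likelihood_exp:
  assumes "s > 0"
  shows "likelihood f s n x y = ennreal (exp (- (real n * ln (2 * pi * s\<^sup>2) + (\<Sum>i<n. (y i - f (x i))\<^sup>2) / s\<^sup>2) / 2))"
proof -
  have nd: "normal_density \<mu> s z = exp (- (ln (2 * pi * s\<^sup>2) + (z - \<mu>)\<^sup>2 / s\<^sup>2) / 2)" for \<mu> z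
  proof -
    have "sqrt (2 * pi * s\<^sup>2) = exp (ln (2 * pi * s\<^sup>2) / 2)"
      using assms by (simp add: ln_sqrt[symmetric])
    then have "1 / sqrt (2 * pi * s\<^sup>2) = exp (- (ln (2 * pi * s\<^sup>2) / 2))"
      by (simp add: exp_minus inverse_eq_divide)
    then show ?thesis
      unfolding normal_density_def by (simp add: exp_add[symmetric] add_divide_distrib field_simps)
  qed
  have "likelihood f s n x y = ennreal (\<Prod>i<n. exp (- (ln (2 * pi * s\<^sup>2) + (y i - f (x i))\<^sup>2 / s\<^sup>2) / 2))"
    unfolding likelihood_def nd by (rule prod_ennreal) simp
  also have "(\<Prod>i<n. exp (- (ln (2 * pi * s\<^sup>2) + (y i - f (x i))\<^sup>2 / s\<^sup>2) / 2)) =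
     exp (- (real n * ln (2 * pi * s\<^sup>2) + (\<Sum>i<n. (y i - f (x i))\<^sup>2) / s\<^sup>2) / 2)"
    unfolding exp_sum[OF finite_lessThan, symmetric] sum_divide_distrib[symmetric] sum_negf sum.distrib by simp
  finally show ?thesis .
qed

lemma likelihood_ratio:
  assumes "s > 0" "s0 > 0"
  shows "likelihood f s n x y = ennreal (exp (- (real n * (2 * ln (s / s0)) + (\<Sum>i<n. (y i - f (x i))\<^sup>2) / s\<^sup>2
            - (\<Sum>i<n. (y i - f0 (x i))\<^sup>2) / s0\<^sup>2) / 2)) * likelihood f0 s0 n x y"
proof -
  have "ln (2 * pi * s\<^sup>2) = 2 * ln (s / s0) + ln (2 * pi * s0\<^sup>2)"
    using assms by (simp add: ln_mult ln_div ln_realpow)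
  then show ?thesis
    unfolding likelihood_exp[OF assms(1)] likelihood_exp[OF assms(2)]
    by (simp add: ennreal_mult[symmetric] exp_add[symmetric] algebra_simps diff_divide_distrib add_divide_distrib)
qed

text \<open>With z = s0 / s, A the residual mean square and v the noise mean square, both in units
  of s0^2, the bounded expression is -2 / n times the log likelihood ratio. A surplus in A wins for
  every z, as z^2 A - 2 ln z >= 1 + ln A; a wrong scale wins through z^2 - 2 ln z - 1 >= (z -
  1)^2.\<close>

lemma gaussian_excess_bound:
  fixes q \<epsilon> :: real
  assumes "q > 0" "\<epsilon> > 0"
  obtains \<eta> \<delta> where "\<eta> > 0" "\<delta> > 0"
    "\<And>z A v. z > 0 \<Longrightarrow> v \<le> 1 + \<eta> \<Longrightarrow> A \<ge> 1 - \<eta> \<Longrightarrow> A \<ge> 1 + q \<or> \<bar>1 / z - 1\<bar> \<ge> \<epsilon> \<Longrightarrow>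
       z\<^sup>2 * A - 2 * ln z - v \<ge> \<delta>"
proof
  \<comment> \<open>A lower bound for |z - 1|: it is at least 1/2 if z <= 1/2, and otherwise |z - 1|
    = z |1 / z - 1| >= \<epsilon> / 2.\<close>
  define \<kappa> where "\<kappa> = min (1/2) (\<epsilon> / 2)"
  have \<kappa>: "\<kappa> > 0" using assms by (auto simp: \<kappa>_def)
  \<comment> \<open>1/4 lets \<eta> z^2 consume at most half of (z - 1)^2, up to 2 \<eta>; with
    \<kappa>^2 / 12 the remaining loss 3 \<eta> is at most \<kappa>^2 / 4. The logarithm serves the
    case of a surplus in A.\<close>
  define \<eta> where "\<eta> = min (min (1/4) (ln (1 + q) / 2)) (\<kappa>\<^sup>2 / 12)"
  define \<delta> where "\<delta> = min (ln (1 + q) / 2) (\<kappa>\<^sup>2 / 4)"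
  have lq: "ln (1 + q) > 0" using assms by simp
  show "\<eta> > 0" "\<delta> > 0" using lq \<kappa> by (auto simp: \<eta>_def \<delta>_def)
  fix z A v :: real
  assume z: "z > 0" and v: "v \<le> 1 + \<eta>" and A: "A \<ge> 1 - \<eta>" and cases: "A \<ge> 1 + q \<or> \<bar>1 / z - 1\<bar> \<ge> \<epsilon>"
  have \<eta>: "\<eta> \<le> 1/4" "\<eta> \<le> ln (1 + q) / 2" "\<eta> \<le> \<kappa>\<^sup>2 / 12" by (auto simp: \<eta>_def)
  show "z\<^sup>2 * A - 2 * ln z - v \<ge> \<delta>"
    using cases
  proof
    assume A1: "A \<ge> 1 + q"
    then have "A > 0" using assms by simp
    have "ln (z\<^sup>2 * A) \<le> z\<^sup>2 * A - 1" using z \<open>A > 0\<close> by (intro ln_le_minus_one) simp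
    moreover have "ln (z\<^sup>2 * A) = 2 * ln z + ln A" using z \<open>A > 0\<close> by (simp add: ln_mult ln_realpow)
    moreover have "ln (1 + q) \<le> ln A" using A1 assms by simp
    ultimately have "z\<^sup>2 * A - 2 * ln z - v \<ge> ln (1 + q) / 2" using v \<eta> by linarith
    then show ?thesis by (simp add: \<delta>_def)
  next
    assume e: "\<bar>1 / z - 1\<bar> \<ge> \<epsilon>"
    have "\<bar>z - 1\<bar> \<ge> \<kappa>"
    proof (cases "z \<le> 1/2")
      case True then show ?thesis by (auto simp: \<kappa>_def)
    next
      case False
      have "\<bar>z - 1\<bar> = z * \<bar>1 / z - 1\<bar>" using z by (auto simp: abs_if field_simps)
      also have "\<dots> \<ge> (1/2) * \<epsilon>" using False e assms by (intro mult_mono) auto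
      finally show ?thesis unfolding \<kappa>_def by linarith
    qed
    then have k2: "(z - 1)\<^sup>2 \<ge> \<kappa>\<^sup>2" using \<kappa> by (metis abs_le_square_iff abs_of_pos)
    have "ln z \<le> z - 1" using z by (rule ln_le_minus_one)
    moreover have "z\<^sup>2 * A \<ge> z\<^sup>2 * (1 - \<eta>)" using A by (intro mult_left_mono) auto
    ultimately have "z\<^sup>2 * A - 2 * ln z - v \<ge> z\<^sup>2 * (1 - \<eta>) - 2 * (z - 1) - (1 + \<eta>)"
      using v by (intro diff_mono) auto
    also have "z\<^sup>2 * (1 - \<eta>) - 2 * (z - 1) - (1 + \<eta>) = (z - 1)\<^sup>2 - \<eta> * z\<^sup>2 - \<eta>"
      by (simp add: power2_eq_square algebra_simps)
    finally have 1: "z\<^sup>2 * A - 2 * ln z - v \<ge> (z - 1)\<^sup>2 - \<eta> * z\<^sup>2 - \<eta>" .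
    have "z\<^sup>2 \<le> 2 * (z - 1)\<^sup>2 + 2"
    proof -
      have "0 \<le> (z - 2)\<^sup>2" by simp
      then show ?thesis by (simp add: power2_eq_square algebra_simps)
    qed
    then have "\<eta> * z\<^sup>2 \<le> \<eta> * (2 * (z - 1)\<^sup>2 + 2)" using \<open>\<eta> > 0\<close> by (intro mult_left_mono) auto
    also have "\<dots> = (2 * \<eta>) * (z - 1)\<^sup>2 + 2 * \<eta>" by (simp add: algebra_simps)
    also have "\<dots> \<le> (1/2) * (z - 1)\<^sup>2 + 2 * \<eta>" using \<eta> by (intro add_right_mono mult_right_mono) auto
    finally have "z\<^sup>2 * A - 2 * ln z - v \<ge> \<kappa>\<^sup>2 / 4" using 1 k2 \<eta>(3) by linarith
    then show ?thesis by (simp add: \<delta>_def)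
  qed
qed

text \<open>Expanding the square, the residual sum is V - 2 cross + G, and a cross term of at most
  \<eta>' (n + G) leaves at least G / 2. What remains is the scalar inequality, which is uniform in
  f and s.\<close>

lemma likelihood_upper_bound:
  assumes reg: "regular_noise (\<lambda>i. y i - f0 (x i)) x f0 s0" and F: "\<And>i. \<bar>f0 (x i)\<bar> \<le> F"
    and "s0 > 0" "q > 0" "\<epsilon> > 0"
  obtains \<delta> where "\<delta> > 0"
    "\<forall>\<^sub>F n in sequentially. \<forall>f s. piecewise_mono m f \<and> s > 0 \<and>
       (q * real n \<le> (\<Sum>i<n. (f (x i) - f0 (x i))\<^sup>2) \<or> \<bar>s / s0 - 1\<bar> \<ge> \<epsilon>) \<longrightarrow>
       likelihood f s n x y \<le> ennreal (exp (- \<delta> * real n)) * likelihood f0 s0 n x y"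
proof -
  \<comment> \<open>Of the gain G / 2 >= q n / 2, half is spent on the noise errors; the remaining q
    n / 4 equals \<open>q1\<close> in units of s0^2 n.\<close>
  define q1 where "q1 = q / (4 * s0\<^sup>2)"
  have "q1 > 0" using assms by (simp add: q1_def)
  obtain \<eta> \<delta> where \<eta>: "\<eta> > 0" and \<delta>: "\<delta> > 0" and scal:
    "\<And>z A v. z > 0 \<Longrightarrow> v \<le> 1 + \<eta> \<Longrightarrow> A \<ge> 1 - \<eta> \<Longrightarrow> A \<ge> 1 + q1 \<or> \<bar>1 / z - 1\<bar> \<ge> \<epsilon> \<Longrightarrow>
       z\<^sup>2 * A - 2 * ln z - v \<ge> \<delta>"
    using gaussian_excess_bound[OF \<open>q1 > 0\<close> \<open>\<epsilon> > 0\<close>] by blast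
  \<comment> \<open>1/4 bounds twice the G part of the cross term by G / 2; the other two entries
    keep the loss 3 \<eta>' n below q n / 4 and below \<eta> s0^2 n.\<close>
  define \<eta>' where "\<eta>' = min (min (1/4) (q / 12)) (\<eta> * s0\<^sup>2 / 3)"
  have \<eta>': "\<eta>' > 0" "\<eta>' \<le> 1/4" "3 * \<eta>' \<le> q / 4" "3 * \<eta>' \<le> \<eta> * s0\<^sup>2"
    using assms \<eta> by (auto simp: \<eta>'_def)
  let ?e = "\<lambda>i. y i - f0 (x i)"
  have ev1: "\<forall>\<^sub>F n in sequentially. \<bar>(\<Sum>i<n. (?e i)\<^sup>2) - s0\<^sup>2 * real n\<bar> \<le> \<eta>' * real n"
    using reg \<eta>'(1) by (auto simp: regular_noise_def)
  \<comment> \<open>The Gaussian exponent carries a factor 1/2, hence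
    \<open>\<delta> / 2\<close>.\<close>
  have "\<forall>\<^sub>F n in sequentially. \<forall>f s. piecewise_mono m f \<and> s > 0 \<and>
       (q * real n \<le> (\<Sum>i<n. (f (x i) - f0 (x i))\<^sup>2) \<or> \<bar>s / s0 - 1\<bar> \<ge> \<epsilon>) \<longrightarrow>
       likelihood f s n x y \<le> ennreal (exp (- (\<delta> / 2) * real n)) * likelihood f0 s0 n x y"
    using ev1 uniform_noise_correlation[OF reg F \<eta>'(1), of m] eventually_gt_at_top[of 0]
  proof eventually_elim
    case (elim n)
    show ?case
    proof (intro allI impI, elim conjE)
      fix f s assume pm: "piecewise_mono m f" and s: "s > 0"
        and c: "q * real n \<le> (\<Sum>i<n. (f (x i) - f0 (x i))\<^sup>2) \<or> \<bar>s / s0 - 1\<bar> \<ge> \<epsilon>"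
      define G where "G = (\<Sum>i<n. (f (x i) - f0 (x i))\<^sup>2)"
      define V where "V = (\<Sum>i<n. (?e i)\<^sup>2)"
      define S where "S = (\<Sum>i<n. (y i - f (x i))\<^sup>2)"
      have n: "real n > 0" using elim by simp
      have "G \<ge> 0" by (simp add: G_def sum_nonneg)
      have "S = V - 2 * (\<Sum>i<n. ?e i * (f (x i) - f0 (x i))) + G"
        unfolding S_def V_def G_def sum_distrib_left sum_subtractf[symmetric] sum.distrib[symmetric]
        by (intro sum.cong) (auto simp: power2_eq_square algebra_simps)
      moreover have "\<bar>\<Sum>i<n. ?e i * (f (x i) - f0 (x i))\<bar> \<le> \<eta>' * (real n + G)"
        using elim(2) pm by (auto simp: G_def)
      ultimately have "S \<ge> V - 2 * \<eta>' * real n - 2 * \<eta>' * G + G" by (simp add: distrib_left)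
      moreover have "\<eta>' * G \<le> 1/4 * G" using \<eta>' \<open>G \<ge> 0\<close> by (intro mult_right_mono) auto
      moreover have "\<bar>V - s0\<^sup>2 * real n\<bar> \<le> \<eta>' * real n" using elim(1) by (simp add: V_def)
      ultimately have S: "S \<ge> s0\<^sup>2 * real n - 3 * \<eta>' * real n + G / 2" and V: "V \<le> s0\<^sup>2 * real n + \<eta>' * real n"
        by linarith+
      have s02: "s0\<^sup>2 * real n > 0" using n assms by simp
      have eta_n: "3 * \<eta>' * real n \<le> \<eta> * s0\<^sup>2 * real n" "3 * \<eta>' * real n \<le> q / 4 * real n"
        using \<eta>' n by (auto intro!: mult_right_mono)
      have "\<delta> \<le> (s0 / s)\<^sup>2 * (S / (s0\<^sup>2 * real n)) - 2 * ln (s0 / s) - V / (s0\<^sup>2 * real n)"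
      proof (rule scal)
        show "s0 / s > 0" using s assms by simp
        have "V \<le> (1 + \<eta>) * (s0\<^sup>2 * real n)"
        proof -
          have "\<eta>' * real n \<ge> 0" using \<eta>'(1) by simp
          then show ?thesis using V eta_n(1) by (simp add: algebra_simps)
        qed
        then show "V / (s0\<^sup>2 * real n) \<le> 1 + \<eta>" using s02 by (simp only: pos_divide_le_eq)
        have "S \<ge> (1 - \<eta>) * (s0\<^sup>2 * real n)"
          using S eta_n(1) \<open>G \<ge> 0\<close> by (simp add: algebra_simps)
        then show "1 - \<eta> \<le> S / (s0\<^sup>2 * real n)" using s02 by (simp only: pos_le_divide_eq)
        show "1 + q1 \<le> S / (s0\<^sup>2 * real n) \<or> \<epsilon> \<le> \<bar>1 / (s0 / s) - 1\<bar>"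
          using c
        proof
          assume "q * real n \<le> (\<Sum>i<n. (f (x i) - f0 (x i))\<^sup>2)"
          then have "G \<ge> q * real n" by (simp add: G_def)
          moreover have "(1 + q1) * (s0\<^sup>2 * real n) = s0\<^sup>2 * real n + q / 4 * real n"
            using assms by (simp add: q1_def field_simps)
          ultimately have "S \<ge> (1 + q1) * (s0\<^sup>2 * real n)"
            using S eta_n(2) by linarith
          then have "1 + q1 \<le> S / (s0\<^sup>2 * real n)" using s02 by (simp only: pos_le_divide_eq)
          then show ?thesis ..
        next
          assume "\<bar>s / s0 - 1\<bar> \<ge> \<epsilon>" then show ?thesis by simp
        qed
      qed
      also have "(s0 / s)\<^sup>2 * (S / (s0\<^sup>2 * real n)) = S / s\<^sup>2 / real n"
        using assms by (simp add: power_divide)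
      also have "ln (s0 / s) = - ln (s / s0)" using s assms by (simp add: ln_div)
      finally have "\<delta> * real n \<le> (S / s\<^sup>2 / real n + 2 * ln (s / s0) - V / (s0\<^sup>2 * real n)) * real n"
        using n by (intro mult_right_mono) auto
      also have "\<dots> = real n * (2 * ln (s / s0)) + S / s\<^sup>2 - V / s0\<^sup>2"
        using n assms by (simp add: distrib_right left_diff_distrib)
      finally show "likelihood f s n x y \<le> ennreal (exp (- (\<delta> / 2) * real n)) * likelihood f0 s0 n x y"
        unfolding likelihood_ratio[OF s \<open>s0 > 0\<close>, of f n x y f0] S_def[symmetric] V_def[symmetric]
        by (intro mult_right_mono ennreal_leI) auto
    qed
  qed
  then show ?thesis using that[of "\<delta> / 2"] \<delta> by simp
qed

lemma likelihood_lower_bound: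
  assumes reg: "regular_noise (\<lambda>i. y i - f0 (x i)) x f0 s0" and "s0 > 0" "\<delta> > 0"
  obtains \<eta> where "\<eta> > 0"
    "\<forall>\<^sub>F n in sequentially. \<forall>f s. s > 0 \<and> (\<forall>i. \<bar>f (x i) - f0 (x i)\<bar> \<le> \<eta>) \<and> \<bar>s - s0\<bar> < \<eta> \<longrightarrow>
       ennreal (exp (- \<delta> * real n)) * likelihood f0 s0 n x y \<le> likelihood f s n x y"
proof -
  let ?e = "\<lambda>i. y i - f0 (x i)"
  \<comment> \<open>The exponent per observation caused by replacing s0 with s, the squared noise
    sum being at most 2 s0^2 n. It is continuous at s0 and vanishes there.\<close>
  define \<psi> where "\<psi> s = 2 * ln (s / s0) + 2 * s0\<^sup>2 * \<bar>1 / s\<^sup>2 - 1 / s0\<^sup>2\<bar>" for s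
  have "isCont \<psi> s0"
    unfolding \<psi>_def using \<open>s0 > 0\<close> by (intro continuous_intros) auto
  then have "\<psi> \<midarrow>s0\<rightarrow> 0" using \<open>s0 > 0\<close> unfolding isCont_def \<psi>_def by simp
  from LIM_D[OF this \<open>\<delta> > 0\<close>] obtain d where d: "d > 0"
    "\<And>s. s \<noteq> s0 \<Longrightarrow> \<bar>s - s0\<bar> < d \<Longrightarrow> \<bar>\<psi> s\<bar> < \<delta>" by auto
  \<comment> \<open>\<open>s0 / 2\<close> keeps 1 / s^2 below 4 / s0^2; the last entry makes the
    change of the residual sum, divided by s^2, at most \<delta> n. Together with \<psi> this gives
    2 \<delta> n, which the Gaussian exponent halves.\<close>
  define \<eta> where "\<eta> = min (min 1 d) (min (s0 / 2) (\<delta> * s0\<^sup>2 / (4 * (2 * s0\<^sup>2 + 2))))"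
  have s0p: "2 * s0\<^sup>2 + 2 > 0" by (intro add_nonneg_pos add_pos_nonneg) auto
  have \<eta>: "\<eta> > 0" "\<eta> \<le> 1" "\<eta> \<le> d" "\<eta> \<le> s0 / 2" "\<eta> * (2 * s0\<^sup>2 + 2) * (4 / s0\<^sup>2) \<le> \<delta>"
  proof -
    show "\<eta> > 0" using assms d s0p by (auto simp: \<eta>_def)
    show "\<eta> \<le> 1" "\<eta> \<le> d" "\<eta> \<le> s0 / 2" unfolding \<eta>_def by linarith+
    have "\<eta> \<le> \<delta> * s0\<^sup>2 / (4 * (2 * s0\<^sup>2 + 2))" by (simp add: \<eta>_def)
    then have "\<eta> * (4 * (2 * s0\<^sup>2 + 2)) \<le> \<delta> * s0\<^sup>2" using s0p by (simp add: pos_le_divide_eq)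
    then show "\<eta> * (2 * s0\<^sup>2 + 2) * (4 / s0\<^sup>2) \<le> \<delta>" using \<open>s0 > 0\<close> by (simp add: pos_divide_le_eq mult_ac)
  qed
  have ev1: "\<forall>\<^sub>F n in sequentially. \<bar>(\<Sum>i<n. (?e i)\<^sup>2) - s0\<^sup>2 * real n\<bar> \<le> s0\<^sup>2 * real n"
    using reg assms by (auto simp: regular_noise_def)
  have "\<forall>\<^sub>F n in sequentially. \<forall>f s. s > 0 \<and> (\<forall>i. \<bar>f (x i) - f0 (x i)\<bar> \<le> \<eta>) \<and> \<bar>s - s0\<bar> < \<eta> \<longrightarrow>
       ennreal (exp (- \<delta> * real n)) * likelihood f0 s0 n x y \<le> likelihood f s n x y"
    using ev1
  proof eventually_elim
    case (elim n)
    show ?case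
    proof (intro allI impI, elim conjE)
      fix f s assume s: "s > 0" and f: "\<forall>i. \<bar>f (x i) - f0 (x i)\<bar> \<le> \<eta>" and ss: "\<bar>s - s0\<bar> < \<eta>"
      define V where "V = (\<Sum>i<n. (?e i)\<^sup>2)"
      define S where "S = (\<Sum>i<n. (y i - f (x i))\<^sup>2)"
      have V: "V \<le> 2 * s0\<^sup>2 * real n" "V \<ge> 0" using elim by (auto simp: V_def sum_nonneg)
      have "S \<le> (\<Sum>i<n. (?e i)\<^sup>2 + \<eta> * (?e i)\<^sup>2 + (\<eta> + \<eta>\<^sup>2))"
        unfolding S_def
      proof (rule sum_mono)
        fix i
        define g where "g = f (x i) - f0 (x i)"
        have g: "\<bar>g\<bar> \<le> \<eta>" using f by (simp add: g_def)
        have "g\<^sup>2 \<le> \<eta>\<^sup>2" using g by (metis abs_le_square_iff abs_of_pos \<eta>(1))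
        have "- 2 * ?e i * g \<le> 2 * \<bar>?e i\<bar> * \<bar>g\<bar>"
          using abs_ge_minus_self[of "?e i * g"] unfolding abs_mult mult.assoc by linarith
        also have "\<dots> \<le> 2 * \<bar>?e i\<bar> * \<eta>" using g by (intro mult_left_mono) auto
        also have "\<dots> \<le> \<eta> * (1 + (?e i)\<^sup>2)"
        proof -
          have "0 \<le> (\<bar>?e i\<bar> - 1)\<^sup>2" by simp
          then have "2 * \<bar>?e i\<bar> \<le> 1 + (?e i)\<^sup>2" by (simp add: power2_diff)
          from mult_left_mono[OF this, of \<eta>] \<eta>(1) show ?thesis by (simp add: mult_ac)
        qed
        finally have "- 2 * ?e i * g \<le> \<eta> * (1 + (?e i)\<^sup>2)" .
        moreover have "(y i - f (x i))\<^sup>2 = (?e i)\<^sup>2 + (- 2 * ?e i * g) + g\<^sup>2"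
          by (simp add: g_def power2_eq_square algebra_simps)
        ultimately show "(y i - f (x i))\<^sup>2 \<le> (?e i)\<^sup>2 + \<eta> * (?e i)\<^sup>2 + (\<eta> + \<eta>\<^sup>2)"
          using \<open>g\<^sup>2 \<le> \<eta>\<^sup>2\<close> by (simp add: distrib_left)
      qed
      also have "\<dots> = V + \<eta> * V + (\<eta> + \<eta>\<^sup>2) * real n"
        by (simp add: V_def sum.distrib sum_distrib_left)
      also have "\<dots> \<le> V + \<eta> * (2 * s0\<^sup>2 * real n) + (\<eta> + \<eta>) * real n"
        using V \<eta>(1,2) by (intro add_mono mult_left_mono mult_right_mono) (auto simp: power2_eq_square mult_left_le)
      also have "\<dots> = V + \<eta> * (2 * s0\<^sup>2 + 2) * real n" by (simp add: algebra_simps)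
      finally have S: "S - V \<le> \<eta> * (2 * s0\<^sup>2 + 2) * real n" by simp
      have "s \<ge> s0 / 2" using ss \<eta> by linarith
      then have "(s0 / 2)\<^sup>2 \<le> s\<^sup>2" using \<open>s0 > 0\<close> by (intro power_mono) auto
      then have "1 / s\<^sup>2 \<le> 4 / s0\<^sup>2" using s \<open>s0 > 0\<close> by (simp add: power_divide frac_le field_simps)
      have "(S - V) / s\<^sup>2 \<le> \<eta> * (2 * s0\<^sup>2 + 2) * real n * (1 / s\<^sup>2)"
        using divide_right_mono[OF S, of "s\<^sup>2"] by simp
      also have "\<dots> \<le> \<eta> * (2 * s0\<^sup>2 + 2) * real n * (4 / s0\<^sup>2)"
        using \<open>1 / s\<^sup>2 \<le> 4 / s0\<^sup>2\<close> \<eta>(1) s0p by (intro mult_left_mono) auto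
      also have "\<dots> = (\<eta> * (2 * s0\<^sup>2 + 2) * (4 / s0\<^sup>2)) * real n" by simp
      also have "\<dots> \<le> \<delta> * real n" using \<eta>(5) by (rule mult_right_mono) simp
      finally have 1: "(S - V) / s\<^sup>2 \<le> \<delta> * real n" .
      have "V * (1 / s\<^sup>2 - 1 / s0\<^sup>2) \<le> V * \<bar>1 / s\<^sup>2 - 1 / s0\<^sup>2\<bar>" using V by (intro mult_left_mono) auto
      also have "\<dots> \<le> 2 * s0\<^sup>2 * real n * \<bar>1 / s\<^sup>2 - 1 / s0\<^sup>2\<bar>" using V by (intro mult_right_mono) auto
      finally have "real n * (2 * ln (s / s0)) + V * (1 / s\<^sup>2 - 1 / s0\<^sup>2) \<le> real n * \<psi> s"
        by (simp add: \<psi>_def algebra_simps)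
      also have "\<psi> s \<le> \<delta>"
      proof (cases "s = s0")
        case True then show ?thesis using assms by (simp add: \<psi>_def)
      next
        case False then show ?thesis using d(2)[of s] ss \<eta> by auto
      qed
      finally have "real n * (2 * ln (s / s0)) + V * (1 / s\<^sup>2 - 1 / s0\<^sup>2) \<le> real n * \<delta>"
        by (simp add: mult_left_mono)
      then have "real n * (2 * ln (s / s0)) + S / s\<^sup>2 - V / s0\<^sup>2 \<le> 2 * \<delta> * real n"
        using 1 by (simp add: diff_divide_distrib algebra_simps)
      then show "ennreal (exp (- \<delta> * real n)) * likelihood f0 s0 n x y \<le> likelihood f s n x y"
        unfolding likelihood_ratio[OF s \<open>s0 > 0\<close>, of f n x y f0] S_def[symmetric] V_def[symmetric]
        by (intro mult_right_mono ennreal_leI) auto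
    qed
  qed
  then show ?thesis using that \<eta>(1) by blast
qed

section \<open>The posterior as a quotient of two integrals\<close>

lemma ennreal_inverse_antimono:
  fixes a b :: ennreal
  assumes "a \<le> b"
  shows "inverse b \<le> inverse a"
proof (cases "a = 0 \<or> b = top")
  case False
  then obtain u v where "a = ennreal u" "b = ennreal v" "0 < u" "0 < v"
    using assms by (cases a; cases b) (auto simp: less_le top_unique)
  then show ?thesis using assms by (simp add: inverse_ennreal)
qed auto

text \<open>The likelihood at the truth is positive and finite and cancels; exp (- \<delta> n) over
  exp (- \<delta> n / 2) still tends to 0. Both integrals are compared with simple ones, of a
  constant and of a multiple of the indicator of \<open>B\<close>, since \<open>nn_integral\<close>
  is monotone on arbitrary integrands.\<close>

lemma posterior_tendsto_0:
  fixes Pr :: "param measure"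
  assumes fin: "emeasure Pr (space Pr) < \<infinity>"
    and "\<delta> > 0" and "s0 > 0"
    and good: "AE th in Pr. R (F th) (sigma_of th)"
    and upper: "\<forall>\<^sub>F n in sequentially. \<forall>f s. R f s \<and> P n f s \<longrightarrow>
       likelihood f s n x y \<le> ennreal (exp (- \<delta> * real n)) * likelihood f0 s0 n x y"
    and B: "B \<in> sets Pr" "emeasure Pr B > 0"
    and lower: "\<forall>\<^sub>F n in sequentially. \<forall>th\<in>B.
       ennreal (exp (- (\<delta> / 2) * real n)) * likelihood f0 s0 n x y \<le> likelihood (F th) (sigma_of th) n x y"
  shows "(\<lambda>n. posterior Pr F n x y (P n)) \<longlonglongrightarrow> 0"
proof -
  define L where "L n = likelihood f0 s0 n x y" for n
  have L: "0 < L n" "L n < \<infinity>" for n unfolding L_def likelihood_exp[OF \<open>s0 > 0\<close>] by auto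
  define \<mu> where "\<mu> = measure Pr (space Pr)"
  define b where "b = measure Pr B"
  interpret finite_measure Pr using fin by (intro finite_measureI) auto
  have b: "emeasure Pr B = ennreal b" "b > 0" using B(2) by (auto simp: b_def emeasure_eq_measure)
  have mu: "emeasure Pr (space Pr) = ennreal \<mu>" "\<mu> \<ge> 0" by (auto simp: \<mu>_def emeasure_eq_measure)
  have "\<forall>\<^sub>F n in sequentially. posterior Pr F n x y (P n) \<le> ennreal (exp (- (\<delta> / 2) * real n) * \<mu> / b)"
    using upper lower
  proof eventually_elim
    case (elim n)
    let ?N = "\<integral>\<^sup>+ th. indicator {th. P n (F th) (sigma_of th)} th * likelihood (F th) (sigma_of th) n x y \<partial>Pr"
    let ?D = "\<integral>\<^sup>+ th. likelihood (F th) (sigma_of th) n x y \<partial>Pr"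
    have "?N \<le> (\<integral>\<^sup>+ th. ennreal (exp (- \<delta> * real n)) * L n \<partial>Pr)"
      using good by (intro nn_integral_mono_AE) (use elim(1) in \<open>auto simp: indicator_def L_def\<close>)
    also have "\<dots> = ennreal (exp (- \<delta> * real n)) * L n * ennreal \<mu>" by (simp add: mu)
    finally have N: "?N \<le> ennreal (exp (- \<delta> * real n)) * L n * ennreal \<mu>" .
    have "ennreal (exp (- (\<delta> / 2) * real n)) * L n * ennreal b = (\<integral>\<^sup>+ th. ennreal (exp (- (\<delta> / 2) * real n)) * L n * indicator B th \<partial>Pr)"
      using B(1) by (simp add: nn_integral_cmult_indicator b)
    also have "\<dots> \<le> ?D"
      by (intro nn_integral_mono) (use elim(2) in \<open>auto simp: indicator_def L_def\<close>)
    finally have D: "ennreal (exp (- (\<delta> / 2) * real n)) * L n * ennreal b \<le> ?D" .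
    obtain l where l: "L n = ennreal l" "l > 0"
      using L[of n] by (cases "L n") auto
    have "posterior Pr F n x y (P n) \<le> (ennreal (exp (- \<delta> * real n)) * L n * ennreal \<mu>) / (ennreal (exp (- (\<delta> / 2) * real n)) * L n * ennreal b)"
      unfolding posterior_def divide_ennreal_def using N D by (intro mult_mono ennreal_inverse_antimono) auto
    also have "\<dots> = ennreal (exp (- \<delta> * real n) * l * \<mu> / (exp (- (\<delta> / 2) * real n) * l * b))"
      unfolding l using l b mu by (simp add: ennreal_mult[symmetric] divide_ennreal)
    also have "exp (- \<delta> * real n) * l * \<mu> / (exp (- (\<delta> / 2) * real n) * l * b) = exp (- (\<delta> / 2) * real n) * \<mu> / b"
    proof -
      have "exp (- \<delta> * real n) = exp (- (\<delta> / 2) * real n) * exp (- (\<delta> / 2) * real n)"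
        by (simp add: exp_add[symmetric])
      then show ?thesis using l b by simp
    qed
    finally show ?case .
  qed
  moreover have "(\<lambda>n. ennreal (exp (- (\<delta> / 2) * real n) * \<mu> / b)) \<longlonglongrightarrow> ennreal (0 * \<mu> / b)"
  proof (intro tendsto_ennrealI tendsto_intros)
    have "(\<lambda>n. exp (- (\<delta> / 2)) ^ n) \<longlonglongrightarrow> 0"
      using \<open>\<delta> > 0\<close> by (intro LIMSEQ_realpow_zero) auto
    then show "(\<lambda>n. exp (- (\<delta> / 2) * real n)) \<longlonglongrightarrow> 0"
      by (simp add: exp_of_nat_mult[symmetric] mult.commute)
  qed (use b in auto)
  ultimately show ?thesis
    using tendsto_sandwich[OF always_eventually[of "\<lambda>n. 0 \<le> posterior Pr F n x y (P n)"] _ tendsto_const] by simp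
qed

section \<open>Exponential moments\<close>

text \<open>Borel-Cantelli in expectation form: the sum of all \<open>X n\<close> has finite
  integral, so almost surely the terms tend to 0. When \<open>X n\<close> is an exponential,
  \<open>X n z < 1\<close> says that its exponent is negative.\<close>

lemma AE_eventually_less_1:
  fixes X :: "nat \<Rightarrow> 'a \<Rightarrow> ennreal"
  assumes [measurable]: "\<And>n. X n \<in> borel_measurable M"
    and le: "\<And>n. (\<integral>\<^sup>+ z. X n z \<partial>M) \<le> ennreal (a n)" and "\<And>n. a n \<ge> 0" "summable a"
  shows "AE z in M. \<forall>\<^sub>F n in sequentially. X n z < 1"
proof -
  have "(\<integral>\<^sup>+ z. (\<Sum>n. X n z) \<partial>M) = (\<Sum>n. \<integral>\<^sup>+ z. X n z \<partial>M)" by (rule nn_integral_suminf) simp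
  also have "\<dots> \<le> (\<Sum>n. ennreal (a n))" by (intro suminf_le le) auto
  also have "\<dots> = ennreal (\<Sum>n. a n)" by (rule suminf_ennreal2) fact+
  also have "\<dots> < \<infinity>" by simp
  finally have "AE z in M. (\<Sum>n. X n z) \<noteq> \<infinity>"
    by (intro nn_integral_PInf_AE) (auto simp: less_top)
  then show ?thesis
  proof eventually_elim
    case (elim z)
    have fin: "X n z = ennreal (enn2real (X n z))" for n
    proof -
      have "X n z \<noteq> top" using elim ennreal_suminf_lessD[of "\<lambda>n. X n z" top n] by (auto simp: less_top)
      then show ?thesis by (simp add: less_top)
    qed
    have "summable (\<lambda>n. enn2real (X n z))"
      using elim fin by (intro summable_suminf_not_top) auto
    from summable_LIMSEQ_zero[OF this] have "\<forall>\<^sub>F n in sequentially. enn2real (X n z) < 1"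
      by (rule order_tendstoD) simp
    then show ?case
      by eventually_elim (subst fin, simp add: ennreal_less_one_iff)
  qed
qed

lemma nn_integral_PiM_prod:
  fixes M :: "nat \<Rightarrow> 'a measure" and h :: "nat \<Rightarrow> 'a \<Rightarrow> ennreal"
  assumes "\<And>i. prob_space (M i)" and [measurable]: "\<And>i. h i \<in> borel_measurable (M i)"
  shows "(\<integral>\<^sup>+ z. (\<Prod>i<n. h i (z i)) \<partial>PiM UNIV M) = (\<Prod>i<n. \<integral>\<^sup>+ u. h i u \<partial>M i)"
proof -
  interpret product_prob_space M UNIV
    using assms(1) by (simp add: product_prob_space_def product_prob_space_axioms_def product_sigma_finite_def prob_space_imp_sigma_finite)
  have "(\<integral>\<^sup>+ z. (\<Prod>i<n. h i (z i)) \<partial>PiM UNIV M) = (\<integral>\<^sup>+ z. (\<Prod>i<n. h i (restrict z {..<n} i)) \<partial>PiM UNIV M)"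
    by (intro nn_integral_cong prod.cong) auto
  also have "\<dots> = (\<integral>\<^sup>+ z. (\<Prod>i<n. h i (z i)) \<partial>distr (PiM UNIV M) (PiM {..<n} M) (\<lambda>z. restrict z {..<n}))"
    by (subst nn_integral_distr) auto
  also have "distr (PiM UNIV M) (PiM {..<n} M) (\<lambda>z. restrict z {..<n}) = PiM {..<n} M"
    by (rule distr_PiM_restrict_finite) auto
  also have "(\<integral>\<^sup>+ z. (\<Prod>i<n. h i (z i)) \<partial>PiM {..<n} M) = (\<Prod>i<n. \<integral>\<^sup>+ u. h i u \<partial>M i)"
    by (rule product_nn_integral_prod) auto
  finally show ?thesis .
qed

lemma nn_integral_PiM_exp_sum:
  fixes M :: "nat \<Rightarrow> 'a measure" and h :: "nat \<Rightarrow> 'a \<Rightarrow> real"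
  assumes "\<And>i. prob_space (M i)" and [measurable]: "\<And>i. h i \<in> borel_measurable (M i)"
    and le: "\<And>i. i < n \<Longrightarrow> (\<integral>\<^sup>+ u. ennreal (exp (h i u)) \<partial>M i) \<le> ennreal \<rho>" and "\<rho> \<ge> 0"
  shows "(\<integral>\<^sup>+ z. ennreal (exp (\<Sum>i<n. h i (z i))) \<partial>PiM UNIV M) \<le> ennreal (\<rho> ^ n)"
proof -
  have "(\<integral>\<^sup>+ z. ennreal (exp (\<Sum>i<n. h i (z i))) \<partial>PiM UNIV M) = (\<integral>\<^sup>+ z. (\<Prod>i<n. ennreal (exp (h i (z i)))) \<partial>PiM UNIV M)"
    by (simp add: exp_sum prod_ennreal)
  also have "\<dots> = (\<Prod>i<n. \<integral>\<^sup>+ u. ennreal (exp (h i u)) \<partial>M i)"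
    using assms(1) by (intro nn_integral_PiM_prod) auto
  also have "\<dots> \<le> (\<Prod>i<n. ennreal \<rho>)" by (intro prod_mono_ennreal le) auto
  also have "\<dots> = ennreal (\<rho> ^ n)" using \<open>\<rho> \<ge> 0\<close> by (simp add: ennreal_power)
  finally show ?thesis .
qed

text \<open>Chernoff's bound with tilt and threshold both contained in \<open>h\<close>;
  independence turns the coordinate bound into \<open>\<rho> ^ n\<close>, which is summable.\<close>

lemma chernoff_AE:
  fixes M :: "nat \<Rightarrow> 'a measure" and h :: "nat \<Rightarrow> 'a \<Rightarrow> real"
  assumes "\<And>i. prob_space (M i)" and [measurable]: "\<And>i. h i \<in> borel_measurable (M i)"
    and le: "\<And>i. (\<integral>\<^sup>+ u. ennreal (exp (h i u)) \<partial>M i) \<le> ennreal \<rho>" and "\<rho> \<ge> 0" "\<rho> < 1"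
  shows "AE z in PiM UNIV M. \<forall>\<^sub>F n in sequentially. (\<Sum>i<n. h i (z i)) < 0"
proof -
  have "AE z in PiM UNIV M. \<forall>\<^sub>F n in sequentially. ennreal (exp (\<Sum>i<n. h i (z i))) < 1"
  proof (rule AE_eventually_less_1)
    show "(\<integral>\<^sup>+ z. ennreal (exp (\<Sum>i<n. h i (z i))) \<partial>PiM UNIV M) \<le> ennreal (\<rho> ^ n)" for n
      by (rule nn_integral_PiM_exp_sum[OF assms(1,2) le \<open>\<rho> \<ge> 0\<close>])
    show "summable (\<lambda>n. \<rho> ^ n)" using assms by (intro summable_geometric) auto
  qed (use assms in auto)
  then show ?thesis by (simp add: ennreal_less_one_iff)
qed

lemma prob_space_normal_measure: "s > 0 \<Longrightarrow> prob_space (normal_measure \<mu> s)"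
  unfolding normal_measure_def by (rule prob_space_normal_density)

lemma sets_normal_measure [measurable_cong, simp]: "sets (normal_measure \<mu> s) = sets borel"
  by (simp add: normal_measure_def)

lemma space_normal_measure [simp]: "space (normal_measure \<mu> s) = UNIV"
  by (simp add: normal_measure_def)

lemma nn_integral_normal_measure:
  assumes [measurable]: "g \<in> borel_measurable borel"
  shows "(\<integral>\<^sup>+ u. g u \<partial>normal_measure \<mu> s) = (\<integral>\<^sup>+ u. ennreal (normal_density \<mu> s u) * g u \<partial>lborel)"
  unfolding normal_measure_def by (subst nn_integral_density) auto

lemma nn_integral_normal_density:
  "s > 0 \<Longrightarrow> (\<integral>\<^sup>+ u. ennreal (normal_density \<mu> s u) \<partial>lborel) = 1"
  using prob_space.emeasure_space_1[OF prob_space_normal_density[of s \<mu>]]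
  by (simp add: emeasure_density)

text \<open>Completing the square: the tilt moves the mean to \<mu> + c s^2. The constant t is the
  threshold that the Chernoff bounds subtract.\<close>

lemma normal_exp_linear:
  assumes "s > 0"
  shows "(\<integral>\<^sup>+ u. ennreal (exp (c * (u - \<mu>) - t)) \<partial>normal_measure \<mu> s) = ennreal (exp (c\<^sup>2 * s\<^sup>2 / 2 - t))"
proof -
  have eq: "normal_density \<mu> s u * exp (c * (u - \<mu>) - t) = exp (c\<^sup>2 * s\<^sup>2 / 2 - t) * normal_density (\<mu> + c * s\<^sup>2) s u" for u
  proof -
    have "- (u - \<mu>)\<^sup>2 / (2 * s\<^sup>2) + (c * (u - \<mu>) - t) = (c\<^sup>2 * s\<^sup>2 / 2 - t) + - (u - (\<mu> + c * s\<^sup>2))\<^sup>2 / (2 * s\<^sup>2)"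
      using assms by (simp add: field_simps power2_eq_square)
    then have "exp (- (u - \<mu>)\<^sup>2 / (2 * s\<^sup>2)) * exp (c * (u - \<mu>) - t) = exp (c\<^sup>2 * s\<^sup>2 / 2 - t) * exp (- (u - (\<mu> + c * s\<^sup>2))\<^sup>2 / (2 * s\<^sup>2))"
      unfolding exp_add[symmetric] by simp
    then show ?thesis unfolding normal_density_def by (simp add: mult.assoc mult.left_commute)
  qed
  have "(\<integral>\<^sup>+ u. ennreal (exp (c * (u - \<mu>) - t)) \<partial>normal_measure \<mu> s)
      = (\<integral>\<^sup>+ u. ennreal (exp (c\<^sup>2 * s\<^sup>2 / 2 - t)) * ennreal (normal_density (\<mu> + c * s\<^sup>2) s u) \<partial>lborel)"
    by (simp add: nn_integral_normal_measure ennreal_mult[symmetric] eq)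
  also have "\<dots> = ennreal (exp (c\<^sup>2 * s\<^sup>2 / 2 - t))"
    using assms by (simp add: nn_integral_cmult nn_integral_normal_density)
  finally show ?thesis .
qed

text \<open>The quadratic tilt changes the variance from s^2 to s^2 / r with r = 1 - 2 c s^2; the
  factor r^(-1/2) is written as an exponential to combine with the threshold.\<close>

lemma normal_exp_square:
  assumes "s > 0" "2 * c * s\<^sup>2 < 1"
  shows "(\<integral>\<^sup>+ u. ennreal (exp (c * (u - \<mu>)\<^sup>2 - t)) \<partial>normal_measure \<mu> s) = ennreal (exp (- t - ln (1 - 2 * c * s\<^sup>2) / 2))"
proof -
  define r where "r = 1 - 2 * c * s\<^sup>2"
  have r: "r > 0" using assms by (simp add: r_def)
  define s' where "s' = s / sqrt r"
  have s': "s' > 0" "s'\<^sup>2 = s\<^sup>2 / r" using assms r by (auto simp: s'_def power_divide)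
  have eq: "normal_density \<mu> s u * exp (c * (u - \<mu>)\<^sup>2 - t) = exp (- t - ln r / 2) * normal_density \<mu> s' u" for u
  proof -
    have "- (u - \<mu>)\<^sup>2 / (2 * s\<^sup>2) + (c * (u - \<mu>)\<^sup>2 - t) = - t + - (u - \<mu>)\<^sup>2 / (2 * (s\<^sup>2 / r))"
      using assms r by (simp add: field_simps) (simp add: r_def algebra_simps)
    then have 1: "exp (- (u - \<mu>)\<^sup>2 / (2 * s\<^sup>2)) * exp (c * (u - \<mu>)\<^sup>2 - t) = exp (- t) * exp (- (u - \<mu>)\<^sup>2 / (2 * (s\<^sup>2 / r)))"
      unfolding exp_add[symmetric] by simp
    have "sqrt r = exp (ln r / 2)" using r by (simp add: ln_sqrt[symmetric])
    then have 2: "exp (- t - ln r / 2) = exp (- t) / sqrt r" by (simp add: exp_diff)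
    have 3: "1 / sqrt (2 * pi * (s\<^sup>2 / r)) = sqrt r * (1 / sqrt (2 * pi * s\<^sup>2))"
      using r by (simp add: real_sqrt_divide real_sqrt_mult)
    show ?thesis unfolding normal_density_def s'(2) 2 3 using 1 r by (simp add: mult.assoc mult.left_commute)
  qed
  have "(\<integral>\<^sup>+ u. ennreal (exp (c * (u - \<mu>)\<^sup>2 - t)) \<partial>normal_measure \<mu> s)
      = (\<integral>\<^sup>+ u. ennreal (exp (- t - ln r / 2)) * ennreal (normal_density \<mu> s' u) \<partial>lborel)"
    by (simp add: nn_integral_normal_measure ennreal_mult[symmetric] eq)
  also have "\<dots> = ennreal (exp (- t - ln r / 2))"
    using s' by (simp add: nn_integral_cmult nn_integral_normal_density)
  finally show ?thesis by (simp add: r_def)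
qed

section \<open>Almost sure regularity of the noise\<close>

lemma AE_eventually_mono:
  assumes "AE z in M. \<forall>\<^sub>F n in F. P n z" and "\<And>n z. P n z \<Longrightarrow> R n z"
  shows "AE z in M. \<forall>\<^sub>F n in F. R n z"
  using assms(1) by eventually_elim (auto elim!: eventually_mono intro: assms(2))

text \<open>Monotonicity in t reduces uncountably many null sets to those for t = 1 / (k +
  1).\<close>

lemma AE_all_positive_reals:
  assumes mono: "\<And>s t z. 0 < s \<Longrightarrow> s \<le> t \<Longrightarrow> P s z \<Longrightarrow> P t z"
    and AE: "\<And>t::real. t > 0 \<Longrightarrow> AE z in M. P t z"
  shows "AE z in M. \<forall>t>0. P t z"
proof -
  have "AE z in M. \<forall>k::nat. P (1 / real (Suc k)) z"
    unfolding AE_all_countable by (intro allI AE) simp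
  then show ?thesis
  proof eventually_elim
    case (elim z)
    show ?case
    proof (intro allI impI)
      fix t :: real assume "t > 0"
      then obtain k where "1 / real (Suc k) < t" using nat_approx_posE by blast
      then show "P t z" using mono[of "1 / real (Suc k)" t z] elim by auto
    qed
  qed
qed

text \<open>The fourth power leaves room: two factors r^n tame n^2, the other two form a geometric
  series. The n^2 counts pairs of design points.\<close>

lemma summable_square_times_power:
  fixes r :: real
  assumes "0 < r" "r < 1"
  shows "summable (\<lambda>n. real n ^ 2 * (r ^ 4) ^ n)"
proof (rule summable_comparison_test_ev)
  have "(\<lambda>n. of_nat n * r ^ n) \<longlonglongrightarrow> 0" by (rule powser_times_n_limit_0) (use assms in auto)
  then have "\<forall>\<^sub>F n in sequentially. real n * r ^ n < 1" by (rule order_tendstoD) simp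
  then show "\<forall>\<^sub>F n in sequentially. norm (real n ^ 2 * (r ^ 4) ^ n) \<le> (r ^ 2) ^ n"
  proof eventually_elim
    case (elim n)
    have "real n ^ 2 * (r ^ 4) ^ n = (real n * r ^ n)\<^sup>2 * (r ^ 2) ^ n"
      by (simp add: power_mult_distrib power_mult[symmetric] power_add[symmetric] algebra_simps)
    also have "\<dots> \<le> 1 * (r ^ 2) ^ n"
      using elim assms by (intro mult_right_mono power_le_one) auto
    finally show ?case using assms by simp
  qed
  show "summable (\<lambda>n. (r ^ 2) ^ n)" using assms by (intro summable_geometric) (simp add: power_less_one_iff)
qed

lemma interval_noise_sums:
  fixes x :: "nat \<Rightarrow> real"
  assumes "s > 0" "t > 0"
  shows "AE y in PiM UNIV (\<lambda>i. normal_measure (\<mu> i) s). \<forall>\<^sub>F n in sequentially.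
    \<forall>I. is_interval I \<longrightarrow> \<bar>\<Sum>i | i < n \<and> x i \<in> I. y i - \<mu> i\<bar> \<le> t * real n"
proof -
  let ?M = "\<lambda>i. normal_measure (\<mu> i) s"
  \<comment> \<open>The optimal tilt: c^2 s^2 / 2 - c t is least at c = t / s^2, with value - t^2 /
    (2 s^2).\<close>
  define l where "l = t / s\<^sup>2"
  have l: "l > 0" using assms by (simp add: l_def)
  \<comment> \<open>Fourth root of the Chernoff factor, to fit
    \<open>summable_square_times_power\<close>.\<close>
  define r where "r = exp (- t\<^sup>2 / (8 * s\<^sup>2))"
  have r: "0 < r" "r < 1" using assms by (auto simp: r_def)
  have r4: "r ^ 4 = exp (- t\<^sup>2 / (2 * s\<^sup>2))" by (simp add: r_def exp_of_nat_mult[symmetric])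
  \<comment> \<open>A nonempty trace of an interval consists of all design points between its least
    and its greatest one; p and q are indices of these two.\<close>
  define J where "J n p q = {i. i < n \<and> x p \<le> x i \<and> x i \<le> x q}" for n p q
  \<comment> \<open>The threshold l t is subtracted in every coordinate, also outside the trace,
    because the claim compares with t n and not with the number of points in the interval.\<close>
  define h where "h c n p q i u = (if i \<in> J n p q then c * (u - \<mu> i) else 0) - l * t" for c n p q i u
  define Y where "Y c n p q y = ennreal (exp (\<Sum>i<n. h c n p q i (y i)))" for c n p q and y :: "nat \<Rightarrow> real"
  have [measurable]: "h c n p q i \<in> borel_measurable borel" for c n p q i unfolding h_def by measurable
  have [measurable]: "Y c n p q \<in> borel_measurable (PiM UNIV ?M)" for c n p q unfolding Y_def by measurable
  have Y: "(\<integral>\<^sup>+ y. Y c n p q y \<partial>PiM UNIV ?M) \<le> ennreal ((r ^ 4) ^ n)" if c: "\<bar>c\<bar> = l" for c n p q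
    unfolding Y_def
  proof (rule nn_integral_PiM_exp_sum)
    fix i
    have c2: "c\<^sup>2 = l\<^sup>2" using c by (metis power2_abs)
    have e: "c\<^sup>2 * s\<^sup>2 / 2 - l * t = - t\<^sup>2 / (2 * s\<^sup>2)"
      unfolding c2 l_def using assms by (simp add: field_simps power2_eq_square)
    have "- (l * t) \<le> - t\<^sup>2 / (2 * s\<^sup>2)" using assms unfolding e[symmetric] by simp
    then show "(\<integral>\<^sup>+ u. ennreal (exp (h c n p q i u)) \<partial>?M i) \<le> ennreal (r ^ 4)"
      using normal_exp_linear[OF assms(1), of "\<mu> i" c "l * t"] prob_space.emeasure_space_1[OF prob_space_normal_measure[OF assms(1)]]
      by (cases "i \<in> J n p q") (simp_all add: h_def e r4)
  qed (use prob_space_normal_measure assms r in auto)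
  \<comment> \<open>The union bound as a single variable: \<open>X n y < 1\<close> makes the
    exponents for all pairs and both signs negative simultaneously.\<close>
  define X where "X n y = (\<Sum>p<n. \<Sum>q<n. Y l n p q y + Y (- l) n p q y)" for n y
  have "AE y in PiM UNIV ?M. \<forall>\<^sub>F n in sequentially. X n y < 1"
  proof (rule AE_eventually_less_1)
    show "X n \<in> borel_measurable (PiM UNIV ?M)" for n unfolding X_def by measurable
    show "summable (\<lambda>n. 2 * (real n ^ 2 * (r ^ 4) ^ n))"
      using r by (intro summable_mult summable_square_times_power)
    fix n
    show "0 \<le> 2 * (real n ^ 2 * (r ^ 4) ^ n)" using r by simp
    have "(\<integral>\<^sup>+ y. X n y \<partial>PiM UNIV ?M) = (\<Sum>p<n. \<Sum>q<n. (\<integral>\<^sup>+ y. Y l n p q y \<partial>PiM UNIV ?M) + (\<integral>\<^sup>+ y. Y (- l) n p q y \<partial>PiM UNIV ?M))"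
      unfolding X_def by (simp add: nn_integral_sum nn_integral_add)
    also have "\<dots> \<le> (\<Sum>p<n. \<Sum>q<n. ennreal ((r ^ 4) ^ n) + ennreal ((r ^ 4) ^ n))"
      using l by (intro sum_mono add_mono Y) auto
    also have "\<dots> = ennreal (2 * (real n ^ 2 * (r ^ 4) ^ n))"
      using r by (simp add: ennreal_plus[symmetric] ennreal_of_nat_eq_real_of_nat ennreal_mult[symmetric] power2_eq_square mult_ac del: ennreal_plus)
    finally show "(\<integral>\<^sup>+ y. X n y \<partial>PiM UNIV ?M) \<le> ennreal (2 * (real n ^ 2 * (r ^ 4) ^ n))" .
  qed
  then show ?thesis
  proof eventually_elim
    case (elim y)
    from elim show ?case
    proof eventually_elim
      case (elim n)
      have bound: "\<bar>\<Sum>i\<in>J n p q. y i - \<mu> i\<bar> \<le> t * real n" if pq: "p < n" "q < n" for p q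
      proof -
        have "Y l n p q y + Y (- l) n p q y \<le> (\<Sum>q<n. Y l n p q y + Y (- l) n p q y)"
          by (rule member_le_sum) (use pq in auto)
        also have "\<dots> \<le> X n y" unfolding X_def by (rule member_le_sum) (use pq in auto)
        finally have *: "Y l n p q y + Y (- l) n p q y < 1" using elim by simp
        have sm: "(\<Sum>i<n. h c n p q i (y i)) = c * (\<Sum>i\<in>J n p q. y i - \<mu> i) - real n * (l * t)" for c
        proof -
          have "(\<Sum>i\<in>J n p q. c * (y i - \<mu> i)) = (\<Sum>i<n. if i \<in> J n p q then c * (y i - \<mu> i) else 0)"
            by (intro sum.mono_neutral_cong_left) (auto simp: J_def)
          moreover have "(\<Sum>i<n. h c n p q i (y i)) = (\<Sum>i<n. if i \<in> J n p q then c * (y i - \<mu> i) else 0) - real n * (l * t)"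
            unfolding h_def by (subst sum_subtractf) simp
          ultimately show ?thesis by (simp only: sum_distrib_left)
        qed
        have "Y l n p q y < 1"
          by (rule le_less_trans[OF add_increasing2[OF zero_le order_refl] *])
        then have "l * (\<Sum>i\<in>J n p q. y i - \<mu> i) < l * (t * real n)"
          unfolding Y_def sm ennreal_less_one_iff exp_less_one_iff by (simp add: mult_ac)
        moreover have "Y (- l) n p q y < 1"
          by (rule le_less_trans[OF add_increasing[OF zero_le order_refl] *])
        then have "l * (- (\<Sum>i\<in>J n p q. y i - \<mu> i)) < l * (t * real n)"
          unfolding Y_def sm ennreal_less_one_iff exp_less_one_iff by (simp add: mult_ac)
        ultimately show ?thesis unfolding mult_less_cancel_left_pos[OF l] by linarith
      qed
      show ?case
      proof safe
        fix I :: "real set" assume I: "is_interval I"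
        define K where "K = {i. i < n \<and> x i \<in> I}"
        have fK: "finite K" by (simp add: K_def)
        show "\<bar>\<Sum>i | i < n \<and> x i \<in> I. y i - \<mu> i\<bar> \<le> t * real n"
        proof (cases "K = {}")
          case True
          then show ?thesis unfolding K_def[symmetric] using assms by simp
        next
          case False
          have "Min (x ` K) \<in> x ` K" "Max (x ` K) \<in> x ` K" using fK False by auto
          then obtain p q where pq: "p \<in> K" "x p = Min (x ` K)" "q \<in> K" "x q = Max (x ` K)" by force
          have "x p \<le> x i" "x i \<le> x q" if "i \<in> K" for i unfolding pq using fK that by (intro Min_le Max_ge; simp)+
          moreover have "x p \<in> I" "x q \<in> I" and pqn: "p < n" "q < n" using pq by (auto simp: K_def)
          ultimately have "K = J n p q"
            using mem_is_interval_1_I[OF I \<open>x p \<in> I\<close> \<open>x q \<in> I\<close>] unfolding K_def J_def by blast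
          then show ?thesis using bound[OF pqn] unfolding K_def by simp
        qed
      qed
    qed
  qed
qed

text \<open>For z = u - \<mu> with |z| > L one has c z^2 <= 2 c z^2 - c L^2. So the exponential
  moment of the truncated square exceeds 1 by at most exp (- c L^2) times a finite moment, which is
  small for large L.\<close>

lemma truncated_noise_squares:
  assumes "s > 0" "t > 0"
  obtains L where "L > 0" "AE y in PiM UNIV (\<lambda>i. normal_measure (\<mu> i) s). \<forall>\<^sub>F n in sequentially.
    (\<Sum>i<n. if \<bar>y i - \<mu> i\<bar> > L then (y i - \<mu> i)\<^sup>2 else 0) \<le> t * real n"
proof -
  \<comment> \<open>So small that even the doubled tilt \<open>2 * c\<close> has a finite moment: 1
    - 2 (2 c) s^2 = 1/2.\<close>
  define c where "c = 1 / (8 * s\<^sup>2)"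
  have c: "c > 0" "2 * (2 * c) * s\<^sup>2 = 1/2" using assms by (auto simp: c_def)
  define E where "E = exp (c * t) - 1"
  have E: "E > 0" using c assms by (simp add: E_def)
  \<comment> \<open>This yields exp (- c L^2) <= E / 4 by way of c L^2 <= exp (c L^2). The quadratic
    moment contributes sqrt 2, bounded by 2, so the excess is at most E / 2.\<close>
  define L where "L = max 1 (4 / (c * E))"
  have L: "L \<ge> 1" "L \<ge> 4 / (c * E)" by (auto simp: L_def)
  have expL: "exp (- (c * L\<^sup>2)) \<le> E / 4"
  proof -
    have "4 \<le> L * (c * E)" using L(2) c E by (simp add: pos_divide_le_eq)
    also have "\<dots> \<le> L\<^sup>2 * (c * E)" using L(1) c E by (intro mult_right_mono) (auto simp: power2_eq_square)
    also have "\<dots> \<le> exp (c * L\<^sup>2) * E"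
    proof -
      have "c * L\<^sup>2 \<le> exp (c * L\<^sup>2)" using exp_ge_add_one_self[of "c * L\<^sup>2"] by linarith
      then have "(c * L\<^sup>2) * E \<le> exp (c * L\<^sup>2) * E" using E by (intro mult_right_mono) auto
      then show ?thesis by (simp add: mult_ac)
    qed
    finally show ?thesis by (simp add: exp_minus field_simps)
  qed
  define \<rho> where "\<rho> = exp (- (c * t)) * (1 + E / 2)"
  have "\<rho> < 1"
  proof -
    have "exp (c * t) = 1 + E" by (simp add: E_def)
    then have "1 + E / 2 < exp (c * t)" using E by simp
    then show ?thesis by (simp add: \<rho>_def exp_minus field_simps)
  qed
  let ?h = "\<lambda>i u. c * (if \<bar>u - \<mu> i\<bar> > L then (u - \<mu> i)\<^sup>2 else 0) - c * t"
  have "AE y in PiM UNIV (\<lambda>i. normal_measure (\<mu> i) s). \<forall>\<^sub>F n in sequentially. (\<Sum>i<n. ?h i (y i)) < 0"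
  proof (rule chernoff_AE)
    fix i
    have "(\<integral>\<^sup>+ u. ennreal (exp (?h i u)) \<partial>normal_measure (\<mu> i) s) \<le>
       (\<integral>\<^sup>+ u. ennreal (exp (0 * (u - \<mu> i) - c * t)) + ennreal (exp (2 * c * (u - \<mu> i)\<^sup>2 - (c * t + c * L\<^sup>2))) \<partial>normal_measure (\<mu> i) s)"
    proof (rule nn_integral_mono)
      fix u
      have "exp (?h i u) \<le> exp (2 * c * (u - \<mu> i)\<^sup>2 - (c * t + c * L\<^sup>2))" if "\<bar>u - \<mu> i\<bar> > L"
      proof -
        have "L\<^sup>2 \<le> (u - \<mu> i)\<^sup>2" using that L by (metis abs_le_square_iff abs_of_nonneg less_eq_real_def order_trans zero_le_one)
        then have "c * L\<^sup>2 \<le> c * (u - \<mu> i)\<^sup>2" using c by simp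
        then have "?h i u \<le> 2 * c * (u - \<mu> i)\<^sup>2 - (c * t + c * L\<^sup>2)" unfolding if_P[OF that] by linarith
        then show ?thesis unfolding exp_le_cancel_iff .
      qed
      moreover have "exp (?h i u) = exp (0 * (u - \<mu> i) - c * t)" if "\<not> \<bar>u - \<mu> i\<bar> > L"
        using that by simp
      ultimately show "ennreal (exp (?h i u)) \<le> ennreal (exp (0 * (u - \<mu> i) - c * t)) + ennreal (exp (2 * c * (u - \<mu> i)\<^sup>2 - (c * t + c * L\<^sup>2)))"
        by (metis add_increasing add_increasing2 ennreal_leI order_refl zero_le)
    qed
    also have "\<dots> = (\<integral>\<^sup>+ u. ennreal (exp (0 * (u - \<mu> i) - c * t)) \<partial>normal_measure (\<mu> i) s)
       + (\<integral>\<^sup>+ u. ennreal (exp (2 * c * (u - \<mu> i)\<^sup>2 - (c * t + c * L\<^sup>2))) \<partial>normal_measure (\<mu> i) s)"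
      by (rule nn_integral_add) auto
    also have "\<dots> = ennreal (exp (- (c * t))) + ennreal (exp (- (c * t + c * L\<^sup>2) - ln (1/2) / 2))"
      using normal_exp_linear[OF assms(1), of "\<mu> i" 0 "c * t"] normal_exp_square[OF assms(1), of "2 * c" "\<mu> i" "c * t + c * L\<^sup>2"] c(2)
      by simp
    also have "\<dots> \<le> ennreal \<rho>"
    proof -
      have "exp (- ln (1/2) / 2) \<le> (2::real)"
      proof -
        have "exp (- ln (1/2) / 2) = exp (ln 2 / (2::real))" by (simp add: ln_div)
        also have "\<dots> \<le> exp (ln 2)" by (subst exp_le_cancel_iff) simp
        finally show ?thesis by simp
      qed
      then have "exp (- (c * t)) * (exp (- (c * L\<^sup>2)) * exp (- ln (1/2) / 2)) \<le> exp (- (c * t)) * (E / 4 * 2)"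
        using expL E by (intro mult_left_mono mult_mono) auto
      moreover have "exp (- (c * t + c * L\<^sup>2) - ln (1/2) / 2) = exp (- (c * t)) * (exp (- (c * L\<^sup>2)) * exp (- ln (1/2) / 2))"
        by (simp add: exp_add[symmetric])
      ultimately show ?thesis
        by (simp add: \<rho>_def distrib_left ennreal_plus[symmetric] del: ennreal_plus) (intro ennreal_leI; simp)
    qed
    finally show "(\<integral>\<^sup>+ u. ennreal (exp (?h i u)) \<partial>normal_measure (\<mu> i) s) \<le> ennreal \<rho>" .
  qed (use \<open>\<rho> < 1\<close> E assms prob_space_normal_measure in \<open>auto simp: \<rho>_def\<close>)
  then have "AE y in PiM UNIV (\<lambda>i. normal_measure (\<mu> i) s). \<forall>\<^sub>F n in sequentially.
    (\<Sum>i<n. if \<bar>y i - \<mu> i\<bar> > L then (y i - \<mu> i)\<^sup>2 else 0) \<le> t * real n"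
  proof (rule AE_eventually_mono)
    fix n y assume elim: "(\<Sum>i<n. ?h i (y i)) < 0"
    then have "c * (\<Sum>i<n. if \<bar>y i - \<mu> i\<bar> > L then (y i - \<mu> i)\<^sup>2 else 0) < c * (t * real n)"
      unfolding sum_distrib_left sum_subtractf by (simp add: mult_ac)
    then show "(\<Sum>i<n. if \<bar>y i - \<mu> i\<bar> > L then (y i - \<mu> i)\<^sup>2 else 0) \<le> t * real n" using c by simp
  qed
  then show ?thesis using that[of L] L by simp
qed

lemma noise_squares_LLN:
  assumes "s > 0" "t > 0"
  shows "AE y in PiM UNIV (\<lambda>i. normal_measure (\<mu> i) s). \<forall>\<^sub>F n in sequentially.
    \<bar>(\<Sum>i<n. (y i - \<mu> i)\<^sup>2) - s\<^sup>2 * real n\<bar> \<le> t * real n"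
proof -
  \<comment> \<open>The first entry gives u <= 1/2, where ln (1 - u) has a quadratic lower bound.
    The second gives u^2 <= c t / 2, so the quadratic error uses up at most half of the
    threshold.\<close>
  define c where "c = min (1 / (4 * s\<^sup>2)) (t / (8 * s ^ 4))"
  have c: "c > 0" using assms by (simp add: c_def)
  define u where "u = 2 * c * s\<^sup>2"
  have u: "0 < u" "u \<le> 1/2"
  proof -
    show "0 < u" using c assms by (simp add: u_def)
    have "c \<le> 1 / (4 * s\<^sup>2)" by (simp add: c_def)
    then show "u \<le> 1/2" using assms by (simp add: u_def pos_le_divide_eq)
  qed
  have u2: "u\<^sup>2 \<le> c * t / 2"
  proof -
    have "c \<le> t / (8 * s ^ 4)" by (simp add: c_def)
    then have "c * (8 * s ^ 4) \<le> t" using assms by (simp add: pos_le_divide_eq)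
    then have "c * (c * (8 * s ^ 4)) \<le> c * t" using c by simp
    moreover have "u\<^sup>2 = c * (c * (8 * s ^ 4)) / 2"
      by (simp add: u_def power_mult_distrib power2_eq_square power4_eq_xxxx)
    ultimately show ?thesis by linarith
  qed
  define \<rho> where "\<rho> = exp (- (c * t / 2))"
  have \<rho>: "0 \<le> \<rho>" "\<rho> < 1" using c assms by (auto simp: \<rho>_def)
  have "AE y in PiM UNIV (\<lambda>i. normal_measure (\<mu> i) s). \<forall>\<^sub>F n in sequentially. (\<Sum>i<n. c * (y i - \<mu> i)\<^sup>2 - c * (s\<^sup>2 + t)) < 0"
  proof (rule chernoff_AE)
    fix i
    have "- u - 2 * u\<^sup>2 \<le> ln (1 - u)" using u by (intro ln_one_minus_pos_lower_bound) auto
    then have "- (c * (s\<^sup>2 + t)) - ln (1 - u) / 2 \<le> - (c * t / 2)"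
      using u2 by (simp add: u_def distrib_left)
    then show "(\<integral>\<^sup>+ z. ennreal (exp (c * (z - \<mu> i)\<^sup>2 - c * (s\<^sup>2 + t))) \<partial>normal_measure (\<mu> i) s) \<le> ennreal \<rho>"
      using normal_exp_square[OF assms(1), of c "\<mu> i" "c * (s\<^sup>2 + t)"] u
      by (simp add: u_def \<rho>_def)
  qed (use \<rho> assms prob_space_normal_measure in auto)
  moreover have "AE y in PiM UNIV (\<lambda>i. normal_measure (\<mu> i) s). \<forall>\<^sub>F n in sequentially. (\<Sum>i<n. (- c) * (y i - \<mu> i)\<^sup>2 - c * (t - s\<^sup>2)) < 0"
  proof (rule chernoff_AE)
    fix i
    have "u - u\<^sup>2 \<le> ln (1 + u)" using u by (intro ln_one_plus_pos_lower_bound) auto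
    moreover have "c * s\<^sup>2 = u / 2" by (simp add: u_def)
    ultimately have "- (c * (t - s\<^sup>2)) - ln (1 + u) / 2 \<le> - (c * t / 2)"
      using u2 mult_pos_pos[OF c assms(2)] unfolding right_diff_distrib by linarith
    then show "(\<integral>\<^sup>+ z. ennreal (exp ((- c) * (z - \<mu> i)\<^sup>2 - c * (t - s\<^sup>2))) \<partial>normal_measure (\<mu> i) s) \<le> ennreal \<rho>"
      using normal_exp_square[OF assms(1), of "- c" "\<mu> i" "c * (t - s\<^sup>2)"] u
      by (simp add: u_def \<rho>_def)
  qed (use \<rho> assms prob_space_normal_measure in auto)
  ultimately show ?thesis
  proof eventually_elim
    case (elim y)
    from elim show ?case
    proof eventually_elim
      case (elim n)
      have "c * ((\<Sum>i<n. (y i - \<mu> i)\<^sup>2) - s\<^sup>2 * real n) < c * (t * real n)"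
        using elim(1) unfolding sum_subtractf sum_distrib_left[symmetric] by (simp add: algebra_simps)
      moreover have "c * (- ((\<Sum>i<n. (y i - \<mu> i)\<^sup>2) - s\<^sup>2 * real n)) < c * (t * real n)"
        using elim(2) unfolding sum_subtractf sum_distrib_left[symmetric] by (simp add: algebra_simps)
      ultimately show ?case using c unfolding mult_less_cancel_left_pos[OF c] by linarith
    qed
  qed
qed

lemma weighted_noise_LLN:
  assumes "s > 0" "t > 0" and F: "\<And>i. \<bar>w i\<bar> \<le> F"
  shows "AE y in PiM UNIV (\<lambda>i. normal_measure (\<mu> i) s). \<forall>\<^sub>F n in sequentially.
    \<bar>\<Sum>i<n. (y i - \<mu> i) * w i\<bar> \<le> t * real n"
proof -
  \<comment> \<open>Nearly the optimal tilt t / (F^2 s^2); the added 1 covers F = 0.\<close>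
  define l where "l = t / (F\<^sup>2 * s\<^sup>2 + 1)"
  have pos: "F\<^sup>2 * s\<^sup>2 + 1 > 0" by (intro add_nonneg_pos) auto
  then have l: "l > 0" using assms by (simp add: l_def)
  have l2: "l * (F\<^sup>2 * s\<^sup>2) \<le> t"
  proof -
    have "l * (F\<^sup>2 * s\<^sup>2 + 1) = t" using pos by (simp add: l_def)
    then show ?thesis using l by (simp add: distrib_left)
  qed
  define \<rho> where "\<rho> = exp (- (l * t / 2))"
  have \<rho>: "0 \<le> \<rho>" "\<rho> < 1" using l assms by (auto simp: \<rho>_def)
  have one: "AE y in PiM UNIV (\<lambda>i. normal_measure (\<mu> i) s). \<forall>\<^sub>F n in sequentially. (\<Sum>i<n. (c * w i) * (y i - \<mu> i) - l * t) < 0"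
    if c: "\<bar>c\<bar> = l" for c
  proof (rule chernoff_AE)
    fix i
    have "(c * w i)\<^sup>2 * s\<^sup>2 \<le> l\<^sup>2 * F\<^sup>2 * s\<^sup>2"
    proof -
      have "\<bar>c * w i\<bar> \<le> l * F" using c F[of i] l by (simp add: abs_mult)
      then have "(c * w i)\<^sup>2 \<le> (l * F)\<^sup>2" by (metis abs_ge_zero power2_abs power_mono)
      then show ?thesis by (simp add: power_mult_distrib mult_right_mono)
    qed
    also have "\<dots> = l * (l * (F\<^sup>2 * s\<^sup>2))" by (simp add: power2_eq_square)
    also have "\<dots> \<le> l * t" using l l2 by simp
    finally have "(c * w i)\<^sup>2 * s\<^sup>2 / 2 - l * t \<le> - (l * t / 2)" by simp
    then show "(\<integral>\<^sup>+ u. ennreal (exp ((c * w i) * (u - \<mu> i) - l * t)) \<partial>normal_measure (\<mu> i) s) \<le> ennreal \<rho>"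
      unfolding normal_exp_linear[OF assms(1)] by (simp add: \<rho>_def)
  qed (use \<rho> assms prob_space_normal_measure in auto)
  from one[of l] one[of "- l"] l have "AE y in PiM UNIV (\<lambda>i. normal_measure (\<mu> i) s). \<forall>\<^sub>F n in sequentially. (\<Sum>i<n. (l * w i) * (y i - \<mu> i) - l * t) < 0"
    "AE y in PiM UNIV (\<lambda>i. normal_measure (\<mu> i) s). \<forall>\<^sub>F n in sequentially. (\<Sum>i<n. (- l * w i) * (y i - \<mu> i) - l * t) < 0" by auto
  then show ?thesis
  proof eventually_elim
    case (elim y)
    from elim show ?case
    proof eventually_elim
      case (elim n)
      have "l * (\<Sum>i<n. (y i - \<mu> i) * w i) < l * (t * real n)"
        using elim(1) unfolding sum_subtractf sum_distrib_left by (simp add: mult_ac)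
      moreover have "l * (- (\<Sum>i<n. (y i - \<mu> i) * w i)) < l * (t * real n)"
        using elim(2) unfolding sum_subtractf by (simp add: sum_negf sum_distrib_left mult_ac)
      ultimately show ?case unfolding mult_less_cancel_left_pos[OF l] by linarith
    qed
  qed
qed

lemma regular_noise_AE:
  assumes "s0 > 0" and F: "\<And>i. \<bar>f0 (x i)\<bar> \<le> F"
  shows "AE y in data_dist f0 s0 x. regular_noise (\<lambda>i. y i - f0 (x i)) x f0 s0"
proof -
  have mono: "s * real n \<le> t * real n" if "s \<le> t" for s t n using that by (rule mult_right_mono) simp
  have ev: "\<forall>\<^sub>F n in sequentially. a n \<le> t * real n"
    if "\<forall>\<^sub>F n in sequentially. a n \<le> s * real n" "s \<le> t" for s t and a :: "nat \<Rightarrow> real"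
    using that(1) by eventually_elim (rule order_trans[OF _ mono[OF that(2)]])
  have evI: "\<forall>\<^sub>F n in sequentially. \<forall>I. is_interval I \<longrightarrow> a n I \<le> t * real n"
    if "\<forall>\<^sub>F n in sequentially. \<forall>I. is_interval I \<longrightarrow> a n I \<le> s * real n" "s \<le> t" for s t and a :: "nat \<Rightarrow> real set \<Rightarrow> real"
    using that(1) by eventually_elim (use mono[OF that(2)] order_trans in blast)
  have "AE y in data_dist f0 s0 x. \<forall>t>0. \<forall>\<^sub>F n in sequentially. \<forall>I. is_interval I \<longrightarrow> \<bar>\<Sum>i | i < n \<and> x i \<in> I. y i - f0 (x i)\<bar> \<le> t * real n"
    unfolding data_dist_def
    by (rule AE_all_positive_reals, erule evI, assumption) (intro interval_noise_sums assms)
  moreover have "AE y in data_dist f0 s0 x. \<forall>t>0. \<exists>L>0. \<forall>\<^sub>F n in sequentially. (\<Sum>i<n. if \<bar>y i - f0 (x i)\<bar> > L then (y i - f0 (x i))\<^sup>2 else 0) \<le> t * real n"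
    unfolding data_dist_def
  proof (rule AE_all_positive_reals)
    fix t :: real assume "t > 0"
    from truncated_noise_squares[OF assms(1) this, of "\<lambda>i. f0 (x i)"] obtain L where L: "L > 0"
      "AE y in PiM UNIV (\<lambda>i. normal_measure (f0 (x i)) s0). \<forall>\<^sub>F n in sequentially.
        (\<Sum>i<n. if \<bar>y i - f0 (x i)\<bar> > L then (y i - f0 (x i))\<^sup>2 else 0) \<le> t * real n" by blast
    from L(2) show "AE y in PiM UNIV (\<lambda>i. normal_measure (f0 (x i)) s0). \<exists>L>0. \<forall>\<^sub>F n in sequentially.
        (\<Sum>i<n. if \<bar>y i - f0 (x i)\<bar> > L then (y i - f0 (x i))\<^sup>2 else 0) \<le> t * real n"
      by eventually_elim (use L(1) in blast)
  next
    fix s t :: real and y assume "s \<le> t" and "\<exists>L>0. \<forall>\<^sub>F n in sequentially. (\<Sum>i<n. if \<bar>y i - f0 (x i)\<bar> > L then (y i - f0 (x i))\<^sup>2 else 0) \<le> s * real n"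
    then show "\<exists>L>0. \<forall>\<^sub>F n in sequentially. (\<Sum>i<n. if \<bar>y i - f0 (x i)\<bar> > L then (y i - f0 (x i))\<^sup>2 else 0) \<le> t * real n"
      using ev[of "\<lambda>n. \<Sum>i<n. if L < \<bar>y i - f0 (x i)\<bar> then (y i - f0 (x i))\<^sup>2 else 0" s t for L] by blast
  qed
  moreover have "AE y in data_dist f0 s0 x. \<forall>t>0. \<forall>\<^sub>F n in sequentially. \<bar>(\<Sum>i<n. (y i - f0 (x i))\<^sup>2) - s0\<^sup>2 * real n\<bar> \<le> t * real n"
    unfolding data_dist_def
    by (rule AE_all_positive_reals, erule ev, assumption) (intro noise_squares_LLN assms)
  moreover have "AE y in data_dist f0 s0 x. \<forall>t>0. \<forall>\<^sub>F n in sequentially. \<bar>\<Sum>i<n. (y i - f0 (x i)) * f0 (x i)\<bar> \<le> t * real n"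
    unfolding data_dist_def
    by (rule AE_all_positive_reals, erule ev, assumption) (intro weighted_noise_LLN[where F = F] assms)
  ultimately show ?thesis
    unfolding regular_noise_def by eventually_elim blast
qed

section \<open>Random designs\<close>

text \<open>Lower-tail Chernoff bound with tilt 1 and half the mean as threshold; the moment is at
  most exp (p (exp (-1) - 1/2)), below 1 because exp (-1) < 1/2.\<close>

lemma frequency_AE:
  fixes Q :: "'a measure"
  assumes Q: "prob_space Q" and B: "B \<in> sets Q" and p: "measure Q B > 0"
  shows "AE x in PiM (UNIV :: nat set) (\<lambda>_. Q). \<forall>\<^sub>F n in sequentially. measure Q B / 2 * real n \<le> real (card {i. i < n \<and> x i \<in> B})"
proof -
  interpret prob_space Q by fact
  define p where "p = prob B"
  have p01: "0 < p" "p \<le> 1" using p by (auto simp: p_def)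
  define \<rho> where "\<rho> = exp (p / 2) * (1 - p * (1 - exp (-1)))"
  have e1: "exp (-1) < (1/2 :: real)"
  proof -
    have "(3/2)\<^sup>2 \<le> (exp (1/2) :: real)\<^sup>2" using exp_ge_add_one_self[of "1/2::real"] by (intro power_mono) auto
    also have "(exp (1/2) :: real)\<^sup>2 = exp 1" by (simp add: power2_eq_square exp_add[symmetric])
    finally have "exp 1 > (2 :: real)" by (simp add: power2_eq_square)
    then show ?thesis by (simp add: exp_minus field_simps)
  qed
  have "\<rho> < 1"
  proof -
    have "1 - p * (1 - exp (-1)) \<le> exp (- (p * (1 - exp (-1))))"
      using exp_ge_add_one_self[of "- (p * (1 - exp (-1)))"] by simp
    then have "\<rho> \<le> exp (p / 2) * exp (- (p * (1 - exp (-1))))" unfolding \<rho>_def by (intro mult_left_mono) auto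
    also have "\<dots> = exp (p * (exp (-1) - 1/2))" by (simp add: exp_add[symmetric] algebra_simps)
    also have "\<dots> < 1" using p01 e1 by (simp add: mult_pos_neg)
    finally show ?thesis .
  qed
  have \<rho>0: "\<rho> \<ge> 0"
  proof -
    have "p * (1 - exp (-1)) \<le> 1 * 1" using p01 by (intro mult_mono) auto
    then show ?thesis by (simp add: \<rho>_def)
  qed
  have "AE x in PiM (UNIV :: nat set) (\<lambda>_. Q). \<forall>\<^sub>F n in sequentially. (\<Sum>i<n. p / 2 - indicator B (x i)) < 0"
  proof (rule chernoff_AE)
    have "(\<integral>\<^sup>+ u. ennreal (exp (p / 2 - indicator B u)) \<partial>Q) =
      (\<integral>\<^sup>+ u. ennreal (exp (p / 2 - 1)) * indicator B u + ennreal (exp (p / 2)) * indicator (space Q - B) u \<partial>Q)"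
      by (intro nn_integral_cong) (auto simp: indicator_def)
    also have "\<dots> = ennreal (exp (p / 2 - 1)) * emeasure Q B + ennreal (exp (p / 2)) * emeasure Q (space Q - B)"
      using B by (subst nn_integral_add) (auto simp: nn_integral_cmult_indicator)
    also have "\<dots> = ennreal (exp (p / 2 - 1) * p + exp (p / 2) * (1 - p))"
      using p01 B by (simp add: emeasure_eq_measure prob_compl p_def ennreal_mult[symmetric] ennreal_plus[symmetric] del: ennreal_plus)
    also have "exp (p / 2 - 1) * p + exp (p / 2) * (1 - p) = \<rho>"
    proof -
      have "exp (p / 2 - 1) = exp (p / 2) * exp (- 1)" by (simp add: exp_add[symmetric])
      then show ?thesis by (simp add: \<rho>_def algebra_simps)
    qed
    finally show "(\<integral>\<^sup>+ u. ennreal (exp (p / 2 - indicator B u)) \<partial>Q) \<le> ennreal \<rho>" by simp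
  qed (use \<open>\<rho> < 1\<close> \<rho>0 B Q in auto)
  then show ?thesis
  proof (rule AE_eventually_mono)
    fix n and x :: "nat \<Rightarrow> 'a" assume elim: "(\<Sum>i<n. p / 2 - indicator B (x i)) < 0"
    have "(\<Sum>i<n. indicator B (x i)) = real (card {i. i < n \<and> x i \<in> B})"
    proof -
      have "{..<n} \<inter> {i. x i \<in> B} = {i. i < n \<and> x i \<in> B}" by auto
      then show ?thesis by (simp add: indicator_def sum.If_cases)
    qed
    then show "measure Q B / 2 * real n \<le> real (card {i. i < n \<and> x i \<in> B})" using elim by (simp add: sum_subtractf p_def mult.commute)
  qed
qed

section \<open>Finite cut sets and uniformity over intervals\<close>

text \<open>By compactness finitely many balls cover [0, 1]; \<open>T\<close> collects their centres
  and ends. An interval that misses \<open>T\<close> and meets a ball stays in one of its open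
  halves. Excluding the centre matters for properties that fail at single points, such as small mass
  at an atom.\<close>

lemma finite_cut_points:
  fixes G :: "real set \<Rightarrow> bool"
  assumes loc: "\<And>x. x \<in> {0..1} \<Longrightarrow> \<exists>d>0. \<forall>C. C \<subseteq> {x-d<..<x} \<or> C \<subseteq> {x<..<x+d} \<longrightarrow> G C"
  obtains T where "finite T" "\<And>C. is_interval C \<Longrightarrow> C \<subseteq> {0..1} \<Longrightarrow> C \<inter> T = {} \<Longrightarrow> G C"
proof -
  from loc obtain d where d: "\<And>x. x \<in> {0..1} \<Longrightarrow> d x > 0"
    "\<And>x C. x \<in> {0..1} \<Longrightarrow> C \<subseteq> {x-d x<..<x} \<or> C \<subseteq> {x<..<x+d x} \<Longrightarrow> G C" by metis
  have "compact {0..1::real}" by simp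
  from compactE_image[OF this, of "{0..1}" "\<lambda>x. {x - d x<..<x + d x}"] d(1)
  obtain X where X: "X \<subseteq> {0..1}" "finite X" "{0..1} \<subseteq> (\<Union>x\<in>X. {x - d x<..<x + d x})"
    by force
  define T where "T = X \<union> (\<lambda>x. x - d x) ` X \<union> (\<lambda>x. x + d x) ` X"
  show ?thesis
  proof
    show "finite T" using X by (simp add: T_def)
    fix C :: "real set" assume C: "is_interval C" "C \<subseteq> {0..1}" "C \<inter> T = {}"
    show "G C"
    proof (cases "C = {}")
      case True
      then show ?thesis using d(2)[of 0 C] by auto
    next
      case False
      then obtain c where c: "c \<in> C" by auto
      then obtain x where x: "x \<in> X" "c \<in> {x - d x<..<x + d x}" using C X by blast
      have nT: "x \<notin> C" "x - d x \<notin> C" "x + d x \<notin> C" using C x by (auto simp: T_def)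
      have "C \<subseteq> {x-d x<..<x} \<or> C \<subseteq> {x<..<x+d x}"
      proof (cases "c < x")
        case True
        have "z \<in> {x-d x<..<x}" if z: "z \<in> C" for z
        proof -
          have "\<not> x \<le> z" using mem_is_interval_1_I[OF C(1) c z, of x] nT(1) True by auto
          moreover have "\<not> z \<le> x - d x" using mem_is_interval_1_I[OF C(1) z c, of "x - d x"] nT(2) x(2) by auto
          ultimately show ?thesis by simp
        qed
        then show ?thesis by blast
      next
        case False
        then have "c > x" using nT c by (cases "c = x") auto
        have "z \<in> {x<..<x+d x}" if z: "z \<in> C" for z
        proof -
          have "\<not> z \<le> x" using mem_is_interval_1_I[OF C(1) z c, of x] nT(1) \<open>c > x\<close> by auto
          moreover have "\<not> x + d x \<le> z" using mem_is_interval_1_I[OF C(1) c z, of "x + d x"] nT(3) x(2) by auto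
          ultimately show ?thesis by simp
        qed
        then show ?thesis by blast
      qed
      then show ?thesis using d(2) x X by blast
    qed
  qed
qed

text \<open>One-sided punctured neighbourhoods shrink to the empty set, so their mass tends to 0
  even at an atom of Q; atoms heavier than q end up in \<open>T\<close>.\<close>

lemma small_measure_cuts:
  fixes Q :: "real measure"
  assumes "prob_space Q" and sets: "sets Q = sets borel" and "q > 0"
  obtains T where "finite T" "\<And>C. is_interval C \<Longrightarrow> C \<subseteq> {0..1} \<Longrightarrow> C \<inter> T = {} \<Longrightarrow> measure Q C \<le> q"
proof (rule finite_cut_points[of "\<lambda>C. measure Q C \<le> q"])
  interpret prob_space Q by fact
  fix x :: real
  have ev: "\<forall>\<^sub>F n in sequentially. measure Q (A n) < q"
    if A: "range A \<subseteq> sets Q" "decseq A" "(\<Inter>n. A n) = {}" for A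
    using finite_Lim_measure_decseq[OF A(1,2)] \<open>q > 0\<close> unfolding A(3) by (intro order_tendstoD(2)[where y = 0]) auto
  have dec: "1 / real (Suc n) \<le> 1 / real (Suc m)" if "m \<le> n" for m n using that by (intro divide_left_mono) auto
  have empt: "\<exists>n. 1 / real (Suc n) < e" if "e > 0" for e :: real using nat_approx_posE[OF that] by metis
  have l: "\<forall>\<^sub>F n in sequentially. measure Q {x - 1 / real (Suc n)<..<x} < q"
  proof (rule ev)
    show "decseq (\<lambda>n. {x - 1 / real (Suc n)<..<x})"
    proof (rule decseq_SucI, rule subsetI)
      fix n z assume "z \<in> {x - 1 / real (Suc (Suc n))<..<x}"
      then show "z \<in> {x - 1 / real (Suc n)<..<x}"
        using dec[of n "Suc n"] unfolding greaterThanLessThan_iff by linarith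
    qed
    show "(\<Inter>n. {x - 1 / real (Suc n)<..<x}) = {}"
    proof (rule equals0I)
      fix z assume "z \<in> (\<Inter>n. {x - 1 / real (Suc n)<..<x})"
      then have *: "x - 1 / real (Suc n) < z \<and> z < x" for n unfolding INT_iff greaterThanLessThan_iff by blast
      then have "x - z > 0" by simp
      from empt[OF this] obtain n where "1 / real (Suc n) < x - z" by blast
      then show False using *[of n] by linarith
    qed
    show "range (\<lambda>n. {x - 1 / real (Suc n)<..<x}) \<subseteq> sets Q" unfolding sets by (rule image_subsetI) simp
  qed
  have r: "\<forall>\<^sub>F n in sequentially. measure Q {x<..<x + 1 / real (Suc n)} < q"
  proof (rule ev)
    show "decseq (\<lambda>n. {x<..<x + 1 / real (Suc n)})"
    proof (rule decseq_SucI, rule subsetI)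
      fix n z assume "z \<in> {x<..<x + 1 / real (Suc (Suc n))}"
      then show "z \<in> {x<..<x + 1 / real (Suc n)}"
        using dec[of n "Suc n"] unfolding greaterThanLessThan_iff by linarith
    qed
    show "(\<Inter>n. {x<..<x + 1 / real (Suc n)}) = {}"
    proof (rule equals0I)
      fix z assume "z \<in> (\<Inter>n. {x<..<x + 1 / real (Suc n)})"
      then have *: "x < z \<and> z < x + 1 / real (Suc n)" for n unfolding INT_iff greaterThanLessThan_iff by blast
      then have "z - x > 0" by simp
      from empt[OF this] obtain n where "1 / real (Suc n) < z - x" by blast
      then show False using *[of n] by linarith
    qed
    show "range (\<lambda>n. {x<..<x + 1 / real (Suc n)}) \<subseteq> sets Q" unfolding sets by (rule image_subsetI) simp
  qed
  from eventually_happens[OF eventually_conj[OF l r]] obtain n where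
    n: "measure Q {x - 1 / real (Suc n)<..<x} < q" "measure Q {x<..<x + 1 / real (Suc n)} < q" by auto
  show "\<exists>d>0. \<forall>C. C \<subseteq> {x-d<..<x} \<or> C \<subseteq> {x<..<x+d} \<longrightarrow> measure Q C \<le> q"
  proof (intro exI[of _ "1 / real (Suc n)"] conjI allI impI)
    fix C assume "C \<subseteq> {x - 1 / real (Suc n)<..<x} \<or> C \<subseteq> {x<..<x + 1 / real (Suc n)}"
    then show "measure Q C \<le> q"
      using n sets finite_measure_mono[of C "{x - 1 / real (Suc n)<..<x}"] finite_measure_mono[of C "{x<..<x + 1 / real (Suc n)}"]
      by fastforce
  qed simp
qed (use that in blast)

text \<open>Uniformity comes from finitely many closed intervals with ends in \<open>T\<close>.
  Shrinking I to the hull of its points of \<open>T\<close> loses two pieces of mass at most q / 4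
  each, so the hull keeps q / 2, and half of that is the guaranteed frequency.\<close>

lemma interval_frequency_AE:
  fixes Q :: "real measure"
  assumes Q: "prob_space Q" "sets Q = sets borel" and "q > 0"
  shows "AE x in PiM (UNIV :: nat set) (\<lambda>_. Q). \<forall>\<^sub>F n in sequentially. \<forall>I. is_interval I \<and> I \<subseteq> {0..1} \<and> measure Q I \<ge> q \<longrightarrow>
    q / 4 * real n \<le> real (card {i. i < n \<and> x i \<in> I})"
proof -
  interpret prob_space Q by fact
  obtain T where T: "finite T" "\<And>C. is_interval C \<Longrightarrow> C \<subseteq> {0..1} \<Longrightarrow> C \<inter> T = {} \<Longrightarrow> prob C \<le> q / 4"
    using small_measure_cuts[OF Q, of "q / 4"] \<open>q > 0\<close> by auto
  define \<B> where "\<B> = {B. \<exists>l\<in>T. \<exists>u\<in>T. B = {l..u} \<and> prob B \<ge> q / 2}"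
  have "\<B> \<subseteq> (\<lambda>(l, u). {l..u}) ` (T \<times> T)" by (auto simp: \<B>_def)
  then have "finite \<B>" using T(1) by (meson finite_SigmaI finite_imageI finite_subset)
  have "AE x in PiM (UNIV :: nat set) (\<lambda>_. Q). \<forall>B\<in>\<B>. \<forall>\<^sub>F n in sequentially. prob B / 2 * real n \<le> real (card {i. i < n \<and> x i \<in> B})"
  proof (rule AE_finite_allI[OF \<open>finite \<B>\<close> frequency_AE])
    fix B assume "B \<in> \<B>"
    then obtain l u where B: "B = {l..u}" "prob B \<ge> q / 2" unfolding \<B>_def by blast
    show "prob_space Q" by fact
    show "B \<in> sets Q" unfolding B(1) Q(2) by simp
    show "prob B > 0" using B(2) \<open>q > 0\<close> by linarith
  qed
  then show ?thesis
  proof eventually_elim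
    case (elim x)
    then have "\<forall>\<^sub>F n in sequentially. \<forall>B\<in>\<B>. prob B / 2 * real n \<le> real (card {i. i < n \<and> x i \<in> B})"
      using \<open>finite \<B>\<close> by (simp add: eventually_ball_finite)
    then show ?case
    proof eventually_elim
      case (elim n)
      show ?case
      proof safe
        fix I assume I: "is_interval I" "I \<subseteq> {0..1}" "q \<le> prob I"
        have fI: "finite (T \<inter> I)" using T by simp
        have ne: "T \<inter> I \<noteq> {}" using T(2)[OF I(1,2)] I(3) \<open>q > 0\<close> by auto
        define l where "l = Min (T \<inter> I)"
        define u where "u = Max (T \<inter> I)"
        have lu: "l \<in> T \<inter> I" "u \<in> T \<inter> I" unfolding l_def u_def by (rule Min_in Max_in; fact)+
        have lub: "l \<le> t" "t \<le> u" if "t \<in> T \<inter> I" for t unfolding l_def u_def using that fI by auto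
        have sub: "{l..u} \<subseteq> I" using lu by (auto intro: mem_is_interval_1_I[OF I(1), of l u])
        have "I \<inter> {..<l} \<inter> T = {}" "I \<inter> {u<..} \<inter> T = {}" using lub by (meson IntD1 IntD2 IntI equals0I greaterThan_iff lessThan_iff not_le)+
        then have "prob (I \<inter> {..<l}) \<le> q / 4" "prob (I \<inter> {u<..}) \<le> q / 4"
          using T(2) is_interval_cuts[OF I(1)] I(2) by (meson inf.coboundedI1)+
        moreover have "prob I \<le> prob (I \<inter> {..<l}) + prob {l..u} + prob (I \<inter> {u<..})"
        proof -
          have Im: "I \<in> sets borel" using I(1) by (simp add: real_interval_borel_measurable)
          have eq: "I = (I \<inter> {..<l}) \<union> {l..u} \<union> (I \<inter> {u<..})" using sub by auto
          have "prob I \<le> prob ((I \<inter> {..<l}) \<union> {l..u}) + prob (I \<inter> {u<..})"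
            by (subst eq, rule measure_Un_le) (auto simp: Q(2) Im intro!: sets.Un sets.Int)
          also have "prob ((I \<inter> {..<l}) \<union> {l..u}) \<le> prob (I \<inter> {..<l}) + prob {l..u}"
            by (rule measure_Un_le) (auto simp: Q(2) Im intro!: sets.Un sets.Int)
          finally show ?thesis by simp
        qed
        ultimately have p: "prob {l..u} \<ge> q / 2" using I by linarith
        then have "{l..u} \<in> \<B>" using lu by (auto simp: \<B>_def)
        then have "prob {l..u} / 2 * real n \<le> real (card {i. i < n \<and> x i \<in> {l..u}})" using elim by blast
        moreover have "card {i. i < n \<and> x i \<in> {l..u}} \<le> card {i. i < n \<and> x i \<in> I}"
          using sub by (intro card_mono) auto
        moreover have "q / 4 * real n \<le> prob {l..u} / 2 * real n" using p by (intro mult_right_mono) auto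
        ultimately show "q / 4 * real n \<le> real (card {i. i < n \<and> x i \<in> I})" by linarith
      qed
    qed
  qed
qed

text \<open>Uniform continuity in the form of a finite cut set, so that it can be merged with the
  breakpoints of f.\<close>

lemma oscillation_cuts:
  fixes g :: "real \<Rightarrow> real"
  assumes "continuous_on {0..1} g" "e > 0"
  shows "\<exists>T. finite T \<and> (\<forall>C x y. is_interval C \<and> C \<subseteq> {0..1} \<and> C \<inter> T = {} \<and> x \<in> C \<and> y \<in> C \<longrightarrow> \<bar>g x - g y\<bar> < e)"
proof (rule finite_cut_points[of "\<lambda>C. C \<subseteq> {0..1} \<longrightarrow> (\<forall>x\<in>C. \<forall>y\<in>C. \<bar>g x - g y\<bar> < e)"])
  fix x :: real assume "x \<in> {0..1}"
  then obtain d where d: "d > 0" "\<And>z. z \<in> {0..1} \<Longrightarrow> \<bar>z - x\<bar> < d \<Longrightarrow> \<bar>g z - g x\<bar> < e / 2"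
    using assms unfolding continuous_on_iff by (metis dist_real_def half_gt_zero)
  have osc: "\<bar>g y - g z\<bar> < e" if "y \<in> {0..1}" "z \<in> {0..1}" "\<bar>y - x\<bar> < d" "\<bar>z - x\<bar> < d" for y z
    using d(2)[of y] d(2)[of z] that by linarith
  show "\<exists>d>0. \<forall>C. C \<subseteq> {x-d<..<x} \<or> C \<subseteq> {x<..<x+d} \<longrightarrow> (C \<subseteq> {0..1} \<longrightarrow> (\<forall>x\<in>C. \<forall>y\<in>C. \<bar>g x - g y\<bar> < e))"
  proof (intro exI[of _ d] conjI allI impI ballI)
    fix C y z assume C: "C \<subseteq> {x-d<..<x} \<or> C \<subseteq> {x<..<x+d}" "C \<subseteq> {0..1}" "y \<in> C" "z \<in> C"
    then have "y \<in> {x-d<..<x} \<or> y \<in> {x<..<x+d}" "z \<in> {x-d<..<x} \<or> z \<in> {x<..<x+d}" by blast+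
    then have "\<bar>y - x\<bar> < d" "\<bar>z - x\<bar> < d" by auto
    then show "\<bar>g y - g z\<bar> < e" using osc C by blast
  qed (rule \<open>d > 0\<close>)
next
  fix T assume T: "finite T" "\<And>C. is_interval C \<Longrightarrow> C \<subseteq> {0..1} \<Longrightarrow> C \<inter> T = {} \<Longrightarrow> C \<subseteq> {0..1} \<longrightarrow> (\<forall>x\<in>C. \<forall>y\<in>C. \<bar>g x - g y\<bar> < e)"
  show ?thesis
  proof (intro exI[of _ T] conjI allI impI)
    fix C x y assume C: "is_interval C \<and> C \<subseteq> {0..1} \<and> C \<inter> T = {} \<and> x \<in> C \<and> y \<in> C"
    then have "\<forall>x\<in>C. \<forall>y\<in>C. \<bar>g x - g y\<bar> < e" using T(2)[of C] by simp
    then show "\<bar>g x - g y\<bar> < e" using C by blast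
  qed (rule T(1))
qed

text \<open>Away from the breakpoints of f and the cuts of f0, f is monotone while f0 is within e /
  4 of a constant; the places where f exceeds that constant by 3 e / 4, or falls short by as much,
  are then intervals. If each had mass below q, the cut bound would leave too little mass for the
  deviation set.\<close>

lemma large_deviation_interval:
  fixes Q :: "real measure"
  assumes Q: "prob_space Q" "sets Q = sets borel" "emeasure Q {0..1} = 1"
    and f0: "continuous_on {0..1} f0" and "e > 0"
  obtains q where "q > 0" "\<And>f. piecewise_mono m f \<Longrightarrow> measure Q {x. \<bar>f x - f0 x\<bar> > e} \<ge> e \<Longrightarrow>
    \<exists>I. is_interval I \<and> I \<subseteq> {0..1} \<and> measure Q I \<ge> q \<and> (\<forall>x\<in>I. \<bar>f x - f0 x\<bar> > e / 2)"
proof -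
  interpret prob_space Q by fact
  have "e / 4 > 0" using \<open>e > 0\<close> by simp
  from oscillation_cuts[OF f0 this] obtain T where T: "finite T"
    and osc': "\<forall>C x y. is_interval C \<and> C \<subseteq> {0..1} \<and> C \<inter> T = {} \<and> x \<in> C \<and> y \<in> C \<longrightarrow> \<bar>f0 x - f0 y\<bar> < e / 4"
    by blast
  have osc: "\<bar>f0 x - f0 y\<bar> < e / 4" if "is_interval C" "C \<subseteq> {0..1}" "C \<inter> T = {}" "x \<in> C" "y \<in> C" for C x y
    using osc' that by blast
  \<comment> \<open>Chosen so that \<open>3 ^ (m + card T) * (2 * q)\<close> is e / 2; the 2 counts
    the intervals above and below f0.\<close>
  define q where "q = e / (4 * 3 ^ (m + card T))"
  have q: "q > 0" using \<open>e > 0\<close> by (simp add: q_def)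
  show ?thesis
  proof
    show "q > 0" by fact
    fix f assume pm: "piecewise_mono m f" and big: "prob {x. \<bar>f x - f0 x\<bar> > e} \<ge> e"
    define X where "X = {x. \<bar>f x - f0 x\<bar> > e}"
    \<comment> \<open>\<open>measure\<close> is 0 on a non-measurable set, so a positive mass yields
      measurability.\<close>
    have X: "X \<in> sets Q" using big \<open>e > 0\<close> measure_notin_sets[of X Q] by (force simp: X_def)
    show "\<exists>I. is_interval I \<and> I \<subseteq> {0..1} \<and> q \<le> prob I \<and> (\<forall>x\<in>I. \<bar>f x - f0 x\<bar> > e / 2)"
    proof (rule ccontr)
      assume "\<not> ?thesis"
      then have small: "prob I < q" if "is_interval I" "I \<subseteq> {0..1}" "\<And>x. x \<in> I \<Longrightarrow> \<bar>f x - f0 x\<bar> > e / 2" for I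
        using that by (meson not_le)
      obtain A where A: "finite A" "card A \<le> m"
        and mono: "\<And>C. is_interval C \<Longrightarrow> C \<inter> A = {} \<Longrightarrow> mono_on C f \<or> antimono_on C f"
        using pm by (auto simp: piecewise_mono_def)
      define F where "F C = prob (C \<inter> X \<inter> {0..1})" for C
      have meas: "is_interval C \<Longrightarrow> C \<in> sets Q" for C :: "real set"
        using Q by (simp add: real_interval_borel_measurable)
      have "F UNIV \<le> 3 ^ card (A \<union> T) * (2 * q)"
      proof (rule interval_cut_bound)
        fix C :: "real set" and a assume C: "is_interval C"
        have eq: "C \<inter> X \<inter> {0..1} = (C \<inter> {..<a} \<inter> X \<inter> {0..1}) \<union> (C \<inter> {a} \<inter> X \<inter> {0..1}) \<union> (C \<inter> {a<..} \<inter> X \<inter> {0..1})"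
          by auto
        have "F C \<le> prob ((C \<inter> {..<a} \<inter> X \<inter> {0..1}) \<union> (C \<inter> {a} \<inter> X \<inter> {0..1})) + F (C \<inter> {a<..})"
          unfolding F_def by (subst eq, rule measure_Un_le) (intro sets.Un sets.Int X meas[OF C] meas; auto simp: is_interval_1)+
        also have "prob ((C \<inter> {..<a} \<inter> X \<inter> {0..1}) \<union> (C \<inter> {a} \<inter> X \<inter> {0..1})) \<le> F (C \<inter> {..<a}) + F (C \<inter> {a})"
          unfolding F_def by (rule measure_Un_le) (intro sets.Un sets.Int X meas[OF C] meas; auto simp: is_interval_1)+
        finally show "F C \<le> F (C \<inter> {..<a}) + F (C \<inter> {a}) + F (C \<inter> {a<..})" by simp
      next
        fix C and a :: real assume C: "C \<subseteq> {a}"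
        have "F C < q" unfolding F_def
        proof (rule small)
          show "is_interval (C \<inter> X \<inter> {0..1})" using C by (auto simp: is_interval_1 subset_singleton_iff)
        qed (use \<open>e > 0\<close> in \<open>auto simp: X_def\<close>)
        then show "F C \<le> 2 * q" using q by simp
      next
        fix C :: "real set" assume C: "is_interval C" "C \<inter> (A \<union> T) = {}"
        define C1 where "C1 = C \<inter> {0..1}"
        have C1: "is_interval C1" "C1 \<subseteq> {0..1}" "C1 \<inter> A = {}" "C1 \<inter> T = {}"
          unfolding C1_def using C by (auto simp: is_interval_1)
        show "F C \<le> 2 * q"
        proof (cases "C1 = {}")
          case True
          then have "C \<inter> X \<inter> {0..1} = {}" by (auto simp: C1_def)
          then show ?thesis using q by (simp add: F_def)
        next
          case False
          then obtain t where t: "t \<in> C1" by auto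
          \<comment> \<open>The level 3 e / 4 works in both directions: a deviation above e at z
            stays above it when f0 z is replaced by f0 t, and going back leaves e / 2.\<close>
          define I1 where "I1 = {z\<in>C1. f z > f0 t + 3 / 4 * e}"
          define I2 where "I2 = {z\<in>C1. f z < f0 t - 3 / 4 * e}"
          have m: "mono_on C1 f \<or> antimono_on C1 f" using mono C1 by blast
          have bt: "min (f a) (f b) \<le> f z \<and> f z \<le> max (f a) (f b)" if "a \<in> C1" "b \<in> C1" "z \<in> C1" "a \<le> z" "z \<le> b" for a b z
            using m
          proof
            assume "mono_on C1 f"
            then have "f a \<le> f z" "f z \<le> f b" using that by (auto dest: monotone_onD)
            then show ?thesis by auto
          next
            assume "antimono_on C1 f"
            then have "f a \<ge> f z" "f z \<ge> f b" using that by (auto dest: monotone_onD)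
            then show ?thesis by auto
          qed
          have "is_interval I1" unfolding is_interval_1
          proof (intro ballI allI impI)
            fix a b z assume h: "a \<in> I1" "b \<in> I1" "a \<le> z \<and> z \<le> b"
            then have "z \<in> C1" using mem_is_interval_1_I[OF C1(1), of a b z] by (auto simp: I1_def)
            then show "z \<in> I1" using h bt[of a b z] by (auto simp: I1_def min_def split: if_splits)
          qed
          moreover have "is_interval I2" unfolding is_interval_1
          proof (intro ballI allI impI)
            fix a b z assume h: "a \<in> I2" "b \<in> I2" "a \<le> z \<and> z \<le> b"
            then have "z \<in> C1" using mem_is_interval_1_I[OF C1(1), of a b z] by (auto simp: I2_def)
            then show "z \<in> I2" using h bt[of a b z] by (auto simp: I2_def max_def split: if_splits)
          qed
          moreover have "\<bar>f z - f0 z\<bar> > e / 2" if "z \<in> I1 \<union> I2" for z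
            using that osc[OF C1(1,2,4) t, of z] by (auto simp: I1_def I2_def abs_if split: if_splits)
          moreover have "I1 \<subseteq> {0..1}" "I2 \<subseteq> {0..1}" using C1(2) by (auto simp: I1_def I2_def)
          ultimately have "prob I1 < q" "prob I2 < q" "I1 \<in> sets Q" "I2 \<in> sets Q" using small meas by auto
          have "C \<inter> X \<inter> {0..1} \<subseteq> I1 \<union> I2"
          proof
            fix z assume z: "z \<in> C \<inter> X \<inter> {0..1}"
            then have "z \<in> C1" by (simp add: C1_def)
            then show "z \<in> I1 \<union> I2" using z osc[OF C1(1,2,4) t, of z] by (auto simp: I1_def I2_def X_def abs_if split: if_splits)
          qed
          then have "F C \<le> prob (I1 \<union> I2)" unfolding F_def using \<open>I1 \<in> sets Q\<close> \<open>I2 \<in> sets Q\<close> by (intro finite_measure_mono) auto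
          also have "\<dots> \<le> prob I1 + prob I2" by (rule measure_Un_le) fact+
          finally show ?thesis using \<open>prob I1 < q\<close> \<open>prob I2 < q\<close> by simp
        qed
      qed (use A T q in auto)
      also have "\<dots> \<le> 3 ^ (m + card T) * (2 * q)"
        using q A card_Un_le[of A T] by (intro mult_right_mono power_increasing) auto
      also have "\<dots> = e / 2" by (simp add: q_def)
      finally have "F UNIV \<le> e / 2" .
      moreover have "F UNIV = prob X"
      proof -
        have "AE z in Q. z \<in> {0..1}" using Q by (intro AE_in_set_eq_1[THEN iffD2]) (auto simp: measure_def)
        then show ?thesis unfolding F_def using X Q by (intro measure_eq_AE) auto
      qed
      ultimately show False using big \<open>e > 0\<close> by (simp add: X_def)
    qed
  qed
qed

text \<open>If deviations above e / 2 had mass below e / 2, then e / 2 would belong to the set whose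
  infimum is \<open>d_Q\<close>. So f deviates by e / 4 on an interval of mass r, which receives a
  fraction r / 4 of the design.\<close>

lemma design_separation_AE:
  fixes Q :: "real measure"
  assumes Q: "prob_space Q" "sets Q = sets borel" "emeasure Q {0..1} = 1"
    and f0: "continuous_on {0..1} f0" and "e > 0"
  obtains q where "q > 0" "AE x in PiM (UNIV :: nat set) (\<lambda>_. Q). \<forall>\<^sub>F n in sequentially. \<forall>f.
    piecewise_mono m f \<and> d_Q Q f f0 \<ge> e \<longrightarrow> q * real n \<le> (\<Sum>i<n. (f (x i) - f0 (x i))\<^sup>2)"
proof -
  obtain r where r: "r > 0" "\<And>f. piecewise_mono m f \<Longrightarrow> measure Q {x. \<bar>f x - f0 x\<bar> > e / 2} \<ge> e / 2 \<Longrightarrow>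
    \<exists>I. is_interval I \<and> I \<subseteq> {0..1} \<and> measure Q I \<ge> r \<and> (\<forall>x\<in>I. \<bar>f x - f0 x\<bar> > e / 2 / 2)"
    using large_deviation_interval[OF Q f0, of "e / 2" m] \<open>e > 0\<close> by auto
  have "AE x in PiM (UNIV :: nat set) (\<lambda>_. Q). \<forall>\<^sub>F n in sequentially. \<forall>f.
    piecewise_mono m f \<and> d_Q Q f f0 \<ge> e \<longrightarrow> (r / 4 * (e / 4)\<^sup>2) * real n \<le> (\<Sum>i<n. (f (x i) - f0 (x i))\<^sup>2)"
  proof (rule AE_eventually_mono[OF interval_frequency_AE[OF Q(1,2) r(1)]])
    fix n and x :: "nat \<Rightarrow> real"
    assume elim: "\<forall>I. is_interval I \<and> I \<subseteq> {0..1} \<and> measure Q I \<ge> r \<longrightarrow> r / 4 * real n \<le> real (card {i. i < n \<and> x i \<in> I})"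
    show "\<forall>f. piecewise_mono m f \<and> d_Q Q f f0 \<ge> e \<longrightarrow> (r / 4 * (e / 4)\<^sup>2) * real n \<le> (\<Sum>i<n. (f (x i) - f0 (x i))\<^sup>2)"
    proof (intro allI impI, elim conjE)
      fix f assume pm: "piecewise_mono m f" and d: "d_Q Q f f0 \<ge> e"
      have "\<not> measure Q {x. \<bar>f x - f0 x\<bar> > e / 2} < e / 2"
      proof
        assume "measure Q {x. \<bar>f x - f0 x\<bar> > e / 2} < e / 2"
        then have "d_Q Q f f0 \<le> e / 2"
          unfolding d_Q_def using \<open>e > 0\<close> by (intro cInf_lower bdd_belowI[of _ 0]) auto
        then show False using d \<open>e > 0\<close> by simp
      qed
      then obtain I where I: "is_interval I" "I \<subseteq> {0..1}" "measure Q I \<ge> r" "\<And>x. x \<in> I \<Longrightarrow> \<bar>f x - f0 x\<bar> > e / 4"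
        using r(2)[OF pm] by (auto simp: not_less)
      have "(r / 4 * (e / 4)\<^sup>2) * real n = (r / 4 * real n) * (e / 4)\<^sup>2" by simp
      also have "\<dots> \<le> real (card {i. i < n \<and> x i \<in> I}) * (e / 4)\<^sup>2"
        using elim I by (intro mult_right_mono) auto
      also have "\<dots> = (\<Sum>i | i < n \<and> x i \<in> I. (e / 4)\<^sup>2)" by simp
      also have "\<dots> \<le> (\<Sum>i | i < n \<and> x i \<in> I. (f (x i) - f0 (x i))\<^sup>2)"
      proof (rule sum_mono)
        fix i assume "i \<in> {i. i < n \<and> x i \<in> I}"
        then have "\<bar>e / 4\<bar> \<le> \<bar>f (x i) - f0 (x i)\<bar>" using I(4)[of "x i"] \<open>e > 0\<close> by simp
        then show "(e / 4)\<^sup>2 \<le> (f (x i) - f0 (x i))\<^sup>2" by (simp only: abs_le_square_iff)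
      qed
      also have "\<dots> \<le> (\<Sum>i<n. (f (x i) - f0 (x i))\<^sup>2)" by (intro sum_mono2) auto
      finally show "(r / 4 * (e / 4)\<^sup>2) * real n \<le> (\<Sum>i<n. (f (x i) - f0 (x i))\<^sup>2)" .
    qed
  qed
  then show ?thesis using that[of "r / 4 * (e / 4)\<^sup>2"] r(1) \<open>e > 0\<close> by auto
qed

section \<open>Splines with prescribed extrema\<close>

lemma sorted_nth_le: "sorted t \<Longrightarrow> a \<le> b \<Longrightarrow> b < length t \<Longrightarrow> t ! a \<le> (t ! b :: real)"
  by (simp add: sorted_nth_mono)

text \<open>The three claims support each other in the induction: vanishing off the support keeps
  the Cox-de Boor weights in [0, 1] wherever they matter, including the 0 / 0 case at repeated
  knots. The bound \<open>2 ^ j\<close> crudely adds two such terms at each order.\<close>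

lemma bspl_bounds:
  assumes "sorted t" "i + j < length t"
  shows "0 \<le> bspl t i j x \<and> bspl t i j x \<le> 2 ^ j \<and> (x < t ! i \<or> t ! (i + j) \<le> x \<longrightarrow> bspl t i j x = 0)"
  using assms
proof (induction t i j x rule: bspl.induct)
  case (1 t i x)
  then show ?case by simp
next
  case (2 t i x)
  then show ?case by auto
next
  case (3 t i r x)
  have IH1: "0 \<le> bspl t i (Suc r) x \<and> bspl t i (Suc r) x \<le> 2 ^ Suc r \<and>
      (x < t ! i \<or> t ! (i + Suc r) \<le> x \<longrightarrow> bspl t i (Suc r) x = 0)"
    using 3 by simp
  have IH2: "0 \<le> bspl t (Suc i) (Suc r) x \<and> bspl t (Suc i) (Suc r) x \<le> 2 ^ Suc r \<and>
      (x < t ! Suc i \<or> t ! (Suc i + Suc r) \<le> x \<longrightarrow> bspl t (Suc i) (Suc r) x = 0)"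
    using 3 by simp
  have le: "t ! i \<le> t ! Suc i" "t ! (i + r + 1) \<le> t ! (i + r + 2)"
    using 3(3,4) by (auto intro!: sorted_nth_le)
  have unit: "0 \<le> c * b \<and> c * b \<le> 2 ^ Suc r"
    if "0 \<le> b" "b \<le> 2 ^ Suc r" "b \<noteq> 0 \<Longrightarrow> 0 \<le> c \<and> c \<le> 1" for b c :: real
  proof (cases "b = 0")
    case False
    then have "0 \<le> c" "c \<le> 1" using that by auto
    moreover have "c * b \<le> 1 * b" by (rule mult_right_mono) (use that \<open>c \<le> 1\<close> in auto)
    ultimately show ?thesis using that by simp
  qed simp
  define A where "A = (x - t ! i) / (t ! (i + r + 1) - t ! i) * bspl t i (Suc r) x"
  define B where "B = (t ! (i + r + 2) - x) / (t ! (i + r + 2) - t ! Suc i) * bspl t (Suc i) (Suc r) x"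
  have A: "0 \<le> A \<and> A \<le> 2 ^ Suc r" unfolding A_def
  proof (rule unit)
    assume "bspl t i (Suc r) x \<noteq> 0"
    then have "\<not> x < t ! i" "\<not> t ! (i + r + 1) \<le> x" using IH1 by auto
    then show "0 \<le> (x - t ! i) / (t ! (i + r + 1) - t ! i) \<and> (x - t ! i) / (t ! (i + r + 1) - t ! i) \<le> 1"
      by (simp add: divide_le_eq_1)
  qed (use IH1 in auto)
  have B: "0 \<le> B \<and> B \<le> 2 ^ Suc r" unfolding B_def
  proof (rule unit)
    assume "bspl t (Suc i) (Suc r) x \<noteq> 0"
    then have "\<not> x < t ! Suc i" "\<not> t ! (i + r + 2) \<le> x" using IH2 by auto
    then show "0 \<le> (t ! (i + r + 2) - x) / (t ! (i + r + 2) - t ! Suc i) \<and> (t ! (i + r + 2) - x) / (t ! (i + r + 2) - t ! Suc i) \<le> 1"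
      by (simp add: divide_le_eq_1)
  qed (use IH2 in auto)
  have eq: "bspl t i (Suc (Suc r)) x = A + B" by (simp add: A_def B_def)
  have "A + B = 0" if "x < t ! i \<or> t ! (i + Suc (Suc r)) \<le> x"
  proof -
    have "x < t ! i \<or> t ! (i + Suc r) \<le> x" "x < t ! Suc i \<or> t ! (Suc i + Suc r) \<le> x" using that le by auto
    then show ?thesis using IH1 IH2 by (simp add: A_def B_def)
  qed
  then show ?case unfolding eq using A B by auto
qed

text \<open>Left of knot i + r + 1 the first summand of the recursion is positive, from that knot on
  the second.\<close>

lemma bspl_pos:
  assumes "sorted t" "i + j < length t" "j \<ge> 1"
    and "\<And>k. i \<le> k \<Longrightarrow> k < i + j \<Longrightarrow> t ! k < t ! Suc k"
    and "t ! i < x" "x < t ! (i + j)"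
  shows "bspl t i j x > 0"
  using assms
proof (induction t i j x rule: bspl.induct)
  case (1 t i x)
  then show ?case by simp
next
  case (2 t i x)
  then show ?case by simp
next
  case (3 t i r x)
  define A where "A = (x - t ! i) / (t ! (i + r + 1) - t ! i) * bspl t i (Suc r) x"
  define B where "B = (t ! (i + r + 2) - x) / (t ! (i + r + 2) - t ! Suc i) * bspl t (Suc i) (Suc r) x"
  have eq: "bspl t i (Suc (Suc r)) x = A + B" by (simp add: A_def B_def)
  have str: "t ! i < t ! Suc i" "t ! (i + r + 1) < t ! (i + r + 2)"
    using 3(6)[of i] 3(6)[of "i + r + 1"] by auto
  have le: "t ! Suc i \<le> t ! (i + r + 1)" using 3(3,4) by (intro sorted_nth_le) auto
  have nn: "0 \<le> bspl t i (Suc r) x" "0 \<le> bspl t (Suc i) (Suc r) x"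
    using bspl_bounds[OF 3(3), of i "Suc r" x] bspl_bounds[OF 3(3), of "Suc i" "Suc r" x] 3(4) by auto
  have x: "t ! i < x" "x < t ! (i + r + 2)" using 3(7,8) by auto
  have A0: "A \<ge> 0" unfolding A_def using nn x str le by (intro mult_nonneg_nonneg divide_nonneg_nonneg) auto
  have B0: "B \<ge> 0" unfolding B_def using nn x str le by (intro mult_nonneg_nonneg divide_nonneg_nonneg) auto
  show ?case
  proof (cases "x < t ! (i + r + 1)")
    case True
    have "bspl t i (Suc r) x > 0"
      by (rule 3(1)) (use 3 True in auto)
    then have "A > 0" unfolding A_def using x str le by (intro mult_pos_pos divide_pos_pos) auto
    then show ?thesis unfolding eq using B0 by simp
  next
    case False
    \<comment> \<open>For r = 0 the point x may be the left end of the next cell, where the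
      induction hypothesis is silent; the half-open cell of order one contains it.\<close>
    have "bspl t (Suc i) (Suc r) x > 0"
    proof (cases r)
      case 0
      then show ?thesis using False x by simp
    next
      case (Suc r')
      have "t ! Suc i < t ! Suc (Suc i)" using 3(6)[of "Suc i"] Suc by simp
      also have "\<dots> \<le> t ! (i + r + 1)" using 3(3,4) Suc by (intro sorted_nth_le) auto
      finally have "t ! Suc i < x" using False by simp
      then show ?thesis by (intro 3(2)) (use 3 in auto)
    qed
    then have "B > 0" unfolding B_def using x str le by (intro mult_pos_pos divide_pos_pos) auto
    then show ?thesis unfolding eq using A0 by simp
  qed
qed

lemma bspl_measurable [measurable]: "bspl t i j \<in> borel_measurable borel"
proof (induction j arbitrary: i rule: less_induct)
  case (less j i)
  show ?case
  proof (cases j)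
    case 0
    have "bspl t i 0 = (\<lambda>x. 0)" by (auto simp: fun_eq_iff)
    then show ?thesis using 0 by simp
  next
    case j: (Suc j')
    show ?thesis
    proof (cases j')
      case 0
      have "bspl t i (Suc 0) = (\<lambda>x. if t ! i \<le> x \<and> x < t ! Suc i then 1 else 0)" by (auto simp: fun_eq_iff)
      then show ?thesis using 0 j by simp
    next
      case (Suc r)
      have [measurable]: "bspl t i' (Suc r) \<in> borel_measurable borel" for i' using less j Suc by blast
      have "bspl t i (Suc (Suc r)) = (\<lambda>x. (x - t ! i) / (t ! (i + r + 1) - t ! i) * bspl t i (Suc r) x
         + (t ! (i + r + 2) - x) / (t ! (i + r + 2) - t ! Suc i) * bspl t (Suc i) (Suc r) x)" by (auto simp: fun_eq_iff)
      then show ?thesis unfolding j Suc by simp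
    qed
  qed
qed

lemma node_exists_range: "node_exists c N a \<Longrightarrow> odd a \<and> a < 2 ^ (N + 1)"
proof (induction c N a rule: node_exists.induct)
  case (2 c N a')
  then obtain a where a: "odd a" "a' + 1 = 2 * a \<or> a' = 2 * a + 1" "node_exists c N a" "odd a'" by auto
  then have "a < 2 ^ (N + 1)" using 2(1) by auto
  then have "2 * a + 2 \<le> 2 ^ (Suc N + 1)" by simp
  then show ?case using a by auto
qed auto

lemma knot_set_unit_interval: "knot_set c \<subseteq> {0..1}"
proof -
  have "real a / 2 ^ (N + 1) \<le> 1" if "node_exists c N a" for N a
  proof -
    have "a < 2 ^ (N + 1)" using node_exists_range[OF that] by simp
    then have "real a < 2 ^ (N + 1)" by (metis of_nat_less_iff of_nat_numeral of_nat_power)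
    then show ?thesis by (simp add: divide_le_eq_1)
  qed
  then show ?thesis by (auto simp: knot_set_def)
qed

lemma ext_knots_props:
  assumes "finite S" "S \<subseteq> {0..1}"
  shows "sorted (ext_knots j S)" "set (ext_knots j S) \<subseteq> {0..1}" "length (ext_knots j S) = 2 * (j - 1) + card S"
  using assms by (auto simp: ext_knots_def sorted_append)

lemma root_prod_sign:
  fixes \<alpha> :: "nat \<Rightarrow> real"
  assumes C: "is_interval C" "C \<inter> \<alpha> ` {..<H} = {}"
  shows "(\<forall>z\<in>C. (\<Prod>h<H. z - \<alpha> h) \<ge> 0) \<or> (\<forall>z\<in>C. (\<Prod>h<H. z - \<alpha> h) \<le> 0)"
  using C(2)
proof (induction H)
  case (Suc H)
  then have IH: "(\<forall>z\<in>C. (\<Prod>h<H. z - \<alpha> h) \<ge> 0) \<or> (\<forall>z\<in>C. (\<Prod>h<H. z - \<alpha> h) \<le> 0)"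
    and a: "\<alpha> H \<notin> C" by (auto simp: lessThan_Suc)
  have "(\<forall>z\<in>C. z - \<alpha> H \<ge> 0) \<or> (\<forall>z\<in>C. z - \<alpha> H \<le> 0)"
  proof (rule ccontr)
    assume "\<not> ?thesis"
    then obtain u v where "u \<in> C" "u < \<alpha> H" "v \<in> C" "v > \<alpha> H" by (auto simp: not_le)
    then show False using mem_is_interval_1_I[OF C(1), of u v "\<alpha> H"] a by simp
  qed
  with IH show ?case
    by (elim disjE) (simp_all add: lessThan_Suc mult_nonneg_nonneg mult_nonpos_nonpos mult_nonneg_nonpos mult_nonpos_nonneg)
qed simp

lemma root_prod_bounded:
  fixes \<alpha> :: "nat \<Rightarrow> real"
  shows "\<exists>K\<ge>0. \<forall>z\<in>{0..1}. \<bar>\<Prod>h<H. z - \<alpha> h\<bar> \<le> (K::real)"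
proof -
  have "continuous_on {0..1} (\<lambda>z. \<Prod>h<H. z - \<alpha> h)" by (intro continuous_intros)
  then have "compact ((\<lambda>z. \<Prod>h<H. z - \<alpha> h) ` {0..1})" by (intro compact_continuous_image) auto
  then obtain K where "\<forall>y\<in>(\<lambda>z. \<Prod>h<H. z - \<alpha> h) ` {0..1}. \<bar>y\<bar> \<le> K"
    using compact_imp_bounded bounded_real by blast
  then show ?thesis by (intro exI[of _ "max K 0"]) (auto intro: max.coboundedI1)
qed

locale knots =
  fixes t :: "real list" and j :: nat
  assumes sorted: "sorted t" and unit: "set t \<subseteq> {0..1}"
begin

lemma bspl_bound_indicator:
  assumes "i + j < length t"
  shows "0 \<le> bspl t i j z" "bspl t i j z \<le> 2 ^ j * indicator {0..1} z"
proof -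
  have "t ! i \<in> set t" "t ! (i + j) \<in> set t" using assms by auto
  then have "0 \<le> t ! i" "t ! (i + j) \<le> 1" using unit by auto
  then show "0 \<le> bspl t i j z" "bspl t i j z \<le> 2 ^ j * indicator {0..1} z"
    using bspl_bounds[OF sorted assms, of z] by (auto simp: indicator_def not_le)
qed

lemma integrable_root_prod_bspl:
  fixes \<alpha> :: "nat \<Rightarrow> real"
  assumes i: "i + j < length t"
  shows "integrable lborel (\<lambda>z. (\<Prod>h<H. z - \<alpha> h) * bspl t i j z)"
proof -
  obtain K where K: "K \<ge> 0" "\<And>z. z \<in> {0..1} \<Longrightarrow> \<bar>\<Prod>h<H. z - \<alpha> h\<bar> \<le> K"
    using root_prod_bounded[of \<alpha> H] by blast
  show ?thesis
  proof (rule Bochner_Integration.integrable_bound)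
    show "integrable lborel (\<lambda>z::real. K * 2 ^ j * indicator {0..1} z)" by simp
    show "AE z in lborel. norm ((\<Prod>h<H. z - \<alpha> h) * bspl t i j z) \<le> norm (K * 2 ^ j * indicator {0..1} z)"
    proof (rule AE_I2)
      fix z
      have "\<bar>\<Prod>h<H. z - \<alpha> h\<bar> * bspl t i j z \<le> K * (2 ^ j * indicator {0..1} z)"
      proof (cases "z \<in> {0..1}")
        case True
        then show ?thesis using K bspl_bound_indicator[OF i, of z] by (intro mult_mono) auto
      next
        case False
        then have "bspl t i j z = 0" using bspl_bound_indicator[OF i, of z] by (simp add: indicator_simps(2)[OF False])
        then show ?thesis using False by simp
      qed
      then show "norm ((\<Prod>h<H. z - \<alpha> h) * bspl t i j z) \<le> norm (K * 2 ^ j * indicator {0..1} z)"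
        using bspl_bound_indicator(1)[OF i, of z] K(1) by (simp add: abs_mult abs_of_nonneg mult.assoc)
    qed
  qed measurable
qed

lemma bstar_increment:
  fixes \<alpha> :: "nat \<Rightarrow> real"
  assumes "i + j < length t" "x \<le> y"
  shows "(LBINT z:{..y}. (\<Prod>h<H. z - \<alpha> h) * bspl t i j z) - (LBINT z:{..x}. (\<Prod>h<H. z - \<alpha> h) * bspl t i j z)
    = (LBINT z:{x<..y}. (\<Prod>h<H. z - \<alpha> h) * bspl t i j z)"
proof -
  have si: "set_integrable lborel A (\<lambda>z. (\<Prod>h<H. z - \<alpha> h) * bspl t i j z)" if "A \<in> sets borel" for A
    unfolding set_integrable_def using integrable_root_prod_bspl[OF assms(1)] that
    by (intro integrable_mult_indicator) auto
  have "{..y} = {..x} \<union> {x<..y}" using assms(2) by auto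
  then have "(LBINT z:{..y}. (\<Prod>h<H. z - \<alpha> h) * bspl t i j z) =
    (LBINT z:{..x}. (\<Prod>h<H. z - \<alpha> h) * bspl t i j z) + (LBINT z:{x<..y}. (\<Prod>h<H. z - \<alpha> h) * bspl t i j z)"
    using set_integral_Un[OF _ si si, of "{..x}" "{x<..y}"] by (simp add: disjoint_iff)
  then show ?thesis by simp
qed

end

lemma knots_ext_knots: "finite (knot_set c) \<Longrightarrow> knots (ext_knots j (knot_set c))"
  using ext_knots_props[OF _ knot_set_unit_interval] by unfold_locales auto

section \<open>Shape of the prior draws\<close>

text \<open>An increment is M times a nonnegative combination of integrals of the root product
  against B-splines, and the root product has one sign on an interval without roots. So the roots
  serve as breakpoints, whatever the knots are.\<close>

lemma spline_fun_piecewise_mono: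
  assumes \<beta>: "\<And>k. k \<ge> 1 \<Longrightarrow> \<beta> k \<ge> 0"
  shows "piecewise_mono H (spline_fun j H M c \<beta> \<alpha>)"
proof (cases "finite (knot_set c)")
  \<comment> \<open>An infinite knot set yields the default zero function, which is monotone
    everywhere.\<close>
  case False
  then have "spline_fun j H M c \<beta> \<alpha> = (\<lambda>x. 0)" by (auto simp: spline_fun_def)
  then show ?thesis by (auto simp: piecewise_mono_def monotone_on_def intro!: exI[of _ "{}"])
next
  case True
  define t where "t = ext_knots j (knot_set c)"
  interpret knots t j unfolding t_def using True by (rule knots_ext_knots)
  let ?n = "num_bsplines j (knot_set c)"
  let ?f = "spline_fun j H M c \<beta> \<alpha>"
  define I where "I k x y = (LBINT z:{x<..y}. (\<Prod>h<H. z - \<alpha> h) * bspl t (k - 1) j z)" for k x y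
  have k: "k - 1 + j < length t" if "k \<in> {1..?n}" for k
    using that by (auto simp: num_bsplines_def t_def)
  have diff: "?f y - ?f x = M * (\<Sum>k=1..?n. \<beta> k * I k x y)" if "x \<le> y" for x y
  proof -
    have "?f y - ?f x = (\<Sum>k=1..?n. \<beta> k * (bstar j H M \<alpha> (knot_set c) k y - bstar j H M \<alpha> (knot_set c) k x))"
      using True by (simp add: spline_fun_def Let_def right_diff_distrib sum_subtractf)
    also have "\<dots> = (\<Sum>k=1..?n. M * (\<beta> k * I k x y))"
    proof (rule sum.cong[OF refl])
      fix k assume "k \<in> {1..?n}"
      from bstar_increment[OF k[OF this] that, where H = H and \<alpha> = \<alpha>]
      show "\<beta> k * (bstar j H M \<alpha> (knot_set c) k y - bstar j H M \<alpha> (knot_set c) k x) = M * (\<beta> k * I k x y)"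
        by (simp add: bstar_def I_def t_def flip: right_diff_distrib)
    qed
    finally show ?thesis by (simp add: sum_distrib_left)
  qed
  have "mono_on C ?f \<or> antimono_on C ?f" if C: "is_interval C" "C \<inter> \<alpha> ` {..<H} = {}" for C
  proof -
    have sub: "{x<..y} \<subseteq> C" if "x \<in> C" "y \<in> C" for x y
      using that by (auto intro: mem_is_interval_1_I[OF C(1), of x y])
    consider "\<forall>z\<in>C. (\<Prod>h<H. z - \<alpha> h) \<ge> 0" | "\<forall>z\<in>C. (\<Prod>h<H. z - \<alpha> h) \<le> 0"
      using root_prod_sign[OF C] by blast
    then have "(\<forall>x\<in>C. \<forall>y\<in>C. x \<le> y \<longrightarrow> (\<Sum>k=1..?n. \<beta> k * I k x y) \<ge> 0) \<or> (\<forall>x\<in>C. \<forall>y\<in>C. x \<le> y \<longrightarrow> (\<Sum>k=1..?n. \<beta> k * I k x y) \<le> 0)"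
    proof cases
      case 1
      have "I k x y \<ge> 0" if "x \<in> C" "y \<in> C" "k \<in> {1..?n}" for x y k
        unfolding I_def set_lebesgue_integral_def
        by (rule integral_nonneg_AE, rule AE_I2)
           (use 1 sub[OF that(1,2)] bspl_bound_indicator(1)[OF k[OF that(3)]] in \<open>auto simp: indicator_def\<close>)
      then show ?thesis using \<beta> by (intro disjI1) (auto intro!: sum_nonneg mult_nonneg_nonneg)
    next
      case 2
      have "I k x y \<le> 0" if "x \<in> C" "y \<in> C" "k \<in> {1..?n}" for x y k
      proof -
        have "- I k x y = (LBINT z. indicator {x<..y} z *\<^sub>R (- (\<Prod>h<H. z - \<alpha> h) * bspl t (k - 1) j z))"
          unfolding I_def set_lebesgue_integral_def by (simp flip: Bochner_Integration.integral_minus)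
        also have "\<dots> \<ge> 0"
          by (rule integral_nonneg_AE, rule AE_I2)
             (use 2 sub[OF that(1,2)] bspl_bound_indicator(1)[OF k[OF that(3)]] in \<open>auto simp: indicator_def mult_nonpos_nonneg\<close>)
        finally show ?thesis by simp
      qed
      then show ?thesis using \<beta> by (intro disjI2) (auto intro!: sum_nonpos mult_nonneg_nonpos)
    qed
    then show ?thesis
    proof
      assume p: "\<forall>x\<in>C. \<forall>y\<in>C. x \<le> y \<longrightarrow> (\<Sum>k=1..?n. \<beta> k * I k x y) \<ge> 0"
      show ?thesis
      proof (cases "M \<ge> 0")
        case True
        have "?f x \<le> ?f y" if "x \<in> C" "y \<in> C" "x \<le> y" for x y
          using diff[OF that(3)] mult_nonneg_nonneg[OF True p[rule_format, OF that]] by linarith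
        then show ?thesis by (auto simp: monotone_on_def)
      next
        case False
        have "?f y \<le> ?f x" if "x \<in> C" "y \<in> C" "x \<le> y" for x y
          using diff[OF that(3)] mult_nonpos_nonneg[OF _ p[rule_format, OF that], of M] False by linarith
        then show ?thesis by (auto simp: monotone_on_def)
      qed
    next
      assume p: "\<forall>x\<in>C. \<forall>y\<in>C. x \<le> y \<longrightarrow> (\<Sum>k=1..?n. \<beta> k * I k x y) \<le> 0"
      show ?thesis
      proof (cases "M \<ge> 0")
        case True
        have "?f y \<le> ?f x" if "x \<in> C" "y \<in> C" "x \<le> y" for x y
          using diff[OF that(3)] mult_nonneg_nonpos[OF True p[rule_format, OF that]] by linarith
        then show ?thesis by (auto simp: monotone_on_def)
      next
        case False
        have "?f x \<le> ?f y" if "x \<in> C" "y \<in> C" "x \<le> y" for x y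
          using diff[OF that(3)] mult_nonpos_nonpos[OF _ p[rule_format, OF that], of M] False by linarith
        then show ?thesis by (auto simp: monotone_on_def)
      qed
    qed
  qed
  moreover have "card (\<alpha> ` {..<H}) \<le> H" using card_image_le[of "{..<H}" \<alpha>] by simp
  ultimately show ?thesis unfolding piecewise_mono_def by (intro exI[of _ "\<alpha> ` {..<H}"]) auto
qed

section \<open>Uniform approximation of f0 by splines with given roots\<close>

lemma ext_knots_grid:
  assumes "N \<ge> 1"
  defines "S \<equiv> (\<lambda>i. real i / real N) ` {..N}"
  shows "finite S" "length (ext_knots j S) = 2 * (j - 1) + N + 1"
    "i \<le> N \<Longrightarrow> ext_knots j S ! (j - 1 + i) = real i / real N"
proof -
  have S: "S = set (map (\<lambda>i. real i / real N) [0..<Suc N])" by (auto simp: S_def)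
  have "sorted_wrt (<) (map (\<lambda>i. real i / real N) [0..<Suc N])"
    using assms by (simp add: sorted_wrt_map divide_strict_right_mono sorted_wrt_iff_nth_less del: upt_Suc)
  then have "sorted_list_of_set S = map (\<lambda>i. real i / real N) [0..<Suc N]"
    unfolding S by (intro sorted_list_of_set.idem_if_sorted_distinct) (auto simp: strict_sorted_iff simp del: upt_Suc)
  then have e: "ext_knots j S = replicate (j - 1) 0 @ map (\<lambda>i. real i / real N) [0..<Suc N] @ replicate (j - 1) 1"
    by (simp add: ext_knots_def del: upt_Suc)
  show "finite S" by (simp add: S_def)
  show "length (ext_knots j S) = 2 * (j - 1) + N + 1" by (simp add: e)
  show "i \<le> N \<Longrightarrow> ext_knots j S ! (j - 1 + i) = real i / real N"
    unfolding e by (simp add: nth_append del: upt_Suc)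
qed

text \<open>A B-spline supported inside [p, q] confines the whole rise of its integrated basis
  function to [p, q], and there the integrand has one sign. The result is a step from 0 to w, with w
  of the sign of s.\<close>

lemma bump:
  fixes \<alpha> :: "nat \<Rightarrow> real" and M s p q :: real
  assumes j: "j \<ge> 1" and pq: "0 \<le> p" "p < q" "q \<le> 1"
    and N: "N \<ge> 1" "(q - p) * real N \<ge> real j + 1"
    and pos: "\<And>z. p < z \<Longrightarrow> z < q \<Longrightarrow> M * (\<Prod>h<H. z - \<alpha> h) * s > 0"
  defines "S \<equiv> (\<lambda>i. real i / real N) ` {..N}"
  obtains k w where "k \<in> {1..num_bsplines j S}" "w * s > 0"
    "\<And>x. x \<le> p \<Longrightarrow> bstar j H M \<alpha> S k x = 0" "\<And>x. q \<le> x \<Longrightarrow> bstar j H M \<alpha> S k x = w"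
    "\<And>x. 0 \<le> bstar j H M \<alpha> S k x / w \<and> bstar j H M \<alpha> S k x / w \<le> 1"
proof -
  define t where "t = ext_knots j S"
  note g = ext_knots_grid[OF N(1), folded S_def]
  have N0: "real N > 0" using N by simp
  have "S \<subseteq> {0..1}" using N0 by (auto simp: S_def divide_le_eq_1)
  then interpret knots t j
    using ext_knots_props[OF g(1)] unfolding t_def by unfold_locales auto
  \<comment> \<open>The first grid index strictly beyond p; since [p, q] has length at least j + 1
    grid cells, the knots i up to i + j stay inside.\<close>
  define i where "i = nat (\<lfloor>p * real N\<rfloor> + 1)"
  have i: "real i = of_int \<lfloor>p * real N\<rfloor> + 1" using pq N0 by (simp add: i_def)
  have i1: "p * real N < real i" "real i \<le> p * real N + 1" unfolding i by linarith+
  have iq: "real (i + j) \<le> q * real N" using i1 N(2) by (simp add: algebra_simps)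
  also have "\<dots> \<le> real N" using pq N0 by (simp add: mult_le_cancel_right1)
  finally have iN: "i + j \<le> N" by linarith
  \<comment> \<open>Grid point i sits at list index j - 1 + i behind the repeated knots at 0, and
    \<open>bstar\<close> with index k uses B-spline k - 1.\<close>
  define k where "k = j + i"
  have kj: "k - 1 = j - 1 + i" "k - 1 + j = j - 1 + (i + j)" using j by (auto simp: k_def)
  have lt: "k - 1 + j < length t" using iN j g(2)[of j] by (simp add: k_def t_def)
  have ti: "t ! (j - 1 + i') = real i' / real N" if "i' \<le> N" for i' using g(3)[OF that, of j] by (simp add: t_def)
  define u where "u = real i / real N"
  define v where "v = real (i + j) / real N"
  have u: "t ! (k - 1) = u" "t ! (k - 1 + j) = v"
  proof -
    show "t ! (k - 1) = u" unfolding kj(1) u_def by (rule ti) (use iN in simp)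
    show "t ! (k - 1 + j) = v" unfolding kj(2) v_def by (rule ti[OF iN])
  qed
  have uv: "p < u" "u < v" "v \<le> q" using i1 iq j N0 by (simp_all add: u_def v_def pos_less_divide_eq pos_divide_le_eq divide_strict_right_mono)
  define B where "B = bspl t (k - 1) j"
  have B0: "B z \<ge> 0" for z using bspl_bound_indicator[OF lt] by (simp add: B_def)
  have Bz: "B z = 0" if "z \<le> p \<or> q \<le> z" for z
    using bspl_bounds[OF sorted lt, of z] that uv unfolding u B_def by auto
  have Bp: "B z > 0" if "u < z" "z < v" for z unfolding B_def
  proof (rule bspl_pos[OF sorted lt j])
    fix l assume l: "k - 1 \<le> l" "l < k - 1 + j"
    then obtain l' where l': "l = j - 1 + l'" "l' < N" using kj iN by (metis add.assoc add_lessD1 le_Suc_ex less_le_trans nat_add_left_cancel_less)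
    have "t ! Suc l = real (Suc l') / real N" using ti[of "Suc l'"] l' by simp
    moreover have "t ! l = real l' / real N" using ti[of l'] l' by simp
    ultimately show "t ! l < t ! Suc l" using N0 by (simp add: divide_strict_right_mono)
  qed (use that u in auto)
  \<comment> \<open>Multiplying by s makes the integrand nonnegative, so its integral up to x lies
    between 0 and the total W; dividing by s restores the sign.\<close>
  define G where "G z = s * (M * ((\<Prod>h<H. z - \<alpha> h) * B z))" for z
  have Gint: "integrable lborel G"
    unfolding G_def B_def by (intro integrable_mult_right integrable_root_prod_bspl lt)
  have G0: "G z \<ge> 0" for z
  proof (cases "p < z \<and> z < q")
    case True
    then have "(M * (\<Prod>h<H. z - \<alpha> h) * s) * B z \<ge> 0" using mult_nonneg_nonneg[OF less_imp_le[OF pos] B0] by blast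
    then show ?thesis by (simp add: G_def mult_ac)
  next
    case False then show ?thesis using Bz[of z] by (auto simp: G_def not_less)
  qed
  have Gp: "G z > 0" if "u < z" "z < v" for z
  proof -
    have "(M * (\<Prod>h<H. z - \<alpha> h) * s) * B z > 0" using uv that by (intro mult_pos_pos[OF pos Bp]) auto
    then show ?thesis by (simp add: G_def mult_ac)
  qed
  define W where "W = (LINT z|lborel. G z)"
  have "W \<ge> 0" unfolding W_def using G0 by (intro integral_nonneg_AE) auto
  moreover have "W \<noteq> 0"
  proof
    assume "W = 0"
    then have "AE z in lborel. G z = 0" using Gint G0 integral_nonneg_eq_0_iff_AE[of lborel G] by (simp add: W_def)
    then have "AE z in lborel. z \<notin> {u<..<v}" by eventually_elim (use Gp in fastforce)
    then have "{u<..<v} \<in> null_sets lborel" by (subst AE_iff_null_sets) auto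
    then show False using uv by (simp add: null_sets_def)
  qed
  ultimately have W: "W > 0" by simp
  have s0: "s \<noteq> 0" using pos[of "(p + q) / 2"] pq by auto
  define b where "b x = bstar j H M \<alpha> S k x" for x
  have sb: "s * b x = (LINT z|lborel. indicator {..x} z * G z)" for x
    unfolding b_def bstar_def set_lebesgue_integral_def G_def B_def t_def[symmetric]
    by (subst integral_mult_right_zero[symmetric], subst integral_mult_right_zero[symmetric]) (simp add: mult_ac)
  have low: "s * b x \<ge> 0" for x unfolding sb using G0 by (intro integral_nonneg_AE) auto
  have up: "s * b x \<le> W" for x unfolding sb W_def
  proof (rule integral_mono)
    show "integrable lborel (\<lambda>z. indicator {..x} z * G z)"
      using integrable_mult_indicator[OF _ Gint, of "{..x}"] by simp
  qed (use Gint G0 in \<open>auto simp: indicator_def\<close>)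
  have z0: "b x = 0" if "x \<le> p" for x
  proof -
    have "s * b x = (LINT z::real|lborel. 0)" unfolding sb
      by (intro Bochner_Integration.integral_cong) (use that Bz in \<open>auto simp: indicator_def G_def\<close>)
    then show ?thesis using s0 by simp
  qed
  have z1: "s * b x = W" if "q \<le> x" for x
    unfolding sb W_def
    by (intro Bochner_Integration.integral_cong) (use that Bz in \<open>auto simp: indicator_def G_def\<close>)
  show ?thesis
  proof (rule that)
    show "k \<in> {1..num_bsplines j S}"
      using lt j by (auto simp: num_bsplines_def t_def k_def)
    show "W / s * s > 0" using W s0 by simp
    show "x \<le> p \<Longrightarrow> bstar j H M \<alpha> S k x = 0" for x using z0 by (simp add: b_def)
    show "q \<le> x \<Longrightarrow> bstar j H M \<alpha> S k x = W / s" for x using z1[of x] s0 by (simp add: b_def field_simps)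
    show "0 \<le> bstar j H M \<alpha> S k x / (W / s) \<and> bstar j H M \<alpha> S k x / (W / s) \<le> 1" for x
      using low[of x] up[of x] W s0 by (simp add: b_def field_simps)
  qed
qed

text \<open>On a mesh where f0 varies by less than \<eta> / 2 per cell, each increment is delivered
  by one bump rising inside its own cell. The spline agrees with f0 at all mesh points, and within a
  cell the bump and f0 each move by less than \<eta> / 2. Coefficients are nonnegative since every
  bump has the sign of its increment.\<close>

lemma spline_approximation:
  fixes \<alpha> :: "nat \<Rightarrow> real" and M \<eta> :: real
  assumes j: "j \<ge> 1" and f0: "continuous_on {0..1} f0" and "\<eta> > 0"
    and compat: "\<And>u v. 0 \<le> u \<Longrightarrow> u < v \<Longrightarrow> v \<le> 1 \<Longrightarrow> f0 u \<noteq> f0 v \<Longrightarrow>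
      \<exists>p q. u \<le> p \<and> p < q \<and> q \<le> v \<and> (\<forall>z. p < z \<and> z < q \<longrightarrow> M * (\<Prod>h<H. z - \<alpha> h) * (f0 v - f0 u) > 0)"
  obtains D \<beta> where "\<And>k. k \<ge> 1 \<Longrightarrow> \<beta> k \<ge> (0::real)"
    "\<And>c x. knot_set c = (\<lambda>i. real i / 2 ^ (D + 1)) ` {..2 ^ (D + 1)} \<Longrightarrow> x \<in> {0..1} \<Longrightarrow> \<bar>spline_fun j H M c \<beta> \<alpha> x - f0 x\<bar> \<le> \<eta>"
proof -
  obtain d where d: "d > 0" "\<And>x y. x \<in> {0..1} \<Longrightarrow> y \<in> {0..1} \<Longrightarrow> \<bar>x - y\<bar> < d \<Longrightarrow> \<bar>f0 x - f0 y\<bar> < \<eta> / 2"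
    using compact_uniformly_continuous[OF f0] \<open>\<eta> > 0\<close> unfolding uniformly_continuous_on_def
    by (metis compact_Icc dist_real_def half_gt_zero)
  obtain L' where L': "1 / real (Suc L') < d" using nat_approx_posE[OF d(1)] by metis
  define L where "L = Suc L'"
  have L: "real L > 0" "1 / real L < d" using L' by (auto simp: L_def)
  define U where "U m = real m / real L" for m
  define \<Delta> where "\<Delta> m = f0 (U (Suc m)) - f0 (U m)" for m
  have U: "0 \<le> U m" "U m < U (Suc m)" for m using L by (auto simp: U_def divide_strict_right_mono)
  have U1: "U m \<le> 1" if "m \<le> L" for m using L that by (simp add: U_def divide_le_eq_1)
  have Ustep: "U (Suc m) - U m = 1 / real L" for m by (simp add: U_def diff_divide_distrib[symmetric])
  have Umono: "m \<le> n \<Longrightarrow> U m \<le> U n" for m n using L by (simp add: U_def divide_right_mono)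
  have "\<forall>m\<in>{m. m < L \<and> \<Delta> m \<noteq> 0}. \<exists>pq. U m \<le> fst pq \<and> fst pq < snd pq \<and> snd pq \<le> U (Suc m) \<and>
     (\<forall>z. fst pq < z \<and> z < snd pq \<longrightarrow> M * (\<Prod>h<H. z - \<alpha> h) * \<Delta> m > 0)"
  proof
    fix m assume m: "m \<in> {m. m < L \<and> \<Delta> m \<noteq> 0}"
    then show "\<exists>pq. U m \<le> fst pq \<and> fst pq < snd pq \<and> snd pq \<le> U (Suc m) \<and>
     (\<forall>z. fst pq < z \<and> z < snd pq \<longrightarrow> M * (\<Prod>h<H. z - \<alpha> h) * \<Delta> m > 0)"
      using compat[OF U(1)[of m] U(2)[of m] U1[of "Suc m"]] unfolding \<Delta>_def by auto
  qed
  from bchoice[OF this] obtain pq where pq: "\<And>m. m < L \<Longrightarrow> \<Delta> m \<noteq> 0 \<Longrightarrow> U m \<le> fst (pq m) \<and> fst (pq m) < snd (pq m) \<and> snd (pq m) \<le> U (Suc m) \<and>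
     (\<forall>z. fst (pq m) < z \<and> z < snd (pq m) \<longrightarrow> M * (\<Prod>h<H. z - \<alpha> h) * \<Delta> m > 0)" by blast
  \<comment> \<open>The depth is chosen last, so fine that each of the finitely many intervals spans
    j + 1 grid cells.\<close>
  have "\<forall>\<^sub>F D in sequentially. \<forall>m\<in>{m. m < L \<and> \<Delta> m \<noteq> 0}. (snd (pq m) - fst (pq m)) * real (2 ^ (D + 1)) \<ge> real j + 1"
  proof (rule eventually_ball_finite, simp, rule ballI)
    fix m assume "m \<in> {m. m < L \<and> \<Delta> m \<noteq> 0}"
    then have gap: "snd (pq m) - fst (pq m) > 0" using pq by simp
    have "\<forall>\<^sub>F D in sequentially. real D \<ge> (real j + 1) / (snd (pq m) - fst (pq m))"
      using filterlim_real_sequentially by (simp add: filterlim_at_top)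
    then show "\<forall>\<^sub>F D in sequentially. (snd (pq m) - fst (pq m)) * real (2 ^ (D + 1)) \<ge> real j + 1"
    proof eventually_elim
      case (elim D)
      have "D \<le> 2 ^ (D + 1)" using less_exp[of "D + 1"] by linarith
      then have "real D \<le> real (2 ^ (D + 1))" using of_nat_le_iff by blast
      with elim have "(real j + 1) / (snd (pq m) - fst (pq m)) \<le> real (2 ^ (D + 1))" by linarith
      then show ?case using gap by (simp only: pos_divide_le_eq mult.commute)
    qed
  qed
  then obtain D where D: "\<And>m. m < L \<Longrightarrow> \<Delta> m \<noteq> 0 \<Longrightarrow> (snd (pq m) - fst (pq m)) * real (2 ^ (D + 1)) \<ge> real j + 1"
    using eventually_happens'[OF sequentially_bot] by fastforce
  define N :: nat where "N = 2 ^ (D + 1)"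
  define S where "S = (\<lambda>i. real i / real N) ` {..N}"
  have N1: "N \<ge> 1" by (simp add: N_def)
  define n where "n = num_bsplines j S"
  have "\<forall>m\<in>{m. m < L \<and> \<Delta> m \<noteq> 0}. \<exists>kw. fst kw \<in> {1..n} \<and> snd kw * \<Delta> m > 0 \<and>
    (\<forall>x\<le>fst (pq m). bstar j H M \<alpha> S (fst kw) x = 0) \<and> (\<forall>x\<ge>snd (pq m). bstar j H M \<alpha> S (fst kw) x = snd kw) \<and>
    (\<forall>x. 0 \<le> bstar j H M \<alpha> S (fst kw) x / snd kw \<and> bstar j H M \<alpha> S (fst kw) x / snd kw \<le> 1)"
  proof
    fix m assume m: "m \<in> {m. m < L \<and> \<Delta> m \<noteq> 0}"
    then have ml: "m < L" "\<Delta> m \<noteq> 0" by auto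
    note p = pq[OF ml]
    have "0 \<le> fst (pq m)" "fst (pq m) < snd (pq m)" "snd (pq m) \<le> 1"
      using p U(1)[of m] U1[of "Suc m"] ml by auto
    from bump[where M = M and H = H and \<alpha> = \<alpha> and s = "\<Delta> m", OF j this N1 D[OF ml, folded N_def], folded S_def n_def]
    obtain k w where "k \<in> {1..n}" "w * \<Delta> m > 0"
      "\<And>x. x \<le> fst (pq m) \<Longrightarrow> bstar j H M \<alpha> S k x = 0" "\<And>x. snd (pq m) \<le> x \<Longrightarrow> bstar j H M \<alpha> S k x = w"
      "\<And>x. 0 \<le> bstar j H M \<alpha> S k x / w \<and> bstar j H M \<alpha> S k x / w \<le> 1"
      using p by blast
    then show "\<exists>kw. fst kw \<in> {1..n} \<and> snd kw * \<Delta> m > 0 \<and>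
      (\<forall>x\<le>fst (pq m). bstar j H M \<alpha> S (fst kw) x = 0) \<and> (\<forall>x\<ge>snd (pq m). bstar j H M \<alpha> S (fst kw) x = snd kw) \<and>
      (\<forall>x. 0 \<le> bstar j H M \<alpha> S (fst kw) x / snd kw \<and> bstar j H M \<alpha> S (fst kw) x / snd kw \<le> 1)"
      by (intro exI[of _ "(k, w)"]) simp
  qed
  from bchoice[OF this] obtain kw where kw: "\<And>m. m < L \<Longrightarrow> \<Delta> m \<noteq> 0 \<Longrightarrow> fst (kw m) \<in> {1..n} \<and> snd (kw m) * \<Delta> m > 0 \<and>
    (\<forall>x\<le>fst (pq m). bstar j H M \<alpha> S (fst (kw m)) x = 0) \<and> (\<forall>x\<ge>snd (pq m). bstar j H M \<alpha> S (fst (kw m)) x = snd (kw m)) \<and>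
    (\<forall>x. 0 \<le> bstar j H M \<alpha> S (fst (kw m)) x / snd (kw m) \<and> bstar j H M \<alpha> S (fst (kw m)) x / snd (kw m) \<le> 1)"
    by blast
  \<comment> \<open>Summing over all mesh cells that selected B-spline k makes distinctness of the
    selected indices irrelevant to the later exchange of sums.\<close>
  define \<beta> where "\<beta> k = (if k = 0 then f0 0 else \<Sum>m<L. if \<Delta> m \<noteq> 0 \<and> fst (kw m) = k then \<Delta> m / snd (kw m) else 0)" for k
  define \<theta> where "\<theta> m x = bstar j H M \<alpha> S (fst (kw m)) x / snd (kw m)" for m x
  have \<beta>: "\<beta> k \<ge> 0" if "k \<ge> 1" for k
  proof -
    have "\<Delta> m / snd (kw m) \<ge> 0" if "m < L" "\<Delta> m \<noteq> 0" for m
      using kw[OF that] by (auto simp: zero_less_mult_iff zero_le_divide_iff)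
    then show ?thesis using that by (auto simp: \<beta>_def intro!: sum_nonneg)
  qed
  have main: "\<bar>spline_fun j H M c \<beta> \<alpha> x - f0 x\<bar> \<le> \<eta>" if c: "knot_set c = S" and x: "x \<in> {0..1}" for c x
  proof -
    have "spline_fun j H M c \<beta> \<alpha> x = f0 0 + (\<Sum>k=1..n. \<beta> k * bstar j H M \<alpha> S k x)"
      unfolding spline_fun_def c Let_def by (simp add: n_def S_def \<beta>_def)
    also have "(\<Sum>k=1..n. \<beta> k * bstar j H M \<alpha> S k x) =
       (\<Sum>k=1..n. \<Sum>m<L. if fst (kw m) = k then (if \<Delta> m \<noteq> 0 then \<Delta> m / snd (kw m) * bstar j H M \<alpha> S k x else 0) else 0)"
      by (intro sum.cong refl) (auto simp: \<beta>_def sum_distrib_right intro!: sum.cong)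
    also have "\<dots> = (\<Sum>m<L. \<Sum>k=1..n. if fst (kw m) = k then (if \<Delta> m \<noteq> 0 then \<Delta> m / snd (kw m) * bstar j H M \<alpha> S k x else 0) else 0)"
      by (rule sum.swap)
    also have "\<dots> = (\<Sum>m<L. \<Delta> m * \<theta> m x)"
    proof (rule sum.cong[OF refl])
      fix m assume "m \<in> {..<L}"
      then show "(\<Sum>k=1..n. if fst (kw m) = k then (if \<Delta> m \<noteq> 0 then \<Delta> m / snd (kw m) * bstar j H M \<alpha> S k x else 0) else 0) = \<Delta> m * \<theta> m x"
        using kw[of m] by (cases "\<Delta> m = 0") (auto simp: \<theta>_def sum.delta)
    qed
    finally have sp: "spline_fun j H M c \<beta> \<alpha> x = f0 0 + (\<Sum>m<L. \<Delta> m * \<theta> m x)" .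
    \<comment> \<open>The cell containing x; the minimum with L' puts x = 1 into the last
      cell.\<close>
    define r where "r = min (nat \<lfloor>x * real L\<rfloor>) L'"
    have r: "r < L" "U r \<le> x" "x \<le> U (Suc r)"
    proof -
      show "r < L" by (simp add: r_def L_def)
      have xL: "x * real L \<ge> 0" "x * real L \<le> real L" using x L by (auto simp: mult_le_cancel_right1)
      have "real r \<le> x * real L" using xL(1) unfolding r_def by linarith
      then show "U r \<le> x" using L by (simp add: U_def pos_divide_le_eq)
      have "x * real L \<le> real (Suc r)" using xL unfolding r_def L_def by linarith
      then show "x \<le> U (Suc r)" using L unfolding U_def by (simp only: pos_le_divide_eq)
    qed
    have t1: "\<Delta> m * \<theta> m x = \<Delta> m" if "m < r" for m
    proof (cases "\<Delta> m = 0")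
      case False
      have "m < L" using that r by simp
      have "snd (pq m) \<le> x" using pq[OF \<open>m < L\<close> False] Umono[of "Suc m" r] that r by linarith
      then have "bstar j H M \<alpha> S (fst (kw m)) x = snd (kw m)" using kw[OF \<open>m < L\<close> False] by blast
      moreover have "snd (kw m) \<noteq> 0" using kw[OF \<open>m < L\<close> False] by auto
      ultimately show ?thesis by (simp add: \<theta>_def)
    qed simp
    have t2: "\<Delta> m * \<theta> m x = 0" if "r < m" "m < L" for m
    proof (cases "\<Delta> m = 0")
      case False
      have "x \<le> fst (pq m)" using pq[OF that(2) False] Umono[of "Suc r" m] that r by linarith
      then have "bstar j H M \<alpha> S (fst (kw m)) x = 0" using kw[OF that(2) False] by blast
      then show ?thesis by (simp add: \<theta>_def)
    qed simp
    have "\<bar>\<Delta> r * \<theta> r x\<bar> \<le> \<bar>\<Delta> r\<bar>"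
    proof (cases "\<Delta> r = 0")
      case False
      then have "0 \<le> \<theta> r x" "\<theta> r x \<le> 1" using kw[OF r(1) False] by (auto simp: \<theta>_def)
      then show ?thesis by (simp add: abs_mult mult_left_le)
    qed simp
    also have "\<bar>\<Delta> r\<bar> < \<eta> / 2"
      unfolding \<Delta>_def using Ustep[of r] L U r U1[of "Suc r"] U1[of r] U(1)[of "Suc r"] by (intro d(2)) auto
    finally have t3: "\<bar>\<Delta> r * \<theta> r x\<bar> < \<eta> / 2" .
    have "(\<Sum>m<L. \<Delta> m * \<theta> m x) = (\<Sum>m\<in>{..<r} \<union> {r}. \<Delta> m * \<theta> m x)"
      by (rule sum.mono_neutral_right) (use r t2 in auto)
    also have "\<dots> = (\<Sum>m<r. \<Delta> m) + \<Delta> r * \<theta> r x" by (subst sum.union_disjoint) (auto intro!: sum.cong simp: t1[simplified])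
    also have "(\<Sum>m<r. \<Delta> m) = f0 (U r) - f0 0"
      unfolding \<Delta>_def by (subst sum_lessThan_telescope) (simp add: U_def)
    finally have "spline_fun j H M c \<beta> \<alpha> x - f0 x = (f0 (U r) - f0 x) + \<Delta> r * \<theta> r x" using sp by simp
    moreover have "\<bar>f0 (U r) - f0 x\<bar> < \<eta> / 2"
      using Ustep[of r] L U(1)[of r] r U1[of r] x by (intro d(2)) auto
    ultimately show ?thesis using t3 by linarith
  qed
  show ?thesis
  proof (rule that)
    show "\<And>k. k \<ge> 1 \<Longrightarrow> \<beta> k \<ge> 0" by (rule \<beta>)
    fix c and x :: real assume "knot_set c = (\<lambda>i. real i / 2 ^ (D + 1)) ` {..2 ^ (D + 1)}" "x \<in> {0..1}"
    then show "\<bar>spline_fun j H M c \<beta> \<alpha> x - f0 x\<bar> \<le> \<eta>" by (intro main) (auto simp: S_def N_def)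
  qed
qed

section \<open>Continuity of the spline in its roots and coefficients\<close>

text \<open>One factor at a time: the change is (P' - P) (z - \<alpha>') + P (\<alpha> - \<alpha>'),
  with both P and the new factor bounded on [0, 1].\<close>

lemma root_prod_perturbation:
  fixes \<alpha> :: "nat \<Rightarrow> real"
  assumes "\<eta> > 0"
  shows "\<exists>d>0. \<forall>\<alpha>'. (\<forall>h<H. \<bar>\<alpha>' h - \<alpha> h\<bar> < d) \<longrightarrow> (\<forall>z\<in>{0..1}. \<bar>(\<Prod>h<H. z - \<alpha>' h) - (\<Prod>h<H. z - \<alpha> h)\<bar> \<le> (\<eta>::real))"
  using assms
proof (induction H arbitrary: \<eta>)
  case 0
  then show ?case by (intro exI[of _ 1]) auto
next
  case (Suc H)
  obtain K where K: "K \<ge> 0" "\<And>z. z \<in> {0..1} \<Longrightarrow> \<bar>\<Prod>h<H. z - \<alpha> h\<bar> \<le> K"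
    using root_prod_bounded[of \<alpha> H] by blast
  define R where "R = 2 + \<bar>\<alpha> H\<bar>"
  have R: "R > 0" by (simp add: R_def)
  obtain d where d: "d > 0" "\<And>\<alpha>' z. (\<forall>h<H. \<bar>\<alpha>' h - \<alpha> h\<bar> < d) \<Longrightarrow> z \<in> {0..1} \<Longrightarrow> \<bar>(\<Prod>h<H. z - \<alpha>' h) - (\<Prod>h<H. z - \<alpha> h)\<bar> \<le> \<eta> / (2 * R)"
    using Suc.IH[of "\<eta> / (2 * R)"] Suc.prems R by auto
  define d' where "d' = min (min d 1) (\<eta> / (2 * (K + 1)))"
  have d': "d' > 0" "d' \<le> d" "d' \<le> 1" "d' \<le> \<eta> / (2 * (K + 1))" using d(1) Suc.prems K(1) by (auto simp: d'_def)
  show ?case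
  proof (intro exI[of _ d'] conjI allI impI ballI)
    fix \<alpha>' z assume a: "\<forall>h<Suc H. \<bar>\<alpha>' h - \<alpha> h\<bar> < d'" and z: "z \<in> {0..1::real}"
    define P where "P = (\<Prod>h<H. z - \<alpha> h)"
    define P' where "P' = (\<Prod>h<H. z - \<alpha>' h)"
    have "\<bar>P' - P\<bar> \<le> \<eta> / (2 * R)" unfolding P_def P'_def
    proof (rule d(2)[OF _ z], intro allI impI)
      fix h assume "h < H"
      then have "\<bar>\<alpha>' h - \<alpha> h\<bar> < d'" using a by simp
      then show "\<bar>\<alpha>' h - \<alpha> h\<bar> < d" using d'(2) by linarith
    qed
    moreover have "\<bar>z - \<alpha>' H\<bar> \<le> R"
    proof -
      have "\<bar>\<alpha>' H - \<alpha> H\<bar> < 1" using a d'(3) by (meson lessI less_le_trans)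
      then show ?thesis using z unfolding R_def atLeastAtMost_iff by linarith
    qed
    ultimately have "\<bar>P' - P\<bar> * \<bar>z - \<alpha>' H\<bar> \<le> \<eta> / (2 * R) * R" by (intro mult_mono) auto
    also have "\<dots> = \<eta> / 2" using R by simp
    finally have 1: "\<bar>P' - P\<bar> * \<bar>z - \<alpha>' H\<bar> \<le> \<eta> / 2" .
    have "\<bar>P\<bar> * \<bar>\<alpha> H - \<alpha>' H\<bar> \<le> K * (\<eta> / (2 * (K + 1)))"
      using K(2)[OF z] K(1) a d' by (intro mult_mono) (auto simp: P_def abs_minus_commute intro: less_imp_le less_le_trans)
    also have "\<dots> \<le> \<eta> / 2" using K(1) Suc.prems by (simp add: field_simps)
    finally have 2: "\<bar>P\<bar> * \<bar>\<alpha> H - \<alpha>' H\<bar> \<le> \<eta> / 2" .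
    have "(\<Prod>h<Suc H. z - \<alpha>' h) - (\<Prod>h<Suc H. z - \<alpha> h) = (P' - P) * (z - \<alpha>' H) + P * (\<alpha> H - \<alpha>' H)"
      by (simp add: P_def P'_def algebra_simps)
    then show "\<bar>(\<Prod>h<Suc H. z - \<alpha>' h) - (\<Prod>h<Suc H. z - \<alpha> h)\<bar> \<le> \<eta>"
      using 1 2 abs_triangle_ineq[of "(P' - P) * (z - \<alpha>' H)" "P * (\<alpha> H - \<alpha>' H)"] by (simp add: abs_mult)
  qed (rule d'(1))
qed

text \<open>A general factor \<phi> covers both a root product and the difference of two root
  products.\<close>

lemma (in knots) bstar_integral_bound:
  fixes \<phi> :: "real \<Rightarrow> real"
  assumes i: "i + j < length t" and \<phi>: "\<And>z. z \<in> {0..1} \<Longrightarrow> \<bar>\<phi> z\<bar> \<le> K" and "K \<ge> 0"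
    and [measurable]: "\<phi> \<in> borel_measurable borel"
  shows "\<bar>LBINT z:{..x}. \<phi> z * bspl t i j z\<bar> \<le> 2 ^ j * K"
proof -
  have bd: "\<bar>indicator {..x} z * (\<phi> z * bspl t i j z)\<bar> \<le> (2 ^ j * K) * indicator {0..1} z" for z :: real
  proof (cases "z \<in> {0..1}")
    case True
    then have "\<bar>\<phi> z\<bar> * bspl t i j z \<le> K * 2 ^ j"
      using \<phi>[OF True] bspl_bound_indicator[OF i, of z] \<open>K \<ge> 0\<close> by (intro mult_mono) auto
    then show ?thesis using True bspl_bound_indicator[OF i, of z] \<open>K \<ge> 0\<close> by (auto simp: indicator_def abs_mult mult.commute)
  next
    case False
    then have "bspl t i j z = 0" using bspl_bound_indicator[OF i, of z] by (simp add: indicator_simps(2)[OF False])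
    then show ?thesis using False by simp
  qed
  have int: "integrable lborel (\<lambda>z. indicator {..x} z * (\<phi> z * bspl t i j z))"
    by (rule Bochner_Integration.integrable_bound[where f = "\<lambda>z::real. (2 ^ j * K) * indicator {0..1} z"])
       (use bd \<open>K \<ge> 0\<close> in \<open>auto simp: abs_mult\<close>)
  have "\<bar>LBINT z:{..x}. \<phi> z * bspl t i j z\<bar> \<le> (LINT z|lborel. \<bar>indicator {..x} z * (\<phi> z * bspl t i j z)\<bar>)"
    unfolding set_lebesgue_integral_def
    using integral_norm_bound[of lborel "\<lambda>z. indicator {..x} z * (\<phi> z * bspl t i j z)"] by simp
  also have "\<dots> \<le> (LINT z::real|lborel. (2 ^ j * K) * indicator {0..1} z)"
    by (rule integral_mono) (use int bd in auto)
  also have "\<dots> = 2 ^ j * K" by simp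
  finally show ?thesis .
qed

text \<open>For a fixed knot set only n + 1 coefficients and H roots enter, and the estimate is
  uniform in x because all B-splines live on [0, 1]. One third of \<eta> goes to the coefficients
  and one third to the roots.\<close>

lemma spline_perturbation:
  fixes \<alpha> \<beta> :: "nat \<Rightarrow> real" and M \<eta> :: real and j :: nat
  assumes S: "finite S" "S \<subseteq> {0..1}" and M: "M = -1 \<or> M = 1" and "\<eta> > 0"
  defines "n \<equiv> num_bsplines j S"
  obtains d where "d > 0" "\<And>c \<beta>' \<alpha>' x. knot_set c = S \<Longrightarrow> \<forall>k\<le>n. \<bar>\<beta>' k - \<beta> k\<bar> < d \<Longrightarrow> \<forall>h<H. \<bar>\<alpha>' h - \<alpha> h\<bar> < d \<Longrightarrow>
     \<bar>spline_fun j H M c \<beta>' \<alpha>' x - spline_fun j H M c \<beta> \<alpha> x\<bar> \<le> \<eta>"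
proof -
  define t where "t = ext_knots j S"
  interpret knots t j using ext_knots_props[OF S] unfolding t_def by unfold_locales auto
  have lt: "k - 1 + j < length t" if "k \<in> {1..n}" for k
    using that by (auto simp: n_def num_bsplines_def t_def)
  obtain K where K: "K \<ge> 0" "\<And>z. z \<in> {0..1} \<Longrightarrow> \<bar>\<Prod>h<H. z - \<alpha> h\<bar> \<le> K"
    using root_prod_bounded[of \<alpha> H] by blast
  define B where "B = (\<Sum>k=1..n. \<bar>\<beta> k\<bar>)"
  have B: "B \<ge> 0" by (simp add: B_def sum_nonneg)
  define \<eta>' where "\<eta>' = min 1 (\<eta> / (3 * (2 ^ j * (B + 1))))"
  have BB: "0 < 2 ^ j * (B + 1)" using B by (intro mult_pos_pos) auto
  then have \<eta>': "\<eta>' > 0" "\<eta>' \<le> 1" "2 ^ j * (B + 1) * \<eta>' \<le> \<eta> / 3"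
  proof -
    show "\<eta>' > 0" "\<eta>' \<le> 1" using BB \<open>\<eta> > 0\<close> by (auto simp: \<eta>'_def)
    have "\<eta>' \<le> \<eta> / (3 * (2 ^ j * (B + 1)))" by (simp add: \<eta>'_def)
    then have "\<eta>' * (3 * (2 ^ j * (B + 1))) \<le> \<eta>" using BB by (subst (asm) pos_le_divide_eq) auto
    then show "2 ^ j * (B + 1) * \<eta>' \<le> \<eta> / 3" by (simp add: mult_ac)
  qed
  obtain d1 where d1: "d1 > 0" "\<And>\<alpha>' z. (\<forall>h<H. \<bar>\<alpha>' h - \<alpha> h\<bar> < d1) \<Longrightarrow> z \<in> {0..1} \<Longrightarrow> \<bar>(\<Prod>h<H. z - \<alpha>' h) - (\<Prod>h<H. z - \<alpha> h)\<bar> \<le> \<eta>'"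
    using root_prod_perturbation[OF \<eta>'(1), of H \<alpha>] by blast
  define R where "R = 1 + real n * (2 ^ j * (K + 1))"
  have R: "R > 0" using K(1) unfolding R_def by (intro add_pos_nonneg mult_nonneg_nonneg) auto
  define d where "d = min d1 (\<eta> / (3 * R))"
  have d: "d > 0" "d \<le> d1" "R * d \<le> \<eta> / 3"
  proof -
    show "d > 0" "d \<le> d1" using d1 R \<open>\<eta> > 0\<close> by (auto simp: d_def)
    have "d \<le> \<eta> / (3 * R)" by (simp add: d_def)
    then show "R * d \<le> \<eta> / 3" using R by (simp add: field_simps)
  qed
  show ?thesis
  proof (rule that)
    show "d > 0" by fact
    fix c \<beta>' \<alpha>' and x :: real
    assume c: "knot_set c = S" and "\<forall>k\<le>n. \<bar>\<beta>' k - \<beta> k\<bar> < d" and "\<forall>h<H. \<bar>\<alpha>' h - \<alpha> h\<bar> < d"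
    then have b: "\<And>k. k \<le> n \<Longrightarrow> \<bar>\<beta>' k - \<beta> k\<bar> < d" and a: "\<And>h. h < H \<Longrightarrow> \<bar>\<alpha>' h - \<alpha> h\<bar> < d" by blast+
    have pd: "\<bar>(\<Prod>h<H. z - \<alpha>' h) - (\<Prod>h<H. z - \<alpha> h)\<bar> \<le> \<eta>'" if "z \<in> {0..1}" for z
      using a d(2) that by (intro d1(2)) (auto intro: less_le_trans)
    have pb: "\<bar>\<Prod>h<H. z - \<alpha>' h\<bar> \<le> K + 1" if "z \<in> {0..1}" for z
      using pd[OF that] K(2)[OF that] \<eta>'(2) by linarith
    let ?b = "bstar j H M \<alpha> S" and ?b' = "bstar j H M \<alpha>' S"
    have b1: "\<bar>?b' k x\<bar> \<le> 2 ^ j * (K + 1)" if k: "k \<in> {1..n}" for k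
      using bstar_integral_bound[OF lt[OF k] pb, where x = x] K(1) M by (auto simp: bstar_def t_def abs_mult)
    have b2: "\<bar>?b' k x - ?b k x\<bar> \<le> 2 ^ j * \<eta>'" if k: "k \<in> {1..n}" for k
    proof -
      have si: "set_integrable lborel {..x} (\<lambda>z. (\<Prod>h<H. z - \<alpha> h) * bspl t (k - 1) j z)" for \<alpha> :: "nat \<Rightarrow> real"
        unfolding set_integrable_def using integrable_root_prod_bspl[OF lt[OF k]]
        by (intro integrable_mult_indicator) auto
      have "?b' k x - ?b k x = M * (LBINT z:{..x}. (\<Prod>h<H. z - \<alpha>' h) * bspl t (k - 1) j z - (\<Prod>h<H. z - \<alpha> h) * bspl t (k - 1) j z)"
        unfolding bstar_def t_def[symmetric] by (subst set_integral_diff(2)[OF si si]) (simp add: right_diff_distrib)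
      also have "\<dots> = M * (LBINT z:{..x}. ((\<Prod>h<H. z - \<alpha>' h) - (\<Prod>h<H. z - \<alpha> h)) * bspl t (k - 1) j z)"
        by (simp add: left_diff_distrib)
      finally show ?thesis
        using bstar_integral_bound[OF lt[OF k] pd, where x = x] \<eta>'(1) M by (auto simp: abs_mult)
    qed
    have fS: "finite (knot_set c)" using c S by simp
    have "spline_fun j H M c \<beta>' \<alpha>' x - spline_fun j H M c \<beta> \<alpha> x =
       (\<beta>' 0 - \<beta> 0) + (\<Sum>k=1..n. \<beta>' k * ?b' k x - \<beta> k * ?b k x)"
      using S by (simp add: spline_fun_def c Let_def n_def sum_subtractf)
    also have "(\<Sum>k=1..n. \<beta>' k * ?b' k x - \<beta> k * ?b k x) = (\<Sum>k=1..n. (\<beta>' k - \<beta> k) * ?b' k x) + (\<Sum>k=1..n. \<beta> k * (?b' k x - ?b k x))"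
      unfolding sum.distrib[symmetric] by (intro sum.cong) (auto simp: algebra_simps)
    finally have eq: "spline_fun j H M c \<beta>' \<alpha>' x - spline_fun j H M c \<beta> \<alpha> x =
       (\<beta>' 0 - \<beta> 0) + ((\<Sum>k=1..n. (\<beta>' k - \<beta> k) * ?b' k x) + (\<Sum>k=1..n. \<beta> k * (?b' k x - ?b k x)))" .
    have "\<bar>\<Sum>k=1..n. (\<beta>' k - \<beta> k) * ?b' k x\<bar> \<le> (\<Sum>k=1..n. d * (2 ^ j * (K + 1)))"
      by (rule order_trans[OF sum_abs], rule sum_mono, unfold abs_mult, rule mult_mono)
         (use b b1 d(1) in \<open>auto intro: less_imp_le\<close>)
    also have "\<dots> = real n * (2 ^ j * (K + 1)) * d" by simp
    finally have 1: "\<bar>\<Sum>k=1..n. (\<beta>' k - \<beta> k) * ?b' k x\<bar> \<le> real n * (2 ^ j * (K + 1)) * d" .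
    have "\<bar>\<Sum>k=1..n. \<beta> k * (?b' k x - ?b k x)\<bar> \<le> (\<Sum>k=1..n. \<bar>\<beta> k\<bar> * (2 ^ j * \<eta>'))"
      by (rule order_trans[OF sum_abs], rule sum_mono, unfold abs_mult, rule mult_left_mono) (use b2 in auto)
    also have "\<dots> = B * (2 ^ j * \<eta>')" by (simp add: B_def sum_distrib_right)
    also have "\<dots> \<le> 2 ^ j * (B + 1) * \<eta>'" using \<eta>'(1) by (simp add: algebra_simps)
    finally have 2: "\<bar>\<Sum>k=1..n. \<beta> k * (?b' k x - ?b k x)\<bar> \<le> \<eta> / 3" using \<eta>'(3) by linarith
    have "\<bar>\<beta>' 0 - \<beta> 0\<bar> + real n * (2 ^ j * (K + 1)) * d \<le> R * d" using b[of 0] by (simp add: R_def distrib_right)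
    then have "\<bar>\<beta>' 0 - \<beta> 0\<bar> + real n * (2 ^ j * (K + 1)) * d \<le> \<eta> / 3" using d(3) by linarith
    then show "\<bar>spline_fun j H M c \<beta>' \<alpha>' x - spline_fun j H M c \<beta> \<alpha> x\<bar> \<le> \<eta>"
      unfolding eq using 1 2 \<open>\<eta> > 0\<close> by linarith
  qed
qed

section \<open>Sign changes of the derivative\<close>

text \<open>f rises to the right of p and is larger just left of q, so the maximum over [p, q] sits
  at neither end.\<close>

lemma interior_max_between:
  fixes f f' :: "real \<Rightarrow> real"
  assumes der: "\<And>x. x \<in> {0..1} \<Longrightarrow> (f has_real_derivative f' x) (at x within {0..1})"
    and pq: "0 < p" "p < q" "q < 1" and "f' p > 0" "f' q < 0"
  shows "\<exists>m. p < m \<and> m < q \<and> is_loc_max f m"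
proof -
  have "continuous_on {0..1} f" using der by (intro DERIV_continuous_on) auto
  then have "continuous_on {p..q} f" using pq by (elim continuous_on_subset) auto
  then obtain m where m: "m \<in> {p..q}" "\<And>y. y \<in> {p..q} \<Longrightarrow> f y \<le> f m"
    using continuous_attains_sup[of "{p..q}" f] pq by auto
  obtain d where d: "d > 0" "\<And>h. h > 0 \<Longrightarrow> p + h \<in> {0..1} \<Longrightarrow> h < d \<Longrightarrow> f p < f (p + h)"
    using has_real_derivative_pos_inc_right[OF der[of p] \<open>f' p > 0\<close>] pq by auto
  have "m \<noteq> p"
  proof
    assume "m = p"
    define h where "h = min (d / 2) (q - p)"
    have h: "h > 0" "h < d" "h \<le> q - p" using d(1) pq by (auto simp: h_def)
    then have "f p < f (p + h)" using pq by (intro d(2)) auto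
    moreover have "f (p + h) \<le> f m" using h by (intro m(2)) auto
    ultimately show False using \<open>m = p\<close> by simp
  qed
  obtain d' where d': "d' > 0" "\<And>h. h > 0 \<Longrightarrow> q - h \<in> {0..1} \<Longrightarrow> h < d' \<Longrightarrow> f q < f (q - h)"
    using has_real_derivative_neg_dec_left[OF der[of q] \<open>f' q < 0\<close>] pq by auto
  have "m \<noteq> q"
  proof
    assume "m = q"
    define h where "h = min (d' / 2) (q - p)"
    have h: "h > 0" "h < d'" "h \<le> q - p" using d'(1) pq by (auto simp: h_def)
    then have "f q < f (q - h)" using pq by (intro d'(2)) auto
    moreover have "f (q - h) \<le> f m" using h by (intro m(2)) auto
    ultimately show False using \<open>m = q\<close> by simp
  qed
  have mm: "p < m" "m < q" using m(1) \<open>m \<noteq> p\<close> \<open>m \<noteq> q\<close> by auto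
  have "is_loc_max f m"
    unfolding is_loc_max_def
  proof (intro exI[of _ "min (m - p) (q - m)"] conjI allI impI)
    show "0 < min (m - p) (q - m)" using mm by simp
    fix y assume "\<bar>y - m\<bar> < min (m - p) (q - m)"
    then have "\<bar>y - m\<bar> < m - p" "\<bar>y - m\<bar> < q - m" by simp_all
    then have "y \<in> {p..q}" unfolding atLeastAtMost_iff by linarith
    then show "f y \<le> f m" by (rule m(2))
  qed
  then show ?thesis using mm by blast
qed

lemma is_loc_min_uminus: "is_loc_min (\<lambda>x. - f x) x \<longleftrightarrow> is_loc_max f x"
  and is_loc_max_uminus: "is_loc_max (\<lambda>x. - f x) x \<longleftrightarrow> is_loc_min f x"
  by (auto simp: is_loc_max_def is_loc_min_def)

lemma interior_extrema_uminus: "interior_extrema (\<lambda>x. - f x) = interior_extrema f"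
  by (auto simp: interior_extrema_def is_loc_min_uminus is_loc_max_uminus)

lemma C1_on01_uminus: "C1_on01 f \<Longrightarrow> C1_on01 (\<lambda>x. - f x)"
  unfolding C1_on01_def by (metis (mono_tags, lifting) DERIV_minus continuous_on_minus)

lemma F_minus_uminus: "f \<in> F_minus H \<Longrightarrow> (\<lambda>x. - f x) \<in> F_plus H"
  by (auto simp: F_minus_def F_plus_def F_G_def C1_on01_uminus interior_extrema_uminus is_loc_max_uminus)

text \<open>If f' took both signs on C, a maximum or a minimum would lie between, depending on which
  sign comes first.\<close>

lemma derivative_sign_off_extrema:
  fixes f f' :: "real \<Rightarrow> real"
  assumes der: "\<And>x. x \<in> {0..1} \<Longrightarrow> (f has_real_derivative f' x) (at x within {0..1})"
    and C: "is_interval C" "C \<subseteq> {0<..<1}" "C \<inter> interior_extrema f = {}"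
  shows "(\<forall>x\<in>C. f' x \<ge> 0) \<or> (\<forall>x\<in>C. f' x \<le> 0)"
proof (rule ccontr)
  assume "\<not> ?thesis"
  then obtain p q where pq: "p \<in> C" "f' p > 0" "q \<in> C" "f' q < 0" by (auto simp: not_le)
  then have p01: "0 < p" "p < 1" "0 < q" "q < 1" using C(2) by auto
  have "p \<noteq> q" using pq by auto
  then consider "p < q" | "q < p" by linarith
  then show False
  proof cases
    case 1
    obtain m where m: "p < m" "m < q" "is_loc_max f m"
      using interior_max_between[OF der p01(1) 1 p01(4) pq(2,4)] by blast
    then have "m \<in> C" using mem_is_interval_1_I[OF C(1) pq(1,3), of m] by simp
    moreover have "m \<in> interior_extrema f" using m p01 by (auto simp: interior_extrema_def)
    ultimately show False using C(3) by blast
  next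
    case 2
    have "\<exists>m. q < m \<and> m < p \<and> is_loc_max (\<lambda>x. - f x) m"
      by (rule interior_max_between[where f' = "\<lambda>x. - f' x"]) (use p01 2 pq in \<open>auto intro!: DERIV_minus der\<close>)
    then obtain m where m: "q < m" "m < p" "is_loc_min f m" by (auto simp: is_loc_max_uminus)
    then have "m \<in> C" using mem_is_interval_1_I[OF C(1) pq(3,1), of m] by simp
    moreover have "m \<in> interior_extrema f" using m p01 by (auto simp: interior_extrema_def)
    ultimately show False using C(3) by blast
  qed
qed

text \<open>Induction on the largest point: it joins \<open>R\<close> when the sign on its right is
  not the one found on its left. Since s describes the sign of g beyond all points, a new root flips
  s, and the negative factor it has on the left undoes the flip there.\<close>

lemma sign_pattern:
  fixes g :: "real \<Rightarrow> real"
  assumes "finite E" "E \<subseteq> {0<..<r}"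
    "\<And>C. is_interval C \<Longrightarrow> C \<subseteq> {0<..<r} \<Longrightarrow> C \<inter> E = {} \<Longrightarrow> (\<forall>x\<in>C. g x \<ge> 0) \<or> (\<forall>x\<in>C. g x \<le> 0)"
  shows "\<exists>R s. R \<subseteq> E \<and> (s = 1 \<or> s = -1) \<and> (\<forall>x\<in>{0<..<r} - E. s * (\<Prod>e\<in>R. x - e) * g x \<ge> 0)"
  using assms
proof (induction E arbitrary: r rule: finite_linorder_max_induct)
  case empty
  have "(\<forall>x\<in>{0<..<r}. g x \<ge> 0) \<or> (\<forall>x\<in>{0<..<r}. g x \<le> 0)"
    by (rule empty.prems) (auto simp: is_interval_1)
  then show ?case
  proof
    assume "\<forall>x\<in>{0<..<r}. g x \<ge> 0"
    then show ?thesis by (intro exI[of _ "{}"] exI[of _ 1]) auto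
  next
    assume "\<forall>x\<in>{0<..<r}. g x \<le> 0"
    then show ?thesis by (intro exI[of _ "{}"] exI[of _ "-1"]) auto
  qed
next
  case (insert m A)
  have m: "0 < m" "m < r" using insert.prems(1) by auto
  have "\<exists>R s. R \<subseteq> A \<and> (s = 1 \<or> s = -1) \<and> (\<forall>x\<in>{0<..<m} - A. s * (\<Prod>e\<in>R. x - e) * g x \<ge> 0)"
  proof (rule insert.IH)
    show "A \<subseteq> {0<..<m}" using insert.prems(1) insert.hyps(2) by auto
    fix C assume "is_interval C" "C \<subseteq> {0<..<m}" "C \<inter> A = {}"
    then show "(\<forall>x\<in>C. g x \<ge> 0) \<or> (\<forall>x\<in>C. g x \<le> 0)"
      using m by (intro insert.prems(2)) auto
  qed
  then obtain R s where R: "R \<subseteq> A" "s = 1 \<or> s = -1"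
    and left: "\<And>x. x \<in> {0<..<m} - A \<Longrightarrow> s * (\<Prod>e\<in>R. x - e) * g x \<ge> 0" by blast
  have "(\<forall>x\<in>{m<..<r}. g x \<ge> 0) \<or> (\<forall>x\<in>{m<..<r}. g x \<le> 0)"
    by (rule insert.prems(2)) (use m insert.hyps(2) in \<open>auto simp: is_interval_1\<close>)
  then obtain s2 :: real where s2: "s2 = 1 \<or> s2 = -1" "\<And>x. x \<in> {m<..<r} \<Longrightarrow> s2 * g x \<ge> 0"
    by (elim disjE) (force, metis mult_minus1 neg_0_le_iff_le)
  have finR: "finite R" and mR: "m \<notin> R" using R(1) insert.hyps by (auto intro: finite_subset)
  have Rpos: "(\<Prod>e\<in>R. x - e) > 0" if "x > m" for x
    using that R(1) insert.hyps(2) by (intro prod_pos) force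
  show ?case
  proof (cases "s2 = s")
    case True
    have "s * (\<Prod>e\<in>R. x - e) * g x \<ge> 0" if "x \<in> {0<..<r} - insert m A" for x
    proof (cases "x < m")
      case False
      then have "(\<Prod>e\<in>R. x - e) * (s2 * g x) \<ge> 0" using that by (intro mult_nonneg_nonneg[OF less_imp_le[OF Rpos] s2(2)]) auto
      then show ?thesis using True by (simp add: mult_ac)
    qed (use left that in auto)
    then show ?thesis using R by (intro exI[of _ R] exI[of _ s]) auto
  next
    case False
    then have s: "s = - s2" using R(2) s2(1) by auto
    have "s2 * (\<Prod>e\<in>insert m R. x - e) * g x \<ge> 0" if "x \<in> {0<..<r} - insert m A" for x
    proof (cases "x < m")
      case True
      then have "(m - x) * (s * (\<Prod>e\<in>R. x - e) * g x) \<ge> 0" using that by (intro mult_nonneg_nonneg[OF _ left]) auto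
      then show ?thesis using finR mR by (simp add: s algebra_simps)
    next
      case False
      then have "(x - m) * ((\<Prod>e\<in>R. x - e) * (s2 * g x)) \<ge> 0" using that
        by (intro mult_nonneg_nonneg[OF _ mult_nonneg_nonneg[OF less_imp_le[OF Rpos] s2(2)]]) auto
      then show ?thesis using finR mR by (simp add: mult_ac)
    qed
    then show ?thesis using R s2 by (intro exI[of _ "insert m R"] exI[of _ s2]) auto
  qed
qed

text \<open>Otherwise f is nonincreasing up to its first extremum e, and the local maximum at e
  forces f to be constant just left of e. Every point there would be an earlier local
  maximum.\<close>

lemma leading_maximum_sign:
  fixes f f' :: "real \<Rightarrow> real"
  assumes der: "\<And>x. x \<in> {0..1} \<Longrightarrow> (f has_real_derivative f' x) (at x within {0..1})"
    and fin: "finite (interior_extrema f)" "interior_extrema f \<noteq> {}"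
    and lmax: "is_loc_max f (Min (interior_extrema f))"
  shows "\<exists>x. 0 < x \<and> x < Min (interior_extrema f) \<and> f' x > 0"
proof (rule ccontr)
  define e where "e = Min (interior_extrema f)"
  assume "\<not> ?thesis"
  then have neg: "f' x \<le> 0" if "0 < x" "x < e" for x
    using that unfolding e_def by (meson not_less)
  have "e \<in> interior_extrema f" unfolding e_def using fin by (rule Min_in)
  then have e: "0 < e" "e < 1" by (auto simp: interior_extrema_def)
  obtain d where d: "d > 0" "\<And>y. \<bar>y - e\<bar> < d \<Longrightarrow> f y \<le> f e" using lmax by (auto simp: is_loc_max_def e_def)
  define a where "a = max 0 (e - d)"
  have a: "0 \<le> a" "a < e" using d e by (auto simp: a_def)
  have const: "f y = f e" if y: "a < y" "y < e" for y
  proof -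
    have "\<exists>z. y < z \<and> z < e \<and> f e - f y = (e - y) * f' z"
    proof (rule MVT2[OF y(2)])
      fix z assume "y \<le> z" "z \<le> e"
      then have z: "0 < z" "z < 1" using y a e by auto
      then have "at z within {0..1} = at z" by (intro at_within_interior) auto
      then show "(f has_real_derivative f' z) (at z)" using der[of z] z by auto
    qed
    then obtain z where z: "y < z" "z < e" "f e - f y = (e - y) * f' z" by blast
    have "(e - y) * f' z \<le> 0" using neg[of z] z y a by (intro mult_nonneg_nonpos) auto
    moreover have "f y \<le> f e" using y by (intro d(2)) (auto simp: a_def)
    ultimately show ?thesis using z by simp
  qed
  define y where "y = (a + e) / 2"
  have y: "a < y" "y < e" using a by (auto simp: y_def)
  have "is_loc_max f y" unfolding is_loc_max_def
  proof (intro exI[of _ "min (y - a) (e - y)"] conjI allI impI)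
    show "0 < min (y - a) (e - y)" using y by simp
    fix z assume "\<bar>z - y\<bar> < min (y - a) (e - y)"
    then have "\<bar>z - y\<bar> < y - a" "\<bar>z - y\<bar> < e - y" by simp_all
    then have "a < z" "z < e" by linarith+
    then show "f z \<le> f y" using const y by simp
  qed
  then have "y \<in> interior_extrema f" using y a e by (auto simp: interior_extrema_def)
  then have "e \<le> y" unfolding e_def using fin by simp
  then show False using y by simp
qed

lemma prod_nth_eq_prod_list:
  fixes g :: "'a \<Rightarrow> 'b :: comm_monoid_mult"
  shows "(\<Prod>h<length xs. g (xs ! h)) = prod_list (map g xs)"
  by (induction xs) (simp_all add: prod.lessThan_Suc_shift del: prod.lessThan_Suc)

text \<open>On (0, 1) a root at 0 contributes a positive factor and a root at 1 a negative one. With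
  a spare root the sign s can thus be adapted to M; with all H roots in use s must already equal
  M.\<close>

lemma root_choice:
  fixes g :: "real \<Rightarrow> real"
  assumes R: "finite R" "R \<subseteq> {0..1}" "card R < H \<or> (card R = H \<and> s = M)"
    and s: "s = 1 \<or> s = -1" and M: "M = -1 \<or> M = 1"
    and sign: "\<And>x. x \<in> {0<..<1} - E \<Longrightarrow> s * (\<Prod>e\<in>R. x - e) * g x \<ge> 0"
  obtains \<alpha> :: "nat \<Rightarrow> real" where "\<And>h. \<alpha> h \<in> {0..1}" "\<And>x. x \<in> {0<..<1} - E \<Longrightarrow> M * (\<Prod>h<H. x - \<alpha> h) * g x \<ge> 0"
proof -
  define zs where "zs = (if card R = H then [] else (if s = M then 0 else 1) # replicate (H - card R - 1) (0::real))"
  define xs where "xs = sorted_list_of_set R @ zs"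
  have len: "length xs = H" using R by (auto simp: xs_def zs_def)
  have set: "set xs \<subseteq> {0..1}" using R by (auto simp: xs_def zs_def)
  define \<alpha> where "\<alpha> h = (if h < H then xs ! h else 0)" for h
  have prod: "(\<Prod>h<H. x - \<alpha> h) = (\<Prod>e\<in>R. x - e) * prod_list (map (\<lambda>e. x - e) zs)" for x
  proof -
    have "(\<Prod>h<H. x - \<alpha> h) = prod_list (map (\<lambda>e. x - e) xs)"
      unfolding prod_nth_eq_prod_list[symmetric] len by (intro prod.cong) (auto simp: \<alpha>_def)
    moreover have "prod_list (map (\<lambda>e. x - e) (sorted_list_of_set R)) = (\<Prod>e\<in>R. x - e)"
      using prod.distinct_set_conv_list[of "sorted_list_of_set R" "\<lambda>e. x - e"] R(1) by simp
    ultimately show ?thesis by (simp add: xs_def)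
  qed
  show ?thesis
  proof (rule that[of \<alpha>])
    show "\<alpha> h \<in> {0..1}" for h
      using set len nth_mem[of h xs] by (auto simp: \<alpha>_def subset_iff)
    fix x assume x: "x \<in> {0<..<1} - E"
    define w where "w = M * s * prod_list (map (\<lambda>e. x - e) zs)"
    have "w \<ge> 0"
    proof (cases "card R = H")
      case True
      then show ?thesis using R(3) s by (auto simp: w_def zs_def)
    next
      case False
      have "w = (if s = M then x else 1 - x) * x ^ (H - card R - 1)"
        using s M False by (auto simp: w_def zs_def prod_list_replicate)
      then show ?thesis using x by auto
    qed
    then have "w * (s * (\<Prod>e\<in>R. x - e) * g x) \<ge> 0" using sign[OF x] by (rule mult_nonneg_nonneg)
    moreover have "w * (s * (\<Prod>e\<in>R. x - e) * g x) = (s * s) * (M * (\<Prod>h<H. x - \<alpha> h) * g x)"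
      by (simp add: w_def prod mult_ac)
    moreover have "s * s = 1" using s by auto
    ultimately show "M * (\<Prod>h<H. x - \<alpha> h) * g x \<ge> 0" by simp
  qed
qed

text \<open>The parity condition says \<open>M = (-1) ^ H\<close>. It is called upon when all H
  extrema are sign changes: left of the first one f' is positive somewhere, while the product of the
  H factors has sign \<open>(-1) ^ H\<close>, and this forces s = M.\<close>

lemma compatible_roots_plus:
  assumes "H \<ge> 1" and M: "M = -1 \<or> M = (1::real)"
    and f: "f \<in> F_G (H - 1) \<or> (f \<in> F_plus H \<and> ((odd H \<and> M < 0) \<or> (even H \<and> M > 0)))"
    and der: "\<And>x. x \<in> {0..1} \<Longrightarrow> (f has_real_derivative f' x) (at x within {0..1})"
  obtains \<alpha> :: "nat \<Rightarrow> real" where "\<And>h. \<alpha> h \<in> {0..1}"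
    "\<And>x. x \<in> {0<..<1} - interior_extrema f \<Longrightarrow> M * (\<Prod>h<H. x - \<alpha> h) * f' x \<ge> 0"
proof -
  let ?E = "interior_extrema f"
  have fin: "finite ?E" and cE: "card ?E \<le> H - 1 \<or> (card ?E = H \<and> is_loc_max f (Min ?E) \<and> M = (-1) ^ H)"
    using f M \<open>H \<ge> 1\<close> by (auto simp: F_G_def F_plus_def)
  have E01: "?E \<subseteq> {0<..<1}" by (auto simp: interior_extrema_def)
  obtain R s where R: "R \<subseteq> ?E" and s: "s = 1 \<or> s = (-1::real)"
    and sign: "\<And>x. x \<in> {0<..<1} - ?E \<Longrightarrow> s * (\<Prod>e\<in>R. x - e) * f' x \<ge> 0"
    using sign_pattern[OF fin E01 derivative_sign_off_extrema[OF der]] by blast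
  have finR: "finite R" using R fin by (rule finite_subset)
  have cR: "card R \<le> card ?E" using R fin by (simp add: card_mono)
  have "card R < H \<or> (card R = H \<and> s = M)"
  proof (cases "card R < H")
    case False
    then have "\<not> card ?E \<le> H - 1" using cR \<open>H \<ge> 1\<close> by linarith
    then have cE': "card ?E = H" and lm: "is_loc_max f (Min ?E)" and MH: "M = (-1) ^ H" using cE by blast+
    have card: "card ?E = H" "card R = H" using cE' cR False by linarith+
    have RE: "R = ?E" using R fin card by (simp add: card_subset_eq)
    have ne: "?E \<noteq> {}" using card \<open>H \<ge> 1\<close> by auto
    obtain x where x: "0 < x" "x < Min ?E" "f' x > 0"
      using leading_maximum_sign[OF der fin ne lm] by blast
    have lt: "x < e" if "e \<in> ?E" for e using x(2) Min_le[OF fin that] by linarith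
    have xE: "x \<in> {0<..<1} - ?E" using x lt E01 ne by fastforce
    have "(\<Prod>e\<in>?E. x - e) = (\<Prod>e\<in>?E. (-1) * (e - x))" by (intro prod.cong) auto
    also have "\<dots> = (-1) ^ H * (\<Prod>e\<in>?E. e - x)" unfolding prod.distrib by (simp add: card)
    finally have "s * M * ((\<Prod>e\<in>?E. e - x) * f' x) \<ge> 0"
      using sign[OF xE] by (simp add: RE MH mult_ac)
    moreover have "(\<Prod>e\<in>?E. e - x) * f' x > 0" using x lt by (intro mult_pos_pos prod_pos) auto
    ultimately have "s * M \<ge> 0" by (simp add: zero_le_mult_iff)
    then show ?thesis using s M card by auto
  qed simp
  moreover have "R \<subseteq> {0..1}" using R E01 by (auto simp: subset_iff less_imp_le)
  ultimately obtain \<alpha> :: "nat \<Rightarrow> real" where "\<And>h. \<alpha> h \<in> {0..1}"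
    "\<And>x. x \<in> {0<..<1} - ?E \<Longrightarrow> M * (\<Prod>h<H. x - \<alpha> h) * f' x \<ge> 0"
    using root_choice[OF finR _ _ s M sign] by blast
  then show ?thesis by (rule that)
qed

text \<open>The minimum case is the maximum case for -f and -M; extrema and roots stay the
  same.\<close>

lemma compatible_roots:
  assumes "H \<ge> 1" and M: "M = -1 \<or> M = (1::real)"
    and f: "f \<in> F_G (H - 1)
         \<or> (f \<in> F_plus H \<and> ((odd H \<and> M < 0) \<or> (even H \<and> M > 0)))
         \<or> (f \<in> F_minus H \<and> ((odd H \<and> M > 0) \<or> (even H \<and> M < 0)))"
    and der: "\<And>x. x \<in> {0..1} \<Longrightarrow> (f has_real_derivative f' x) (at x within {0..1})"
  obtains \<alpha> :: "nat \<Rightarrow> real" where "\<And>h. \<alpha> h \<in> {0..1}"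
    "\<And>x. x \<in> {0<..<1} - interior_extrema f \<Longrightarrow> M * (\<Prod>h<H. x - \<alpha> h) * f' x \<ge> 0"
proof (cases "f \<in> F_G (H - 1) \<or> (f \<in> F_plus H \<and> ((odd H \<and> M < 0) \<or> (even H \<and> M > 0)))")
  case True
  from compatible_roots_plus[OF assms(1) M True der] that show ?thesis by blast
next
  case False
  then have *: "f \<in> F_minus H" "odd H \<and> M > 0 \<or> even H \<and> M < 0" using f by auto
  obtain \<alpha> :: "nat \<Rightarrow> real" where \<alpha>: "\<And>h. \<alpha> h \<in> {0..1}"
    "\<And>x. x \<in> {0<..<1} - interior_extrema (\<lambda>x. - f x) \<Longrightarrow> (- M) * (\<Prod>h<H. x - \<alpha> h) * (- f' x) \<ge> 0"
  proof (rule compatible_roots_plus[of H "- M" "\<lambda>x. - f x" "\<lambda>x. - f' x"])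
    show "(\<lambda>x. - f x) \<in> F_G (H - 1) \<or> (\<lambda>x. - f x) \<in> F_plus H \<and> (odd H \<and> - M < 0 \<or> even H \<and> 0 < - M)"
      using F_minus_uminus[OF *(1)] *(2) by auto
  qed (use assms in \<open>auto intro!: DERIV_minus\<close>)
  then show ?thesis using that[of \<alpha>] by (simp add: interior_extrema_uminus)
qed

text \<open>The mean value theorem gives a point z where f' has the sign of f v - f u, and
  continuity keeps that sign just right of z. Before the next root or point of E the compatible
  product is nonzero, hence strictly positive.\<close>

lemma local_sign_agreement:
  fixes \<alpha> :: "nat \<Rightarrow> real"
  assumes cont: "continuous_on {0..1} f'"
    and der: "\<And>x. x \<in> {0..1} \<Longrightarrow> (f has_real_derivative f' x) (at x within {0..1})"
    and "finite E"
    and nonneg: "\<And>x. x \<in> {0<..<1} - E \<Longrightarrow> M * (\<Prod>h<H. x - \<alpha> h) * f' x \<ge> 0" and "M \<noteq> (0::real)"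
    and uv: "0 \<le> u" "u < v" "v \<le> 1" "f u \<noteq> f v"
  shows "\<exists>p q. u \<le> p \<and> p < q \<and> q \<le> v \<and> (\<forall>z. p < z \<and> z < q \<longrightarrow> M * (\<Prod>h<H. z - \<alpha> h) * (f v - f u) > 0)"
proof -
  have cf: "continuous_on {0..1} f" using der by (intro DERIV_continuous_on) auto
  have at: "at z within {0..1} = at z" if "0 < z" "z < 1" for z :: real
    using that by (intro at_within_interior) auto
  have "\<exists>z. u < z \<and> z < v \<and> f v - f u = (v - u) * f' z"
  proof -
    have "continuous_on {u..v} f" using cf uv by (elim continuous_on_subset) auto
    then show ?thesis
    proof (rule mvt[OF uv(2), where f' = "\<lambda>z h. f' z * h"])
      fix z assume "u < z" "z < v"
      then show "(f has_derivative (\<lambda>h. f' z * h)) (at z)"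
        using der[of z] at[of z] uv by (auto simp: has_field_derivative_def)
    qed (auto simp: mult.commute)
  qed
  then obtain z where z: "u < z" "z < v" "f v - f u = (v - u) * f' z" by blast
  define \<Delta> where "\<Delta> = f v - f u"
  have "f' z \<noteq> 0" using z uv by auto
  then have "f' z * f' z > 0" using not_real_square_gt_zero by blast
  then have "(v - u) * (f' z * f' z) > 0" using uv by (intro mult_pos_pos[of "v - u"]) simp_all
  then have "\<Delta> * f' z > 0" unfolding \<Delta>_def z(3) by (simp only: mult.assoc)
  have "z \<in> interior {0..1}" using z uv by simp
  then have "isCont f' z" using cont by (intro continuous_on_interior[of "{0..1}"])
  then have "isCont (\<lambda>x. \<Delta> * f' x) z" by (intro continuous_intros)
  then have "\<forall>\<^sub>F x in at z. \<Delta> * f' x > 0" using \<open>\<Delta> * f' z > 0\<close> unfolding isCont_def by (rule order_tendstoD)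
  then obtain d where d: "d > 0" "\<And>x. x \<noteq> z \<Longrightarrow> \<bar>x - z\<bar> < d \<Longrightarrow> \<Delta> * f' x > 0"
    by (auto simp: eventually_at dist_real_def)
  define F where "F = {x \<in> E \<union> \<alpha> ` {..<H}. x > z}"
  have "F \<subseteq> E \<union> \<alpha> ` {..<H}" by (auto simp: F_def)
  then have "finite F" by (rule finite_subset) (simp add: \<open>finite E\<close>)
  define q where "q = Min (insert v (insert (z + d) F))"
  have "q > z" unfolding q_def using \<open>finite F\<close> d z by (auto simp: F_def)
  have q: "q \<le> v" "q \<le> z + d" "\<And>x. x \<in> F \<Longrightarrow> q \<le> x" unfolding q_def by (rule Min_le; use \<open>finite F\<close> in simp)+
  show ?thesis
  proof (rule exI[of _ z], rule exI[of _ q], intro conjI allI impI)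
    fix x assume x: "z < x \<and> x < q"
    then have "x \<notin> F" using q(3) by fastforce
    then have "x \<notin> E" and xa: "x \<noteq> \<alpha> h" if "h < H" for h using x that by (auto simp: F_def)
    moreover have "x \<notin> E" using \<open>x \<notin> F\<close> x by (auto simp: F_def)
    ultimately have nn: "M * (\<Prod>h<H. x - \<alpha> h) * f' x \<ge> 0" using x z uv q by (intro nonneg) auto
    have pos: "\<Delta> * f' x > 0" using x q by (intro d(2)) auto
    have P0: "(\<Prod>h<H. x - \<alpha> h) \<noteq> 0" using xa by auto
    have "M * (\<Prod>h<H. x - \<alpha> h) * f' x \<noteq> 0" using P0 pos \<open>M \<noteq> 0\<close> by auto
    with nn have "M * (\<Prod>h<H. x - \<alpha> h) * f' x > 0" unfolding less_le by metis
    from mult_pos_pos[OF this pos] have "M * (\<Prod>h<H. x - \<alpha> h) * \<Delta> * (f' x * f' x) > 0" by (simp add: mult_ac)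
    moreover have "f' x * f' x > 0" using pos by (auto simp: zero_less_mult_iff)
    ultimately show "M * (\<Prod>h<H. x - \<alpha> h) * (f v - f u) > 0" by (simp add: \<Delta>_def zero_less_mult_iff)
  qed (use z q \<open>q > z\<close> in auto)
qed

section \<open>Support of the prior\<close>

lemma density_interval_pos:
  fixes f :: "real \<Rightarrow> real"
  assumes [measurable]: "f \<in> borel_measurable borel" "A \<in> sets borel"
    and "u < v" "{u<..<v} \<subseteq> A" and pos: "\<And>x. u < x \<Longrightarrow> x < v \<Longrightarrow> f x > 0"
  shows "emeasure (density lborel (\<lambda>x. ennreal (f x))) A > 0"
proof (rule ccontr)
  assume "\<not> ?thesis"
  then have "(\<integral>\<^sup>+ x. ennreal (f x) * indicator A x \<partial>lborel) = 0" by (simp add: emeasure_density)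
  then have "AE x in lborel. ennreal (f x) * indicator A x = 0" by (subst (asm) nn_integral_0_iff_AE) auto
  then have "AE x in lborel. x \<notin> {u<..<v}"
    by eventually_elim (use pos assms(4) in \<open>force simp: ennreal_eq_0_iff\<close>)
  then have "{u<..<v} \<in> null_sets lborel" by (subst AE_iff_null_sets) auto
  then show False using \<open>u < v\<close> by (simp add: null_sets_def)
qed

lemma sets_truncate_to [simp, measurable_cong]: "sets (truncate_to N A) = sets N"
  by (simp add: truncate_to_def)

lemma space_truncate_to [simp]: "space (truncate_to N A) = space N"
  by (simp add: truncate_to_def)

lemma emeasure_truncate_to:
  assumes [measurable]: "A \<in> sets N" "B \<in> sets N"
  shows "emeasure (truncate_to N A) B = emeasure N (A \<inter> B) / emeasure N A"
proof -
  have "emeasure (truncate_to N A) B = (\<integral>\<^sup>+ x. indicator A x / emeasure N A * indicator B x \<partial>N)"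
    unfolding truncate_to_def by (rule emeasure_density) auto
  also have "\<dots> = (\<integral>\<^sup>+ x. indicator (A \<inter> B) x / emeasure N A \<partial>N)"
    by (intro nn_integral_cong) (auto simp: indicator_def)
  also have "\<dots> = emeasure N (A \<inter> B) / emeasure N A" by (subst nn_integral_divide) auto
  finally show ?thesis .
qed

lemma prob_space_truncate_to:
  assumes "A \<in> sets N" "emeasure N A > 0" "emeasure N A < \<infinity>"
  shows "prob_space (truncate_to N A)"
proof
  have "A \<inter> space N = A" using sets.sets_into_space[OF assms(1)] by auto
  then show "emeasure (truncate_to N A) (space (truncate_to N A)) = 1"
    using assms by (simp add: emeasure_truncate_to less_top)
qed

lemma AE_truncate_to:
  assumes [measurable]: "A \<in> sets N"
  shows "AE x in truncate_to N A. x \<in> A"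
  unfolding truncate_to_def by (subst AE_density) (auto simp: indicator_def)

lemma sets_beta_measure [simp, measurable_cong]: "sets (beta_measure v w) = sets borel"
  and sets_gamma_measure [simp, measurable_cong]: "sets (gamma_measure d k) = sets borel"
  and sets_exp_measure [simp, measurable_cong]: "sets (exp_measure l) = sets borel"
  by (simp_all add: beta_measure_def gamma_measure_def exp_measure_def)

lemma space_beta_measure [simp]: "space (beta_measure v w) = UNIV"
  and space_gamma_measure [simp]: "space (gamma_measure d k) = UNIV"
  and space_exp_measure [simp]: "space (exp_measure l) = UNIV"
  by (simp_all add: beta_measure_def gamma_measure_def exp_measure_def)

lemma beta_dens_measurable [measurable]: "beta_dens v w \<in> borel_measurable borel"
  unfolding beta_dens_def[abs_def] by measurable

lemma gamma_dens_measurable [measurable]: "gamma_dens d k \<in> borel_measurable borel"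
  unfolding gamma_dens_def[abs_def] by measurable

lemma prob_space_beta_measure:
  assumes "v > 0" "w > 0"
  shows "prob_space (beta_measure v w)"
proof
  have B: "Beta v w > 0" using assms by (simp add: Beta_def)
  have "((\<lambda>x. (x powr (v - 1) * (1 - x) powr (w - 1)) / Beta v w) has_integral (Beta v w / Beta v w)) {0..1}"
    by (intro has_integral_divide has_integral_Beta_real assms)
  then have *: "((\<lambda>x. (x powr (v - 1) * (1 - x) powr (w - 1)) / Beta v w) has_integral 1) {0..1}" using B by simp
  have "(\<integral>\<^sup>+ x. ennreal (indicator {0..1} x * ((x powr (v - 1) * (1 - x) powr (w - 1)) / Beta v w)) \<partial>lborel) = ennreal 1"
    by (rule nn_integral_has_integral_lebesgue[OF _ *]) (use B in auto)
  moreover have "emeasure (beta_measure v w) UNIV = (\<integral>\<^sup>+ x. ennreal (beta_dens v w x) \<partial>lborel)"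
    unfolding beta_measure_def by (subst emeasure_density) auto
  moreover have "\<dots> = (\<integral>\<^sup>+ x. ennreal (indicator {0..1} x * ((x powr (v - 1) * (1 - x) powr (w - 1)) / Beta v w)) \<partial>lborel)"
    by (intro nn_integral_cong) (auto simp: beta_dens_def indicator_def)
  ultimately show "emeasure (beta_measure v w) (space (beta_measure v w)) = 1" by simp
qed

lemma AE_beta_measure: "AE p in beta_measure v w. 0 < p \<and> p < 1"
  unfolding beta_measure_def by (subst AE_density) (auto simp: beta_dens_def)

lemma prob_space_gamma_measure:
  assumes "d > 0" "k > 0"
  shows "prob_space (gamma_measure d k)"
proof
  have G: "Gamma d > 0" using assms by simp
  define g where "g t = ennreal (indicator {0..} t * t powr (d - 1) / exp t)" for t :: real
  have [measurable]: "g \<in> borel_measurable borel" unfolding g_def by measurable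
  have "ennreal (Gamma d) = (\<integral>\<^sup>+ t. g t \<partial>lborel)" unfolding g_def by (rule Gamma_conv_nn_integral_real) fact
  \<comment> \<open>Scaling by k turns the standard gamma integral into the one with rate k.\<close>
  also have "\<dots> = ennreal k * (\<integral>\<^sup>+ x. g (0 + k * x) \<partial>lborel)"
    using assms by (subst nn_integral_real_affine[where c = k and t = 0]) auto
  finally have *: "ennreal (Gamma d) = ennreal k * (\<integral>\<^sup>+ x. g (k * x) \<partial>lborel)" by simp
  have AE: "AE x in lborel. ennreal (gamma_dens d k x) = ennreal (k / Gamma d) * g (k * x)"
  proof -
    have "AE x in lborel. x \<noteq> (0::real)" by (rule AE_lborel_singleton)
    then show ?thesis
    proof eventually_elim
      case (elim x)
      show ?case
      proof (cases "x > 0")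
        case True
        have "k powr d = k * k powr (d - 1)" using assms by (simp add: powr_mult_base)
        then show ?thesis using True assms G
          by (simp add: gamma_dens_def g_def powr_mult ennreal_mult[symmetric] exp_minus field_simps)
      next
        case False
        then have "k * x < 0" using elim assms by (simp add: mult_pos_neg)
        then show ?thesis using False by (simp add: gamma_dens_def g_def)
      qed
    qed
  qed
  have "emeasure (gamma_measure d k) UNIV = (\<integral>\<^sup>+ x. ennreal (gamma_dens d k x) \<partial>lborel)"
    unfolding gamma_measure_def by (subst emeasure_density) auto
  also have "\<dots> = (\<integral>\<^sup>+ x. ennreal (k / Gamma d) * g (k * x) \<partial>lborel)" by (rule nn_integral_cong_AE[OF AE])
  also have "\<dots> = ennreal (1 / Gamma d) * (ennreal k * (\<integral>\<^sup>+ x. g (k * x) \<partial>lborel))"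
    using assms G by (simp add: nn_integral_cmult mult.assoc[symmetric] ennreal_mult[symmetric])
  also have "\<dots> = ennreal (1 / Gamma d) * ennreal (Gamma d)" by (simp only: *[symmetric])
  also have "\<dots> = 1" using G by (simp add: ennreal_mult[symmetric])
  finally show "emeasure (gamma_measure d k) (space (gamma_measure d k)) = 1" by simp
qed

lemma truncated_gamma_prob_space:
  assumes "d > 0" "k > 0" "eps0 > 0"
  shows "prob_space (truncate_to (gamma_measure d k) {eps0<..})"
proof (rule prob_space_truncate_to)
  interpret prob_space "gamma_measure d k" by (rule prob_space_gamma_measure) fact+
  show "emeasure (gamma_measure d k) {eps0<..} < \<infinity>" using emeasure_finite by (simp add: less_top[symmetric])
  show "emeasure (gamma_measure d k) {eps0<..} > 0"
    unfolding gamma_measure_def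
    by (rule density_interval_pos[of _ _ eps0 "eps0 + 1"]) (use assms in \<open>auto simp: gamma_dens_def\<close>)
qed simp

section \<open>The coefficient prior as a mixture of product measures\<close>

text \<open>For l <= 0 the density formula is nowhere positive and \<open>ennreal\<close> maps it to
  0, so the measure is zero. This default value decides which spike-and-slab factors are
  defective.\<close>

lemma emeasure_exp_measure_UNIV: "emeasure (exp_measure l) UNIV = (if l > 0 then 1 else 0)"
proof (cases "l > 0")
  case True
  interpret prob_space "exp_measure l" unfolding exp_measure_def using True by (rule prob_space_exponential_density)
  show ?thesis using emeasure_space_1 True by simp
next
  case False
  have "emeasure (exp_measure l) UNIV = (\<integral>\<^sup>+ x. ennreal (exponential_density l x) \<partial>lborel)"
    unfolding exp_measure_def by (subst emeasure_density) auto
  also have "\<dots> = nn_integral lborel (\<lambda>x::real. 0)"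
    using False by (intro nn_integral_cong) (auto simp: exponential_density_def ennreal_neg mult_nonpos_nonneg)
  finally show ?thesis using False by simp
qed

text \<open>\<open>bernoulli_pmf\<close> clips its parameter to the unit interval; measurability in
  the hyperparameters calls for a formula valid at every real p.\<close>

abbreviation clip :: "real \<Rightarrow> real" where "clip p \<equiv> min 1 (max 0 p)"

lemma spike_slab_kernel:
  "(\<lambda>z. if z then return borel 0 else exp_measure l) \<in> measurable (measure_pmf q) (subprob_algebra borel)"
proof -
  have "subprob_space (exp_measure l)"
    by (rule subprob_spaceI) (auto simp: emeasure_exp_measure_UNIV)
  then have "exp_measure l \<in> space (subprob_algebra borel)" by (simp add: space_subprob_algebra)
  moreover have "return borel (0::real) \<in> space (subprob_algebra borel)"
    by (simp add: space_subprob_algebra prob_space_return prob_space_imp_subprob_space)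
  ultimately show ?thesis by auto
qed

lemma sets_spike_slab [simp, measurable_cong]: "sets (spike_slab p l) = sets borel"
  unfolding spike_slab_def by (rule sets_bind) auto

lemma space_spike_slab [simp]: "space (spike_slab p l) = UNIV"
  using sets_eq_imp_space_eq[OF sets_spike_slab] by simp

lemma emeasure_spike_slab:
  assumes "A \<in> sets borel"
  shows "emeasure (spike_slab p l) A = ennreal (clip p) * indicator A 0 + ennreal (1 - clip p) * emeasure (exp_measure l) A"
proof -
  have "emeasure (spike_slab p l) A = (\<integral>\<^sup>+ z. emeasure (if z then return borel 0 else exp_measure l) A \<partial>measure_pmf (bernoulli_pmf p))"
    unfolding spike_slab_def by (rule emeasure_bind[OF _ spike_slab_kernel assms]) simp
  also have "\<dots> = (\<Sum>z\<in>UNIV. emeasure (if z then return borel 0 else exp_measure l) A * pmf (bernoulli_pmf p) z)"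
    by (rule nn_integral_measure_pmf_support) auto
  also have "\<dots> = ennreal (clip p) * indicator A 0 + ennreal (1 - clip p) * emeasure (exp_measure l) A"
    using assms by (simp add: UNIV_bool bernoulli_pmf.rep_eq mult.commute add.commute)
  finally show ?thesis .
qed

lemma prob_space_spike_slab: "l > 0 \<or> p \<ge> 1 \<Longrightarrow> prob_space (spike_slab p l)"
  by (rule prob_spaceI) (auto simp: emeasure_spike_slab emeasure_exp_measure_UNIV ennreal_plus[symmetric] simp del: ennreal_plus)

lemma emeasure_exp_measure_measurable:
  assumes [measurable]: "A \<in> sets borel"
  shows "(\<lambda>z. emeasure (exp_measure (snd z)) A) \<in> borel_measurable (borel \<Otimes>\<^sub>M borel)"
proof -
  have "emeasure (exp_measure l) A = (\<integral>\<^sup>+ x. ennreal (exponential_density l x) * indicator A x \<partial>lborel)" for l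
    unfolding exp_measure_def by (rule emeasure_density) auto
  then show ?thesis unfolding exponential_density_def by simp
qed

definition coef_kernel :: "real \<Rightarrow> real \<times> real \<Rightarrow> nat \<Rightarrow> real measure" where
  "coef_kernel c z i = (if i = 0 then normal_measure 0 (sqrt c) else spike_slab (fst z) (snd z))"

lemma sets_coef_kernel [simp, measurable_cong]: "sets (coef_kernel c z i) = sets borel"
  by (simp add: coef_kernel_def)

lemma space_coef_kernel [simp]: "space (coef_kernel c z i) = UNIV"
  by (simp add: coef_kernel_def)

lemma prob_space_coef_kernel:
  "c > 0 \<Longrightarrow> snd z > 0 \<or> fst z \<ge> 1 \<Longrightarrow> prob_space (coef_kernel c z i)"
  by (auto simp: coef_kernel_def prob_space_normal_measure prob_space_spike_slab)

lemma sets_PiM_coef_kernel: "sets (PiM UNIV (coef_kernel c z)) = sets (PiM UNIV (\<lambda>_::nat. borel))"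
  by (rule sets_PiM_cong) auto

text \<open>For \<open>l \<le> 0\<close> and \<open>p < 1\<close> infinitely many factors have mass below 1; the product measure is
  then the junk value 0. This null set of hyperparameters still matters for measurability of the kernel.\<close>
lemma emeasure_PiM_defective:
  fixes M :: "nat \<Rightarrow> 'a measure"
  assumes inf: "infinite {i. emeasure (M i) (space (M i)) \<noteq> 1}"
  shows "emeasure (PiM UNIV M) A = 0"
proof -
  define I where "I = {(J, X). (J \<noteq> {} \<or> (UNIV :: nat set) = {}) \<and> finite J \<and> J \<subseteq> UNIV \<and> X \<in> (\<Pi> j\<in>J. sets (M j))}"
  define G where "G = (\<lambda>(J, X). prod_emb UNIV M J (\<Pi>\<^sub>E j\<in>J. X j))"
  define m where "m = (\<lambda>(J, X). \<Prod>j\<in>J \<union> {i\<in>UNIV. emeasure (M i) (space (M i)) \<noteq> 1}. if j \<in> J then emeasure (M j) (X j) else emeasure (M j) (space (M j)))"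
  define \<Omega> where "\<Omega> = (\<Pi>\<^sub>E i\<in>UNIV. space (M i))"
  \<comment> \<open>A product over an infinite index set is 1 by convention.\<close>
  have m1: "m (J, X) = 1" for J X using inf by (simp add: m_def)
  have "\<not> (\<exists>\<mu>'. (\<forall>i\<in>I. \<mu>' (G i) = m i) \<and> measure_space \<Omega> (sigma_sets \<Omega> (G ` I)) \<mu>')"
  proof
    assume "\<exists>\<mu>'. (\<forall>i\<in>I. \<mu>' (G i) = m i) \<and> measure_space \<Omega> (sigma_sets \<Omega> (G ` I)) \<mu>'"
    then obtain \<mu>' where \<mu>': "\<forall>i\<in>I. \<mu>' (G i) = m i" "measure_space \<Omega> (sigma_sets \<Omega> (G ` I)) \<mu>'" by blast
    \<comment> \<open>An empty cylinder to which the prescription nevertheless assigns mass 1; no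
      measure can satisfy it, so \<open>extend_measure\<close> falls back to the zero
      measure.\<close>
    let ?i = "({0}, \<lambda>_. {}) :: nat set \<times> (nat \<Rightarrow> 'a set)"
    have "?i \<in> I" by (auto simp: I_def)
    moreover have "G ?i = {}" by (auto simp: G_def prod_emb_def PiE_def)
    ultimately have "\<mu>' {} = 1" using \<mu>'(1) m1 by force
    moreover have "\<mu>' {} = 0" using \<mu>'(2) by (simp add: measure_space_def positive_def)
    ultimately show False by simp
  qed
  then have "PiM UNIV M = sigma \<Omega> (G ` I)"
    unfolding PiM_def extend_measure_def I_def[symmetric] G_def[symmetric] m_def[symmetric] \<Omega>_def[symmetric] by (auto simp: if_not_P)
  then show ?thesis by (simp add: emeasure_sigma)
qed

lemma coef_kernel_defective:
  assumes "snd z \<le> 0" "fst z < 1"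
  shows "emeasure (PiM UNIV (coef_kernel c z)) A = 0"
proof (rule emeasure_PiM_defective)
  have "emeasure (coef_kernel c z i) (space (coef_kernel c z i)) \<noteq> 1" if "i \<ge> 1" for i
    using that assms by (auto simp: coef_kernel_def emeasure_spike_slab emeasure_exp_measure_UNIV ennreal_eq_1 min_def max_def)
  then have "{1..} \<subseteq> {i. emeasure (coef_kernel c z i) (space (coef_kernel c z i)) \<noteq> 1}" by auto
  then show "infinite {i. emeasure (coef_kernel c z i) (space (coef_kernel c z i)) \<noteq> 1}"
    using infinite_Ici infinite_super by blast
qed

text \<open>The hyperparameter space is the whole plane, so the kernel must be a subprobability and
  measurable at every z. Where all factors are probability measures the cylinder masses are finite
  products; elsewhere they are 0.\<close>

lemma measurable_coef_kernel:
  assumes c: "c > 0"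
  shows "(\<lambda>z. PiM UNIV (coef_kernel c z)) \<in> measurable (borel \<Otimes>\<^sub>M borel) (subprob_algebra (PiM UNIV (\<lambda>_::nat. borel)))"
proof (rule measurable_subprob_algebra_generated)
  let ?B = "\<lambda>_::nat. borel :: real measure"
  show "sets (PiM UNIV ?B) = sigma_sets (\<Pi>\<^sub>E i\<in>UNIV. space (?B i)) (prod_algebra UNIV ?B)" by (rule sets_PiM)
  show "Int_stable (prod_algebra UNIV ?B)" by (rule Int_stable_prod_algebra)
  show "prod_algebra UNIV ?B \<subseteq> Pow (\<Pi>\<^sub>E i\<in>UNIV. space (?B i))" by (rule prod_algebra_sets_into_space)
  \<comment> \<open>\<open>fst z \<ge> 1\<close> is good even for l <= 0, since the clipped weight
    puts all mass on the spike.\<close>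
  have good: "prob_space (PiM UNIV (coef_kernel c z))" if "snd z > 0 \<or> fst z \<ge> 1" for z
    using that c by (intro prob_space_PiM prob_space_coef_kernel)
  have bad: "emeasure (PiM UNIV (coef_kernel c z)) A = 0" if "\<not> (snd z > 0 \<or> fst z \<ge> 1)" for z A
    using that by (intro coef_kernel_defective) auto
  show "subprob_space (PiM UNIV (coef_kernel c z))" for z
  proof (cases "snd z > 0 \<or> fst z \<ge> 1")
    case True
    then show ?thesis by (intro prob_space_imp_subprob_space good)
  next
    case False
    show ?thesis by (rule subprob_spaceI) (auto simp: bad[OF False] space_PiM)
  qed
  show "sets (PiM UNIV (coef_kernel c z)) = sets (PiM UNIV ?B)" for z by (rule sets_PiM_coef_kernel)
  have cyl: "(\<lambda>z. emeasure (PiM UNIV (coef_kernel c z)) (prod_emb UNIV ?B J (Pi\<^sub>E J E))) \<in> borel_measurable (borel \<Otimes>\<^sub>M borel)"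
    if J: "finite J" and E: "\<And>i. i \<in> J \<Longrightarrow> E i \<in> sets borel" for J E
  proof -
    have eq: "emeasure (PiM UNIV (coef_kernel c z)) (prod_emb UNIV ?B J (Pi\<^sub>E J E)) =
       (if snd z > 0 \<or> fst z \<ge> 1 then \<Prod>i\<in>J. emeasure (coef_kernel c z i) (E i) else 0)" for z
    proof (cases "snd z > 0 \<or> fst z \<ge> 1")
      case True
      have "prod_emb UNIV ?B J (Pi\<^sub>E J E) = prod_emb UNIV (coef_kernel c z) J (Pi\<^sub>E J E)" by (simp add: prod_emb_def)
      then show ?thesis using True J E by (simp add: emeasure_PiM_emb[OF prob_space_coef_kernel[OF c True]])
    next
      case False
      then show ?thesis using bad by simp
    qed
    have [measurable]: "(\<lambda>z. emeasure (coef_kernel c z i) (E i)) \<in> borel_measurable (borel \<Otimes>\<^sub>M borel)" if "i \<in> J" for i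
    proof (cases "i = 0")
      case True
      then show ?thesis by (simp add: coef_kernel_def)
    next
      case False
      note [measurable] = emeasure_exp_measure_measurable[OF E[OF that]]
      show ?thesis using False unfolding coef_kernel_def by (simp add: emeasure_spike_slab[OF E[OF that]])
    qed
    show ?thesis unfolding eq by measurable
  qed
  show "(\<lambda>z. emeasure (PiM UNIV (coef_kernel c z)) A) \<in> borel_measurable (borel \<Otimes>\<^sub>M borel)" if "A \<in> prod_algebra UNIV ?B" for A
    using that by (rule prod_algebraE) (auto intro!: cyl)
  show "(\<lambda>z. emeasure (PiM UNIV (coef_kernel c z)) (\<Pi>\<^sub>E i\<in>UNIV. space (?B i))) \<in> borel_measurable (borel \<Otimes>\<^sub>M borel)"
  proof -
    have eq: "emeasure (PiM UNIV (coef_kernel c z)) (\<Pi>\<^sub>E i\<in>UNIV. space (?B i)) = (if snd z > 0 \<or> fst z \<ge> 1 then 1 else 0)" for z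
      using prob_space.emeasure_space_1[OF good, of z] bad[of z] by (auto simp: space_PiM)
    show ?thesis unfolding eq by measurable
  qed
qed

lemma spike_slab_AE_nonneg: "AE x in spike_slab p l. x \<ge> 0"
proof (rule AE_I')
  have "emeasure (exp_measure l) {..<0} = (\<integral>\<^sup>+ x. ennreal (exponential_density l x) * indicator {..<0} x \<partial>lborel)"
    unfolding exp_measure_def by (rule emeasure_density) auto
  also have "\<dots> = nn_integral lborel (\<lambda>x::real. 0)"
    by (intro nn_integral_cong) (auto simp: exponential_density_def indicator_def)
  finally show "{..<0} \<in> null_sets (spike_slab p l)" by (auto simp: null_sets_def emeasure_spike_slab)
qed (auto simp: not_le)

lemma spike_slab_interval_pos:
  assumes "0 < p" "p < 1" "l > 0" "b \<ge> 0" "r > 0"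
  shows "emeasure (spike_slab p l) {x. \<bar>x - b\<bar> < r} > 0"
proof -
  have S: "{x. \<bar>x - b\<bar> < r} = {b - r<..<b + r}" by auto
  have "emeasure (exp_measure l) {b - r<..<b + r} > 0"
    unfolding exp_measure_def
    by (rule density_interval_pos[of _ _ b "b + r"]) (use assms in \<open>auto simp: exponential_density_def\<close>)
  then have "ennreal (1 - clip p) * emeasure (exp_measure l) {b - r<..<b + r} > 0"
    using assms by (simp add: ennreal_zero_less_mult_iff)
  then show ?thesis unfolding S by (subst emeasure_spike_slab) (auto intro: add_nonneg_pos)
qed

lemma normal_interval_pos:
  assumes "s > 0" "u < v" "{u<..<v} \<subseteq> A" "A \<in> sets borel"
  shows "emeasure (normal_measure \<mu> s) A > 0"
  unfolding normal_measure_def by (rule density_interval_pos[of _ _ u v]) (use assms normal_density_pos in auto)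

definition hyper_prior :: "real \<Rightarrow> real \<Rightarrow> real \<Rightarrow> real \<Rightarrow> real \<Rightarrow> (real \<times> real) measure" where
  "hyper_prior v w d k eps0 = beta_measure v w \<Otimes>\<^sub>M truncate_to (gamma_measure d k) {eps0<..}"

lemma beta_coef_prior_eq:
  "beta_coef_prior c v w d k eps0 = hyper_prior v w d k eps0 \<bind> (\<lambda>z. PiM UNIV (coef_kernel c z))"
  unfolding beta_coef_prior_def hyper_prior_def coef_kernel_def by (simp add: case_prod_unfold)

lemma sets_hyper_prior [measurable_cong]: "sets (hyper_prior v w d k eps0) = sets (borel \<Otimes>\<^sub>M borel)"
  unfolding hyper_prior_def by (rule sets_pair_measure_cong) auto

lemma prob_space_hyper_prior:
  assumes "v > 0" "w > 0" "d > 0" "k > 0" "eps0 > 0"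
  shows "prob_space (hyper_prior v w d k eps0)"
  unfolding hyper_prior_def
  by (intro prob_space_pair prob_space_beta_measure truncated_gamma_prob_space assms)

lemma AE_hyper_prior:
  assumes "v > 0" "w > 0" "d > 0" "k > 0" "eps0 > 0"
  shows "AE z in hyper_prior v w d k eps0. 0 < fst z \<and> fst z < 1 \<and> snd z > 0"
proof -
  let ?G = "truncate_to (gamma_measure d k) {eps0<..}"
  interpret B: prob_space "beta_measure v w" by (intro prob_space_beta_measure assms)
  interpret G: prob_space ?G by (intro truncated_gamma_prob_space assms)
  interpret pair_prob_space "beta_measure v w" ?G ..
  have G: "AE l in ?G. l > 0"
    using AE_truncate_to[of "{eps0<..}" "gamma_measure d k"] by (rule AE_mp) (use assms in auto)
  show ?thesis
    unfolding hyper_prior_def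
  proof (rule AE_pair_measure)
    show "AE x in beta_measure v w. AE y in ?G. 0 < fst (x, y) \<and> fst (x, y) < 1 \<and> snd (x, y) > 0"
      using AE_beta_measure G by (auto elim!: eventually_mono)
  qed measurable
qed

text \<open>Each property passes from almost every kernel to the mixture; for the box, a vanishing
  integral would make the kernel mass vanish almost everywhere. A box constrains the coordinates up
  to n, the ones read by a spline with n B-splines.\<close>

lemma beta_coef_prior_properties:
  assumes c: "c > 0" and h: "v > 0" "w > 0" "d > 0" "k > 0" "eps0 > 0"
  shows sets_beta_coef_prior: "sets (beta_coef_prior c v w d k eps0) = sets (PiM UNIV (\<lambda>_. borel))"
    and prob_space_beta_coef_prior: "prob_space (beta_coef_prior c v w d k eps0)"
    and AE_beta_coef_prior: "AE \<beta> in beta_coef_prior c v w d k eps0. \<forall>i\<ge>1. \<beta> i \<ge> 0"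
    and beta_coef_prior_box_pos: "\<And>\<beta> n r. (\<And>i. i \<ge> 1 \<Longrightarrow> \<beta> i \<ge> 0) \<Longrightarrow> r > 0 \<Longrightarrow>
      emeasure (beta_coef_prior c v w d k eps0) {\<beta>'. \<forall>i\<in>{..n}. \<bar>\<beta>' i - \<beta> i\<bar> < r} > 0"
proof -
  let ?H = "hyper_prior v w d k eps0"
  let ?K = "\<lambda>z. PiM UNIV (coef_kernel c z)"
  interpret H: prob_space ?H by (intro prob_space_hyper_prior h)
  have K: "?K \<in> measurable ?H (subprob_algebra (PiM UNIV (\<lambda>_::nat. borel)))"
    using measurable_coef_kernel[OF c] by (simp add: measurable_cong_sets[OF sets_hyper_prior refl])
  show sets: "sets (beta_coef_prior c v w d k eps0) = sets (PiM UNIV (\<lambda>_. borel))"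
    unfolding beta_coef_prior_eq by (rule sets_bind[OF sets_PiM_coef_kernel H.not_empty])
  have AEK: "AE z in ?H. prob_space (?K z)"
    using AE_hyper_prior[OF h] by eventually_elim (auto intro!: prob_space_PiM prob_space_coef_kernel c)
  show "prob_space (beta_coef_prior c v w d k eps0)"
    unfolding beta_coef_prior_eq by (rule H.prob_space_bind[OF AEK K])
  show "AE \<beta> in beta_coef_prior c v w d k eps0. \<forall>i\<ge>1. \<beta> i \<ge> 0"
    unfolding beta_coef_prior_eq
  proof (subst AE_bind[OF K])
    show "Measurable.pred (PiM UNIV (\<lambda>_. borel)) (\<lambda>\<beta>::nat \<Rightarrow> real. \<forall>i\<ge>1. \<beta> i \<ge> 0)" by measurable
    show "AE z in ?H. AE \<beta> in ?K z. \<forall>i\<ge>1. \<beta> i \<ge> 0"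
      using AE_hyper_prior[OF h]
    proof eventually_elim
      case (elim z)
      have "AE \<beta> in ?K z. i \<ge> 1 \<longrightarrow> \<beta> i \<ge> 0" for i
      proof (cases "i \<ge> 1")
        case True
        have "coef_kernel c z i = spike_slab (fst z) (snd z)" using True by (simp add: coef_kernel_def)
        then have "AE x in coef_kernel c z i. x \<ge> 0" using spike_slab_AE_nonneg by metis
        then have "AE \<beta> in ?K z. \<beta> i \<ge> 0"
          using elim c by (intro AE_PiM_component prob_space_coef_kernel) auto
        then show ?thesis by eventually_elim simp
      qed simp
      then show ?case by (simp add: AE_all_countable)
    qed
  qed
  fix \<beta> :: "nat \<Rightarrow> real" and n r assume \<beta>: "\<And>i. i \<ge> 1 \<Longrightarrow> \<beta> i \<ge> 0" and r: "(r::real) > 0"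
  define X where "X = {\<beta>' :: nat \<Rightarrow> real. \<forall>i\<in>{..n}. \<bar>\<beta>' i - \<beta> i\<bar> < r}"
  have [measurable]: "X \<in> sets (PiM UNIV (\<lambda>_. borel))"
  proof -
    have "{\<beta>' \<in> space (PiM UNIV (\<lambda>_::nat. borel :: real measure)). \<forall>i\<in>{..n}. \<bar>\<beta>' i - \<beta> i\<bar> < r} \<in> sets (PiM UNIV (\<lambda>_. borel))"
      by measurable
    then show ?thesis by (simp add: X_def space_PiM)
  qed
  have Xpos: "AE z in ?H. emeasure (?K z) X > 0"
    using AE_hyper_prior[OF h]
  proof eventually_elim
    case (elim z)
    interpret product_prob_space "coef_kernel c z" UNIV
      using prob_space_coef_kernel[OF c, of z] elim
      by (simp add: product_prob_space_def product_prob_space_axioms_def product_sigma_finite_def prob_space_imp_sigma_finite)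
    have "emeasure (?K z) X = (\<Prod>i\<in>{..n}. emeasure (coef_kernel c z i) {x. \<bar>x - \<beta> i\<bar> < r})"
      using emeasure_PiM_Collect[of "{..n}" "\<lambda>i. {x. \<bar>x - \<beta> i\<bar> < r}"] by (simp add: X_def space_PiM)
    also have "\<dots> > 0"
    proof -
      have "emeasure (coef_kernel c z i) {x. \<bar>x - \<beta> i\<bar> < r} > 0" for i
      proof (cases "i = 0")
        case True
        then show ?thesis using c r
          by (auto simp: coef_kernel_def intro!: normal_interval_pos[of _ "\<beta> 0 - r" "\<beta> 0 + r"])
      next
        case False
        then show ?thesis using elim \<beta>[of i] r by (simp add: coef_kernel_def spike_slab_interval_pos)
      qed
      then show ?thesis by (simp add: zero_less_iff_neq_zero)
    qed
    finally show ?case .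
  qed
  have e: "emeasure (beta_coef_prior c v w d k eps0) X = (\<integral>\<^sup>+ z. emeasure (?K z) X \<partial>?H)"
    unfolding beta_coef_prior_eq by (rule emeasure_bind[OF H.not_empty K]) measurable
  have "emeasure (beta_coef_prior c v w d k eps0) X \<noteq> 0"
  proof
    assume "emeasure (beta_coef_prior c v w d k eps0) X = 0"
    then have "AE z in ?H. emeasure (?K z) X = 0"
      unfolding e by (subst (asm) nn_integral_0_iff_AE) (auto intro: measurable_emeasure_kernel[OF K])
    with Xpos have "AE z in ?H. False" by eventually_elim simp
    then show False using H.AE_False by simp
  qed
  then show "emeasure (beta_coef_prior c v w d k eps0) {\<beta>'. \<forall>i\<in>{..n}. \<bar>\<beta>' i - \<beta> i\<bar> < r} > 0"
    by (simp add: X_def zero_less_iff_neq_zero)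
qed

lemma alpha_prior_properties:
  assumes ab: "a \<le> 0" "b \<ge> 1"
  shows sets_alpha_prior: "sets (alpha_prior a b) = sets (PiM UNIV (\<lambda>_. borel))"
    and prob_space_alpha_prior: "prob_space (alpha_prior a b)"
    and alpha_prior_box_pos: "\<And>\<alpha> n r. (\<And>i. \<alpha> i \<in> {0..1}) \<Longrightarrow> r > 0 \<Longrightarrow>
      emeasure (alpha_prior a b) {\<alpha>'. \<forall>i\<in>{..<n}. \<bar>\<alpha>' i - \<alpha> i\<bar> < r} > 0"
proof -
  let ?N = "normal_measure ((b - a) / 2) 1"
  let ?T = "truncate_to ?N {a..b}"
  interpret N: prob_space ?N by (rule prob_space_normal_measure) simp
  have fin: "emeasure ?N A < \<infinity>" for A using N.emeasure_finite by (simp add: less_top[symmetric])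
  have pos: "emeasure ?N {a..b} > 0" by (rule normal_interval_pos[of _ a b]) (use ab in auto)
  have T: "prob_space ?T" by (rule prob_space_truncate_to) (use pos fin in auto)
  show "sets (alpha_prior a b) = sets (PiM UNIV (\<lambda>_. borel))" unfolding alpha_prior_def by (rule sets_PiM_cong) auto
  show "prob_space (alpha_prior a b)" unfolding alpha_prior_def by (intro prob_space_PiM T)
  fix \<alpha> :: "nat \<Rightarrow> real" and n r assume \<alpha>: "\<And>i. \<alpha> i \<in> {0..1}" and r: "(r::real) > 0"
  interpret product_prob_space "\<lambda>_. ?T" UNIV
    using T by (simp add: product_prob_space_def product_prob_space_axioms_def product_sigma_finite_def prob_space_imp_sigma_finite)
  have "emeasure (alpha_prior a b) {\<alpha>'. \<forall>i\<in>{..<n}. \<bar>\<alpha>' i - \<alpha> i\<bar> < r} = (\<Prod>i\<in>{..<n}. emeasure ?T {x. \<bar>x - \<alpha> i\<bar> < r})"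
    using emeasure_PiM_Collect[of "{..<n}" "\<lambda>i. {x. \<bar>x - \<alpha> i\<bar> < r}"] unfolding alpha_prior_def by (simp add: space_PiM)
  also have "\<dots> > 0"
  proof -
    have "emeasure ?T {x. \<bar>x - \<alpha> i\<bar> < r} > 0" for i
    proof -
      have "emeasure ?N ({a..b} \<inter> {x. \<bar>x - \<alpha> i\<bar> < r}) > 0"
      proof (rule normal_interval_pos)
        \<comment> \<open>A root prescribed at 0 or 1 may be an end of [a, b]; a one-sided
          neighbourhood then remains.\<close>
        show "max a (\<alpha> i - r) < min b (\<alpha> i + r)" using \<alpha>[of i] ab r by auto
      qed (auto simp: abs_less_iff)
      then show ?thesis using fin by (simp add: emeasure_truncate_to ennreal_zero_less_divide less_top)
    qed
    then show ?thesis by (simp add: zero_less_iff_neq_zero)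
  qed
  finally show "emeasure (alpha_prior a b) {\<alpha>'. \<forall>i\<in>{..<n}. \<bar>\<alpha>' i - \<alpha> i\<bar> < r} > 0" .
qed

section \<open>The event that the knots form a full dyadic grid\<close>

text \<open>If all coins at depths 1 to D succeed and all at depth D + 1 fail, nothing deeper can
  exist, so finitely many coins determine the tree. Labels below \<open>2 ^ (D + 2)\<close> cover
  every node up to depth D + 1.\<close>

lemma full_tree_nodes:
  assumes on: "\<And>m a. 1 \<le> m \<Longrightarrow> m \<le> D \<Longrightarrow> a < 2 ^ (D + 2) \<Longrightarrow> c (m, a)"
    and off: "\<And>a. a < 2 ^ (D + 2) \<Longrightarrow> \<not> c (D + 1, a)"
  shows "node_exists c N a \<longleftrightarrow> N \<le> D \<and> odd a \<and> a < 2 ^ (N + 1)"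
proof (induction N arbitrary: a)
  case 0
  then show ?case by (cases "a = 0 \<or> a = 1") auto
next
  case (Suc N)
  show ?case
  proof (cases "Suc N \<le> D")
    case True
    have "\<exists>a'. odd a' \<and> (a + 1 = 2 * a' \<or> a = 2 * a' + 1) \<and> node_exists c N a'" if "odd a" "a < 2 ^ (Suc N + 1)"
    proof -
      \<comment> \<open>The parent of a = 2 b + 1 is the odd one among b and b + 1.\<close>
      obtain b where b: "a = 2 * b + 1" using \<open>odd a\<close> by (elim oddE)
      then have b2: "b < 2 ^ (N + 1)" using that(2) by simp
      show ?thesis
      proof (cases "odd b")
        case True
        then show ?thesis using b b2 Suc.IH[of b] \<open>Suc N \<le> D\<close> by (intro exI[of _ b]) auto
      next
        case False
        then have "b + 1 \<noteq> 2 ^ (N + 1)" by (metis even_add even_power even_two_times_div_two add_is_0 even_numeral odd_one zero_neq_one add_gr_0 less_one)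
        then have "b + 1 < 2 ^ (N + 1)" using b2 by linarith
        then show ?thesis using b False Suc.IH[of "b + 1"] \<open>Suc N \<le> D\<close> by (intro exI[of _ "b + 1"]) auto
      qed
    qed
    moreover have "c (Suc N, a)" if "a < 2 ^ (Suc N + 1)"
    proof (rule on)
      have "(2::nat) ^ (Suc N + 1) \<le> 2 ^ (D + 2)" using True by (intro power_increasing) auto
      then show "a < 2 ^ (D + 2)" using that by linarith
    qed (use True in auto)
    moreover have "node_exists c (Suc N) a \<Longrightarrow> odd a \<and> a < 2 ^ (Suc N + 1)" by (rule node_exists_range)
    ultimately show ?thesis using True by auto
  next
    case False
    have "\<not> node_exists c (Suc N) a"
    proof
      assume n: "node_exists c (Suc N) a"
      then obtain a' where "node_exists c N a'" by auto
      then have "N = D" using Suc.IH False by auto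
      moreover have "c (Suc N, a)" using n by simp
      moreover have "a < 2 ^ (Suc N + 1)" using node_exists_range[OF n] by simp
      ultimately show False using off[of a] by simp
    qed
    then show ?thesis using False by simp
  qed
qed

text \<open>Passing to the next depth adds the fractions with odd numerator; those with even
  numerator reduce to the previous grid.\<close>

lemma dyadic_grid:
  "{real a / 2 ^ (N + 1) | N a. N \<le> D \<and> odd a \<and> a < 2 ^ (N + 1)} \<union> {0, 1} = (\<lambda>i. real i / 2 ^ (D + 1)) ` {..2 ^ (D + 1)}"
proof (induction D)
  case 0
  have 1: "{real a / 2 ^ (N + 1) | N a. N \<le> 0 \<and> odd a \<and> a < 2 ^ (N + 1)} = {1/2}"
  proof -
    have odd1: "odd a \<Longrightarrow> a < 2 \<Longrightarrow> a = 1" for a :: nat by presburger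
    show ?thesis
    proof (intro equalityI subsetI)
      fix z :: real assume "z \<in> {real a / 2 ^ (N + 1) | N a. N \<le> 0 \<and> odd a \<and> a < 2 ^ (N + 1)}"
      then obtain N a where "z = real a / 2 ^ (N + 1)" "N \<le> 0" "odd a" "a < 2 ^ (N + 1)" by blast
      moreover from this have "a = 1" by (intro odd1) simp_all
      ultimately show "z \<in> {1/2}" by simp
    next
      fix z :: real assume "z \<in> {1/2}"
      then have "z = real 1 / 2 ^ (0 + 1) \<and> (0::nat) \<le> 0 \<and> odd (1::nat) \<and> 1 < (2::nat) ^ (0 + 1)" by simp
      then show "z \<in> {real a / 2 ^ (N + 1) | N a. N \<le> 0 \<and> odd a \<and> a < 2 ^ (N + 1)}" by blast
    qed
  qed
  have 2: "{..2 ^ (0 + 1)} = {0, 1, 2 :: nat}" by (simp add: atMost_nat_numeral atMost_Suc insert_commute)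
  show ?case unfolding 1 2 by (simp add: insert_commute)
next
  case (Suc D)
  have split: "{g N a | N a. N \<le> Suc D \<and> P N a} = {g N a | N a. N \<le> D \<and> P N a} \<union> {g (Suc D) a | a. P (Suc D) a}"
    for g :: "nat \<Rightarrow> nat \<Rightarrow> real" and P by (auto simp: le_Suc_eq)
  have "{real a / 2 ^ (N + 1) | N a. N \<le> Suc D \<and> odd a \<and> a < 2 ^ (N + 1)} =
     {real a / 2 ^ (N + 1) | N a. N \<le> D \<and> odd a \<and> a < 2 ^ (N + 1)} \<union> {real a / 2 ^ (Suc D + 1) | a. odd a \<and> a < 2 ^ (Suc D + 1)}"
    using split[of "\<lambda>N a. real a / 2 ^ (N + 1)" "\<lambda>N a. odd a \<and> a < 2 ^ (N + 1)"] .
  then have "{real a / 2 ^ (N + 1) | N a. N \<le> Suc D \<and> odd a \<and> a < 2 ^ (N + 1)} \<union> {0, 1} =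
     (\<lambda>i. real i / 2 ^ (D + 1)) ` {..2 ^ (D + 1)} \<union> {real a / 2 ^ (Suc D + 1) | a. odd a \<and> a < 2 ^ (Suc D + 1)}"
    unfolding Suc.IH[symmetric] by auto
  also have "\<dots> = (\<lambda>i. real i / 2 ^ (Suc D + 1)) ` {..2 ^ (Suc D + 1)}"
  proof (intro equalityI subsetI)
    fix z assume "z \<in> (\<lambda>i. real i / 2 ^ (D + 1)) ` {..2 ^ (D + 1)} \<union> {real a / 2 ^ (Suc D + 1) | a. odd a \<and> a < 2 ^ (Suc D + 1)}"
    then consider i where "i \<le> 2 ^ (D + 1)" "z = real i / 2 ^ (D + 1)" | a where "z = real a / 2 ^ (Suc D + 1)" "a < 2 ^ (Suc D + 1)" by auto
    then show "z \<in> (\<lambda>i. real i / 2 ^ (Suc D + 1)) ` {..2 ^ (Suc D + 1)}"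
    proof cases
      case 1
      then have "z = real (2 * i) / 2 ^ (Suc D + 1)" "2 * i \<in> {..2 ^ (Suc D + 1)}" by auto
      then show ?thesis by blast
    next
      case 2
      then show ?thesis by auto
    qed
  next
    fix z assume "z \<in> (\<lambda>i. real i / 2 ^ (Suc D + 1)) ` {..2 ^ (Suc D + 1)}"
    then obtain i where i: "i \<le> 2 ^ (Suc D + 1)" "z = real i / 2 ^ (Suc D + 1)" by auto
    show "z \<in> (\<lambda>i. real i / 2 ^ (D + 1)) ` {..2 ^ (D + 1)} \<union> {real a / 2 ^ (Suc D + 1) | a. odd a \<and> a < 2 ^ (Suc D + 1)}"
    proof (cases "odd i")
      case True
      then have "i \<noteq> 2 ^ (Suc D + 1)" by auto
      then show ?thesis using True i by auto
    next
      case False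
      then have "even i" by simp
      then obtain i' where "i = 2 * i'" by (elim evenE)
      then have "z = real i' / 2 ^ (D + 1)" "i' \<in> {..2 ^ (D + 1)}" using i by auto
      then show ?thesis by blast
    qed
  qed
  finally show ?case .
qed

lemma prob_space_coin_prior: "prob_space coin_prior"
  unfolding coin_prior_def by (rule prob_space_PiM) (auto intro: measure_pmf.prob_space_axioms)

lemma coin_prior_full_tree:
  obtains A where "A \<in> sets coin_prior" "emeasure coin_prior A > 0"
    "\<And>c. c \<in> A \<Longrightarrow> knot_set c = (\<lambda>i. real i / 2 ^ (D + 1)) ` {..2 ^ (D + 1)}"
proof -
  let ?M = "\<lambda>(m::nat, a::nat). measure_pmf (bernoulli_pmf ((1/2) ^ m))"
  interpret product_prob_space ?M UNIV
    by (auto simp: product_prob_space_def product_prob_space_axioms_def product_sigma_finite_def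
        intro: prob_space_imp_sigma_finite measure_pmf.prob_space_axioms)
  define J where "J = {1..D + 1} \<times> {..<2 ^ (D + 2) :: nat}"
  \<comment> \<open>The singleton of a truth value: the coin must succeed up to depth D and fail at
    depth D + 1.\<close>
  define X where "X ma = {fst ma \<le> D}" for ma :: "nat \<times> nat"
  define A where "A = {c \<in> space (PiM UNIV ?M). \<forall>ma\<in>J. c ma \<in> X ma}"
  have fJ: "finite J" by (simp add: J_def)
  have XM: "X ma \<in> sets (?M ma)" for ma by (cases ma) auto
  show ?thesis
  proof (rule that[of A])
    show "A \<in> sets coin_prior" unfolding coin_prior_def A_def
      using fJ XM by (intro sets.sets_Collect_finite_All sets_Collect_single') auto
    have "emeasure coin_prior A = (\<Prod>ma\<in>J. emeasure (?M ma) (X ma))"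
      unfolding coin_prior_def A_def by (rule emeasure_PiM_Collect) (use fJ XM in auto)
    also have "\<dots> \<noteq> 0"
    proof -
      have "emeasure (?M ma) (X ma) \<noteq> 0" if "ma \<in> J" for ma
      proof -
        \<comment> \<open>From depth 1 on the success probability lies strictly between 0 and 1, so
          either outcome has positive mass.\<close>
        have "fst ma \<ge> 1" using that by (auto simp: J_def)
        then have "(0::real) < (1/2) ^ fst ma" "(1/2) ^ fst ma < (1::real)" by (auto simp: power_less_one_iff)
        then show ?thesis by (cases ma; cases "fst ma \<le> D") (auto simp: X_def emeasure_pmf_single)
      qed
      then show ?thesis using fJ by simp
    qed
    finally show "emeasure coin_prior A > 0" by (simp add: zero_less_iff_neq_zero)
    fix c assume "c \<in> A"
    then have cJ: "c ma = (fst ma \<le> D)" if "ma \<in> J" for ma using that by (auto simp: A_def X_def)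
    have "node_exists c N a \<longleftrightarrow> N \<le> D \<and> odd a \<and> a < 2 ^ (N + 1)" for N a
      by (rule full_tree_nodes) (auto simp: cJ J_def)
    then show "knot_set c = (\<lambda>i. real i / 2 ^ (D + 1)) ` {..2 ^ (D + 1)}"
      unfolding knot_set_def dyadic_grid[symmetric] by simp
  qed
qed

section \<open>Posterior consistency\<close>

lemma AE_pair_fst:
  assumes "prob_space A" "prob_space B" "AE x in A. P x" and [measurable]: "Measurable.pred A P"
  shows "AE z in A \<Otimes>\<^sub>M B. P (fst z)"
proof -
  interpret A: prob_space A by fact
  interpret B: prob_space B by fact
  interpret pair_prob_space A B ..
  show ?thesis by (rule AE_pair_measure) (use assms(3) in auto)
qed

lemma AE_pair_snd:
  assumes "prob_space A" "prob_space B" "AE y in B. P y" and [measurable]: "Measurable.pred B P"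
  shows "AE z in A \<Otimes>\<^sub>M B. P (snd z)"
proof -
  interpret A: prob_space A by fact
  interpret B: prob_space B by fact
  interpret pair_prob_space A B ..
  show ?thesis by (rule AE_pair_measure) (use assms(3) in auto)
qed

lemma emeasure_Times_pos:
  assumes "prob_space B" "X \<in> sets A" "Y \<in> sets B" "emeasure A X > 0" "emeasure B Y > 0"
  shows "X \<times> Y \<in> sets (A \<Otimes>\<^sub>M B)" "emeasure (A \<Otimes>\<^sub>M B) (X \<times> Y) > 0"
proof -
  interpret B: prob_space B by fact
  show "X \<times> Y \<in> sets (A \<Otimes>\<^sub>M B)" using assms by simp
  show "emeasure (A \<Otimes>\<^sub>M B) (X \<times> Y) > 0"
    using assms by (simp add: B.emeasure_pair_measure_Times ennreal_zero_less_mult_iff)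
qed

locale extremum_spline_model =
  fixes j H :: nat and M c v w d k eps0 a b s0 :: real
    and rho :: "real measure" and f0 :: "real \<Rightarrow> real"
  assumes j: "j \<ge> 1" and H: "H \<ge> 1" and M: "M = -1 \<or> M = 1"
    and c: "c > 0" and hyper: "v > 0" "w > 0" "d > 0" "k > 0" "eps0 > 0"
    and ab: "a \<le> 0" "b \<ge> 1" and s0: "s0 > 0"
    and rho: "prob_space rho" "sets rho = sets borel" and rho_pos: "AE s in rho. s > 0"
    and rho_support: "\<And>e. e > 0 \<Longrightarrow> emeasure rho {s. \<bar>s - s0\<bar> < e} > 0"
    and shape: "f0 \<in> F_G (H - 1)
         \<or> (f0 \<in> F_plus H \<and> ((odd H \<and> M < 0) \<or> (even H \<and> M > 0)))
         \<or> (f0 \<in> F_minus H \<and> ((odd H \<and> M > 0) \<or> (even H \<and> M < 0)))"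
begin

abbreviation "Pr \<equiv> full_prior c v w d k eps0 a b rho"
abbreviation "\<beta>prior \<equiv> beta_coef_prior c v w d k eps0"

lemmas prob_\<beta> = prob_space_beta_coef_prior[OF c hyper]
lemmas prob_\<alpha> = prob_space_alpha_prior[OF ab]

lemma prob_space_full_prior: "prob_space Pr"
  unfolding full_prior_def by (intro prob_space_pair prob_space_coin_prior prob_\<beta> prob_\<alpha> rho)

lemma AE_full_prior: "AE th in Pr. piecewise_mono H (f_of j H M th) \<and> sigma_of th > 0"
proof -
  have "AE z in alpha_prior a b \<Otimes>\<^sub>M rho. snd z > 0"
  proof (rule AE_pair_snd)
    show "Measurable.pred rho (\<lambda>s. s > 0)" unfolding measurable_cong_sets[OF rho(2) refl] by measurable
  qed (use prob_\<alpha> rho rho_pos in simp_all)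
  have ps: "prob_space (alpha_prior a b \<Otimes>\<^sub>M rho)" by (intro prob_space_pair prob_\<alpha> rho)
  have m1: "Measurable.pred (alpha_prior a b \<Otimes>\<^sub>M rho) (\<lambda>z. snd z > 0)"
  proof -
    have [measurable_cong]: "sets rho = sets borel" by (rule rho)
    show ?thesis by measurable
  qed
  have m2: "Measurable.pred \<beta>prior (\<lambda>\<beta>. \<forall>i\<ge>1. \<beta> i \<ge> 0)"
    unfolding measurable_cong_sets[OF sets_beta_coef_prior[OF c hyper] refl] by measurable
  have A1: "AE z in \<beta>prior \<Otimes>\<^sub>M (alpha_prior a b \<Otimes>\<^sub>M rho). snd (snd z) > 0"
    by (rule AE_pair_snd[OF prob_\<beta> ps _ m1]) fact
  have A2: "AE z in \<beta>prior \<Otimes>\<^sub>M (alpha_prior a b \<Otimes>\<^sub>M rho). \<forall>i\<ge>1. fst z i \<ge> 0"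
    by (rule AE_pair_fst[OF prob_\<beta> ps AE_beta_coef_prior[OF c hyper] m2])
  have m: "Measurable.pred (\<beta>prior \<Otimes>\<^sub>M (alpha_prior a b \<Otimes>\<^sub>M rho)) (\<lambda>z. (\<forall>i\<ge>1. fst z i \<ge> 0) \<and> snd (snd z) > 0)"
    by (rule pred_intros_logic(3)[OF measurable_compose[OF measurable_fst m2] measurable_compose[OF measurable_snd m1]])
  have "AE z in \<beta>prior \<Otimes>\<^sub>M (alpha_prior a b \<Otimes>\<^sub>M rho). (\<forall>i\<ge>1. fst z i \<ge> 0) \<and> snd (snd z) > 0"
    using A1 A2 by eventually_elim (rule conjI)
  then have "AE th in Pr. (\<forall>i\<ge>1. fst (snd th) i \<ge> 0) \<and> snd (snd (snd th)) > 0"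
    unfolding full_prior_def by (rule AE_pair_snd[OF prob_space_coin_prior prob_space_pair[OF prob_\<beta> ps] _ m])
  then show ?thesis
  proof eventually_elim
    case (elim th)
    then show ?case
      by (cases th) (auto simp: f_of_def sigma_of_def intro!: spline_fun_piecewise_mono)
  qed
qed

lemma continuous_f0: "continuous_on {0..1} f0"
proof -
  have "C1_on01 f0" using shape by (auto simp: F_G_def F_plus_def F_minus_def)
  then show ?thesis by (auto simp: C1_on01_def intro: DERIV_continuous_on)
qed

lemma bounded_f0: "\<exists>F. \<forall>z\<in>{0..1}. \<bar>f0 z\<bar> \<le> F"
proof -
  have "bounded (f0 ` {0..1})" using continuous_f0 by (intro compact_imp_bounded compact_continuous_image) auto
  then show ?thesis by (auto simp: bounded_real)
qed

text \<open>The prior box surrounds an approximating spline: \<eta> / 2 is spent on approximating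
  f0, and \<eta> / 2 on varying coefficients and roots inside the box.\<close>

lemma prior_support:
  assumes "\<eta> > 0"
  shows "\<exists>B\<in>sets Pr. emeasure Pr B > 0 \<and>
    (\<forall>th\<in>B. \<bar>sigma_of th - s0\<bar> < \<eta> \<and> (\<forall>z\<in>{0..1}. \<bar>f_of j H M th z - f0 z\<bar> \<le> \<eta>))"
proof -
  have "C1_on01 f0" and fin: "finite (interior_extrema f0)" using shape by (auto simp: F_G_def F_plus_def F_minus_def)
  then obtain f' where f': "continuous_on {0..1} f'" "\<And>x. x \<in> {0..1} \<Longrightarrow> (f0 has_real_derivative f' x) (at x within {0..1})"
    by (auto simp: C1_on01_def)
  obtain \<alpha> :: "nat \<Rightarrow> real" where \<alpha>: "\<And>h. \<alpha> h \<in> {0..1}"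
    "\<And>x. x \<in> {0<..<1} - interior_extrema f0 \<Longrightarrow> M * (\<Prod>h<H. x - \<alpha> h) * f' x \<ge> 0"
    using compatible_roots[OF H M shape f'(2)] by blast
  have M0: "M \<noteq> 0" using M by auto
  have \<eta>2: "\<eta> / 2 > 0" using assms by simp
  obtain D \<beta> where \<beta>: "\<And>i. i \<ge> 1 \<Longrightarrow> \<beta> i \<ge> (0::real)"
    and approx: "\<And>cc x. knot_set cc = (\<lambda>i. real i / 2 ^ (D + 1)) ` {..2 ^ (D + 1)} \<Longrightarrow> x \<in> {0..1} \<Longrightarrow> \<bar>spline_fun j H M cc \<beta> \<alpha> x - f0 x\<bar> \<le> \<eta> / 2"
    by (rule spline_approximation[OF j continuous_f0 \<eta>2 local_sign_agreement[OF f' fin \<alpha>(2) M0]]) (assumption | rule that)+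
  define S where "S = (\<lambda>i. real i / 2 ^ (D + 1) :: real) ` {..2 ^ (D + 1)}"
  define n where "n = num_bsplines j S"
  obtain A where A: "A \<in> sets coin_prior" "emeasure coin_prior A > 0" "\<And>cc. cc \<in> A \<Longrightarrow> knot_set cc = S"
    by (rule coin_prior_full_tree[of D, folded S_def]) (assumption | rule that)+
  have S: "finite S" "S \<subseteq> {0..1}"
  proof -
    show "finite S" by (simp add: S_def)
    \<comment> \<open>Positive mass makes \<open>A\<close> nonempty, and any tree in it has its
      knots in [0, 1].\<close>
    obtain cc where "cc \<in> A" using A(2) by (metis all_not_in_conv emeasure_empty less_irrefl)
    then show "S \<subseteq> {0..1}" using A(3) knot_set_unit_interval by metis
  qed
  obtain r where r: "r > 0" and pert: "\<And>cc \<beta>' \<alpha>' x. knot_set cc = S \<Longrightarrow> \<forall>i\<le>n. \<bar>\<beta>' i - \<beta> i\<bar> < r \<Longrightarrow> \<forall>h<H. \<bar>\<alpha>' h - \<alpha> h\<bar> < r \<Longrightarrow>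
     \<bar>spline_fun j H M cc \<beta>' \<alpha>' x - spline_fun j H M cc \<beta> \<alpha> x\<bar> \<le> \<eta> / 2"
    by (rule spline_perturbation[OF S M \<eta>2, where j = j and \<alpha> = \<alpha> and \<beta> = \<beta> and H = H, folded n_def]) (assumption | rule that)+
  define B\<beta> where "B\<beta> = {\<beta>'. \<forall>i\<in>{..n}. \<bar>\<beta>' i - \<beta> i\<bar> < r}"
  define B\<alpha> where "B\<alpha> = {\<alpha>'. \<forall>i\<in>{..<H}. \<bar>\<alpha>' i - \<alpha> i\<bar> < r}"
  define B\<sigma> where "B\<sigma> = {s. \<bar>s - s0\<bar> < \<eta>}"
  have box: "{g. \<forall>i\<in>I. \<bar>g i - g0 i\<bar> < r} \<in> sets (PiM UNIV (\<lambda>_. borel))" if "finite I" for I :: "nat set" and g0 :: "nat \<Rightarrow> real"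
  proof -
    have "{g \<in> space (PiM UNIV (\<lambda>_::nat. borel :: real measure)). \<forall>i\<in>I. \<bar>g i - g0 i\<bar> < r} \<in> sets (PiM UNIV (\<lambda>_. borel))"
      using that by measurable
    then show ?thesis by (simp add: space_PiM)
  qed
  have b: "B\<beta> \<in> sets \<beta>prior" "emeasure \<beta>prior B\<beta> > 0"
    unfolding B\<beta>_def sets_beta_coef_prior[OF c hyper] by (rule box, simp) (rule beta_coef_prior_box_pos[OF c hyper \<beta> r])
  have al: "B\<alpha> \<in> sets (alpha_prior a b)" "emeasure (alpha_prior a b) B\<alpha> > 0"
    unfolding B\<alpha>_def sets_alpha_prior[OF ab] by (rule box, simp) (rule alpha_prior_box_pos[OF ab \<alpha>(1) r])
  have si: "B\<sigma> \<in> sets rho" "emeasure rho B\<sigma> > 0"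
  proof -
    have "B\<sigma> = {s0 - \<eta><..<s0 + \<eta>}" by (auto simp: B\<sigma>_def)
    then show "B\<sigma> \<in> sets rho" by (simp add: rho)
    show "emeasure rho B\<sigma> > 0" unfolding B\<sigma>_def by (rule rho_support[OF assms])
  qed
  note t1 = emeasure_Times_pos[OF rho(1) al(1) si(1) al(2) si(2)]
  note t2 = emeasure_Times_pos[OF prob_space_pair[OF prob_\<alpha> rho(1)] b(1) t1(1) b(2) t1(2)]
  note t3 = emeasure_Times_pos[OF prob_space_pair[OF prob_\<beta> prob_space_pair[OF prob_\<alpha> rho(1)]] A(1) t2(1) A(2) t2(2)]
  show ?thesis
  proof (intro bexI[of _ "A \<times> (B\<beta> \<times> (B\<alpha> \<times> B\<sigma>))"] conjI ballI)
    show "A \<times> (B\<beta> \<times> (B\<alpha> \<times> B\<sigma>)) \<in> sets Pr" "emeasure Pr (A \<times> (B\<beta> \<times> (B\<alpha> \<times> B\<sigma>))) > 0"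
      unfolding full_prior_def by (rule t3)+
    fix th :: param assume "th \<in> A \<times> (B\<beta> \<times> (B\<alpha> \<times> B\<sigma>))"
    then obtain cc \<beta>' \<alpha>' s where th: "th = (cc, \<beta>', \<alpha>', s)" "cc \<in> A" "\<beta>' \<in> B\<beta>" "\<alpha>' \<in> B\<alpha>" "s \<in> B\<sigma>" by auto
    show "\<bar>sigma_of th - s0\<bar> < \<eta>" using th by (simp add: sigma_of_def B\<sigma>_def)
    fix z :: real assume z: "z \<in> {0..1}"
    have "\<bar>spline_fun j H M cc \<beta>' \<alpha>' z - spline_fun j H M cc \<beta> \<alpha> z\<bar> \<le> \<eta> / 2"
      by (rule pert[OF A(3)]) (use th in \<open>auto simp: B\<beta>_def B\<alpha>_def\<close>)
    moreover have "\<bar>spline_fun j H M cc \<beta> \<alpha> z - f0 z\<bar> \<le> \<eta> / 2"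
      by (rule approx[OF _ z]) (use A(3) th in \<open>simp add: S_def\<close>)
    ultimately show "\<bar>f_of j H M th z - f0 z\<bar> \<le> \<eta>" unfolding f_of_def th prod.case by linarith
  qed
qed

text \<open>What both designs share. \<open>P n\<close> stands for the complement of a
  neighbourhood; the last assumption translates it into a mean-square gap or a wrong scale, the two
  alternatives of the likelihood bound.\<close>

lemma posterior_concentration:
  assumes x: "\<And>i. x i \<in> {0..1}" and reg: "regular_noise (\<lambda>i. y i - f0 (x i)) x f0 s0"
    and "q > 0" "\<epsilon> > 0"
    and P: "\<forall>\<^sub>F n in sequentially. \<forall>f s. piecewise_mono H f \<and> s > 0 \<and> P n f s \<longrightarrow>
      q * real n \<le> (\<Sum>i<n. (f (x i) - f0 (x i))\<^sup>2) \<or> \<bar>s / s0 - 1\<bar> \<ge> \<epsilon>"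
  shows "(\<lambda>n. posterior Pr (f_of j H M) n x y (P n)) \<longlonglongrightarrow> 0"
proof -
  obtain F where F: "\<And>i. \<bar>f0 (x i)\<bar> \<le> F" using bounded_f0 x by blast
  obtain \<delta> where \<delta>: "\<delta> > 0" and upper: "\<forall>\<^sub>F n in sequentially. \<forall>f s. piecewise_mono H f \<and> s > 0 \<and>
       (q * real n \<le> (\<Sum>i<n. (f (x i) - f0 (x i))\<^sup>2) \<or> \<bar>s / s0 - 1\<bar> \<ge> \<epsilon>) \<longrightarrow>
       likelihood f s n x y \<le> ennreal (exp (- \<delta> * real n)) * likelihood f0 s0 n x y"
    using likelihood_upper_bound[OF reg F s0 \<open>q > 0\<close> \<open>\<epsilon> > 0\<close>] by blast
  \<comment> \<open>The lower bound is taken at half the rate of the upper one, so that the quotient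
    still decays.\<close>
  have "\<delta> / 2 > 0" using \<delta> by simp
  then obtain \<eta> where \<eta>: "\<eta> > 0" and lower: "\<forall>\<^sub>F n in sequentially. \<forall>f s. s > 0 \<and> (\<forall>i. \<bar>f (x i) - f0 (x i)\<bar> \<le> \<eta>) \<and> \<bar>s - s0\<bar> < \<eta> \<longrightarrow>
       ennreal (exp (- (\<delta> / 2) * real n)) * likelihood f0 s0 n x y \<le> likelihood f s n x y"
    using likelihood_lower_bound[OF reg s0] by blast
  \<comment> \<open>The minimum with s0 keeps the scale positive on \<open>B\<close>.\<close>
  have "min \<eta> s0 > 0" using \<eta> s0 by simp
  from prior_support[OF this] obtain B where B: "B \<in> sets Pr" "emeasure Pr B > 0"
    "\<And>th. th \<in> B \<Longrightarrow> \<bar>sigma_of th - s0\<bar> < min \<eta> s0" "\<And>th z. th \<in> B \<Longrightarrow> z \<in> {0..1} \<Longrightarrow> \<bar>f_of j H M th z - f0 z\<bar> \<le> min \<eta> s0"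
    by blast
  interpret prob_space Pr by (rule prob_space_full_prior)
  show ?thesis
  proof (rule posterior_tendsto_0[where R = "\<lambda>f s. piecewise_mono H f \<and> s > 0", OF _ \<delta> s0 AE_full_prior _ B(1,2)])
    show "emeasure Pr (space Pr) < \<infinity>" by (simp add: emeasure_space_1)
    show "\<forall>\<^sub>F n in sequentially. \<forall>f s. (piecewise_mono H f \<and> s > 0) \<and> P n f s \<longrightarrow>
       likelihood f s n x y \<le> ennreal (exp (- \<delta> * real n)) * likelihood f0 s0 n x y"
      using upper P by eventually_elim blast
    show "\<forall>\<^sub>F n in sequentially. \<forall>th\<in>B.
       ennreal (exp (- (\<delta> / 2) * real n)) * likelihood f0 s0 n x y \<le> likelihood (f_of j H M th) (sigma_of th) n x y"
      using lower
    proof eventually_elim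
      case (elim n)
      show ?case
      proof
        fix th assume th: "th \<in> B"
        have "sigma_of th > 0" "\<bar>sigma_of th - s0\<bar> < \<eta>" using B(3)[OF th] by (simp_all add: abs_less_iff)
        moreover have "\<bar>f_of j H M th (x i) - f0 (x i)\<bar> \<le> \<eta>" for i using B(4)[OF th x[of i]] by simp
        ultimately show "ennreal (exp (- (\<delta> / 2) * real n)) * likelihood f0 s0 n x y \<le> likelihood (f_of j H M th) (sigma_of th) n x y"
          using elim by blast
      qed
    qed
  qed
qed

text \<open>The neighbourhood uses the empirical mean absolute deviation; by Cauchy-Schwarz a value
  of at least e forces a mean square of at least e^2.\<close>

lemma fixed_design_consistency:
  assumes "fixed_design K1 x" "e > 0"
  shows "AE y in data_dist f0 s0 x. (\<lambda>n. posterior Pr (f_of j H M) n x y (\<lambda>f s. \<not> W_nbhd e x n f0 s0 f s)) \<longlonglongrightarrow> 0"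
proof -
  have x: "x i \<in> {0..1}" for i using assms by (simp add: fixed_design_def)
  obtain F where F: "\<And>i. \<bar>f0 (x i)\<bar> \<le> F" using bounded_f0 x by blast
  show ?thesis
    using regular_noise_AE[where x = x and ?f0.0 = f0, OF s0 F]
  proof eventually_elim
    case (elim y)
    show ?case
    proof (rule posterior_concentration[OF x elim, of "e\<^sup>2" e])
      show "\<forall>\<^sub>F n in sequentially. \<forall>f s. piecewise_mono H f \<and> s > 0 \<and> \<not> W_nbhd e x n f0 s0 f s \<longrightarrow>
        e\<^sup>2 * real n \<le> (\<Sum>i<n. (f (x i) - f0 (x i))\<^sup>2) \<or> \<bar>s / s0 - 1\<bar> \<ge> e"
        using eventually_gt_at_top[of 0]
      proof eventually_elim
        case (elim n)
        show ?case
        proof (intro allI impI)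
          fix f s assume *: "piecewise_mono H f \<and> s > 0 \<and> \<not> W_nbhd e x n f0 s0 f s"
          show "e\<^sup>2 * real n \<le> (\<Sum>i<n. (f (x i) - f0 (x i))\<^sup>2) \<or> \<bar>s / s0 - 1\<bar> \<ge> e"
          proof (cases "\<bar>s / s0 - 1\<bar> \<ge> e")
            case False
            then have "(\<Sum>i<n. \<bar>f (x i) - f0 (x i)\<bar>) / real n \<ge> e" using * by (auto simp: W_nbhd_def)
            then have 1: "e * real n \<le> (\<Sum>i<n. \<bar>f (x i) - f0 (x i)\<bar>)" using elim by (simp add: pos_le_divide_eq)
            have "(e * real n)\<^sup>2 \<le> (\<Sum>i<n. \<bar>f (x i) - f0 (x i)\<bar>)\<^sup>2"
              using 1 \<open>e > 0\<close> by (intro power_mono) auto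
            also have "\<dots> \<le> real n * (\<Sum>i<n. (f (x i) - f0 (x i))\<^sup>2)"
              using sum_squared_le_sum_of_squares[of "\<lambda>i. \<bar>f (x i) - f0 (x i)\<bar>" "{..<n}"] by (simp add: mult.commute[of "real n"])
            finally have "real n * (e\<^sup>2 * real n) \<le> real n * (\<Sum>i<n. (f (x i) - f0 (x i))\<^sup>2)"
              by (simp add: power2_eq_square mult_ac)
            then show ?thesis using elim by simp
          qed simp
        qed
      qed
    qed (use \<open>e > 0\<close> in auto)
  qed
qed

text \<open>The design is settled first: for almost every x all points lie in [0, 1], where f0 is
  bounded, and the separation holds. For each such x the noise is then treated conditionally on
  it.\<close>

lemma random_design_consistency:
  fixes Q :: "real measure"
  assumes Q: "prob_space Q" "sets Q = sets borel" "emeasure Q {0..1} = 1" and "e > 0"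
  shows "AE x in PiM UNIV (\<lambda>_. Q). AE y in data_dist f0 s0 x.
    (\<lambda>n. posterior Pr (f_of j H M) n x y (\<lambda>f s. \<not> U_nbhd e Q f0 s0 f s)) \<longlonglongrightarrow> 0"
proof -
  interpret Q: prob_space Q by fact
  obtain q where q: "q > 0" "AE x in PiM (UNIV :: nat set) (\<lambda>_. Q). \<forall>\<^sub>F n in sequentially. \<forall>f.
    piecewise_mono H f \<and> d_Q Q f f0 \<ge> e \<longrightarrow> q * real n \<le> (\<Sum>i<n. (f (x i) - f0 (x i))\<^sup>2)"
    using design_separation_AE[OF Q continuous_f0 \<open>e > 0\<close>] by blast
  have "{0..1} \<in> sets Q" by (simp add: Q(2))
  then have "AE z in Q. z \<in> {0..1}" using Q(3) by (intro Q.AE_in_set_eq_1[THEN iffD2]) (auto simp: measure_def)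
  then have "AE x in PiM (UNIV :: nat set) (\<lambda>_. Q). x i \<in> {0..1}" for i
    using Q(1) by (intro AE_PiM_component) auto
  then have "AE x in PiM (UNIV :: nat set) (\<lambda>_. Q). \<forall>i. x i \<in> {0..1}" unfolding AE_all_countable by blast
  with q(2) show ?thesis
  proof eventually_elim
    case (elim x)
    then have x: "x i \<in> {0..1}" for i by blast
    obtain F where F: "\<And>i. \<bar>f0 (x i)\<bar> \<le> F" using bounded_f0 x by blast
    show ?case
      using regular_noise_AE[where x = x and ?f0.0 = f0, OF s0 F]
    proof eventually_elim
      case y: (elim y)
      show ?case
      proof (rule posterior_concentration[OF x y q(1) \<open>e > 0\<close>])
        show "\<forall>\<^sub>F n in sequentially. \<forall>f s. piecewise_mono H f \<and> s > 0 \<and> \<not> U_nbhd e Q f0 s0 f s \<longrightarrow>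
          q * real n \<le> (\<Sum>i<n. (f (x i) - f0 (x i))\<^sup>2) \<or> \<bar>s / s0 - 1\<bar> \<ge> e"
          using elim(1) by eventually_elim (auto simp: U_nbhd_def not_less)
      qed
    qed
  qed
qed

end

theorem theorem2:
  fixes j H :: nat and M c v w d k eps0 a b s0 :: real
    and rho :: "real measure" and f0 :: "real \<Rightarrow> real"
  assumes "j \<ge> 1" and "H \<ge> 1" and "M = -1 \<or> M = 1"
    and "c > 0" and "v > 0" and "w > 0" and "d > 0" and "k > 0" and "eps0 > 0"
    and "a \<le> 0" and "b \<ge> 1" and "s0 > 0"
    and "prob_space rho" and "sets rho = sets borel" and "AE s in rho. s > 0"
    and "\<forall>e>0. emeasure rho {s. \<bar>s - s0\<bar> < e} > 0"
    and "f0 \<in> F_G (H - 1)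
         \<or> (f0 \<in> F_plus H \<and> ((odd H \<and> M < 0) \<or> (even H \<and> M > 0)))
         \<or> (f0 \<in> F_minus H \<and> ((odd H \<and> M > 0) \<or> (even H \<and> M < 0)))"
  shows
    "(\<forall>K1 x. 0 < K1 \<and> K1 < 1 \<and> fixed_design K1 x \<longrightarrow>
        (\<forall>e>0. AE y in data_dist f0 s0 x.
           (\<lambda>n. posterior (full_prior c v w d k eps0 a b rho) (f_of j H M) n x y
                  (\<lambda>f s. \<not> W_nbhd e x n f0 s0 f s)) \<longlonglongrightarrow> 0))
   \<and> (\<forall>Q. prob_space Q \<and> sets Q = sets borel \<and> emeasure Q {0..1} = 1 \<longrightarrow>
        (\<forall>e>0. AE x in PiM UNIV (\<lambda>_. Q). AE y in data_dist f0 s0 x.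
           (\<lambda>n. posterior (full_prior c v w d k eps0 a b rho) (f_of j H M) n x y
                  (\<lambda>f s. \<not> U_nbhd e Q f0 s0 f s)) \<longlonglongrightarrow> 0))"
proof -
  interpret extremum_spline_model j H M c v w d k eps0 a b s0 rho f0
    by (rule extremum_spline_model.intro; (fact assms | rule assms(16)[rule_format], assumption))
  show ?thesis using fixed_design_consistency random_design_consistency by blast
qed

end
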